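(* Let $H$ be a cocommutative Hopf algebra and let $C(D)_H$ be a Hopf Galois coextension. Then the space $(C\Box_D C)_D$ is a right $H$-module coalgebra, and the map $$\kappa\colon (C\Box_D C)_D\to H,\qquad \kappa=(\varepsilon\otimes\mathrm{Id}_H)\circ can^{-1},$$ is a convolution invertible total cointegral.
   Context: All Hopf algebras, algebras and coalgebras are over a field; every Hopf algebra $H$ has an invertible antipode. Sweedler notation: $\Delta(c)=c^{(1)}\otimes c^{(2)}$. For a right $H$-module coalgebra $C$, let $I=\mathrm{span}\{ch-\varepsilon(h)c\}$ (a coideal), $D=C/I$ the quotient coalgebra and $\pi\colon C\to D$ the projection, which makes $C$ a $D$-bicomodule. $C(D)_H$ is a (right) Hopf Galois coextension if $can\colon C\otimes H\to C\Box_D C$, $c\otimes h\mapsto c^{(1)}\otimes c^{(2)}h$, is bijective. $(C\Box_D C)_D=(C\Box_D C)/W$, where $W$ is the span of all $c\otimes c'^{(1)}\varphi(\pi(c'^{(2)}))-c^{(2)}\otimes c'\varphi(\pi(c^{(1)}))$ with $\varphi\in D^*$ (algebraic dual) and $c\otimes c'\in C\Box_D C$ (sums suppressed). It is a coalgebra via $\Delta(\overline{c\otimes c'})=\overline{c^{(1)}\otimes c'^{(2)}}\otimes\overline{c^{(2)}\otimes c'^{(1)}}$, $\varepsilon(\overline{c\otimes c'})=\varepsilon(c)\varepsilon(c')$, and carries the right $H$-action $(\overline{c\otimes c'})h=\overline{c\otimes c'h}$. The map $\kappa$ is induced on the quotient by $(\varepsilon\otimes\mathrm{Id}_H)\circ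 can^{-1}$ on $C\Box_D C$. For a right $H$-module coalgebra $E$, a total cointegral is a linear map $f\colon E\to H$ with $\varepsilon(f(e))=\varepsilon(e)$ and $f(eh)=f(e)h$; it is convolution invertible if invertible in the convolution algebra $\mathrm{Hom}(E,H)$. *)

theory Defs
  imports "HOL-Algebra.Module" "HOL-Algebra.AbelCoset"
begin

section \<open>Linear algebra over a field K\<close>

text \<open>A vector space over \<open>K\<close> is a \<^locale>\<open>module\<close> over a \<^locale>\<open>field\<close> \<open>K\<close>.  The ring
  multiplication and unit that the record of a module also has are irrelevant unless the space is
  an algebra, and are left \<^const>\<open>undefined\<close> in the constructions below.\<close>

definition lin_hom ::
  "('k, 'r) ring_scheme \<Rightarrow> ('k, 'm, 'x) module_scheme \<Rightarrow> ('k, 'n, 'y) module_scheme \<Rightarrow> ('m \<Rightarrow> 'n) set"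
  where "lin_hom K M N =
    {f. f \<in> carrier M \<rightarrow> carrier N
      \<and> (\<forall>x\<in>carrier M. \<forall>y\<in>carrier M. f (x \<oplus>\<^bsub>M\<^esub> y) = f x \<oplus>\<^bsub>N\<^esub> f y)
      \<and> (\<forall>a\<in>carrier K. \<forall>x\<in>carrier M. f (a \<odot>\<^bsub>M\<^esub> x) = a \<odot>\<^bsub>N\<^esub> f x)}"

definition lin_span ::
  "('k, 'r) ring_scheme \<Rightarrow> ('k, 'm, 'x) module_scheme \<Rightarrow> 'm set \<Rightarrow> 'm set"
  where "lin_span K M A = \<Inter> {N. submodule N K M \<and> A \<subseteq> N}"

definition quot_module :: "('k, 'm, 'x) module_scheme \<Rightarrow> 'm set \<Rightarrow> ('k, 'm set) module"
  where "quot_module M N =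
    \<lparr>carrier = a_rcosets\<^bsub>M\<^esub> N, mult = undefined, one = undefined, zero = N, add = set_add M,
     smult = (\<lambda>a U. \<Union>x\<in>U. N +>\<^bsub>M\<^esub> (a \<odot>\<^bsub>M\<^esub> x))\<rparr>"

text \<open>The map induced by \<open>f\<close> on cosets; meaningful if \<open>f\<close> is constant on every coset.\<close>

definition induced :: "('m \<Rightarrow> 'n) \<Rightarrow> 'm set \<Rightarrow> 'n"
  where "induced f U = the_elem (f ` U)"

definition scalar_module :: "('k, 'r) ring_scheme \<Rightarrow> ('k, 'k) module"
  where "scalar_module K =
    \<lparr>carrier = carrier K, mult = mult K, one = one K, zero = zero K, add = add K, smult = mult K\<rparr>"


section \<open>Tensor products\<close>

definition free_module :: "('k, 'r) ring_scheme \<Rightarrow> 's set \<Rightarrow> ('k, 's \<Rightarrow> 'k) module"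
  where "free_module K S =
    \<lparr>carrier = {f. range f \<subseteq> carrier K \<and> (\<forall>s. s \<notin> S \<longrightarrow> f s = \<zero>\<^bsub>K\<^esub>) \<and> finite {s. f s \<noteq> \<zero>\<^bsub>K\<^esub>}},
     mult = undefined, one = undefined, zero = (\<lambda>s. \<zero>\<^bsub>K\<^esub>), add = (\<lambda>f g s. f s \<oplus>\<^bsub>K\<^esub> g s),
     smult = (\<lambda>a f s. a \<otimes>\<^bsub>K\<^esub> f s)\<rparr>"

definition free_gen :: "('k, 'r) ring_scheme \<Rightarrow> 's \<Rightarrow> 's \<Rightarrow> 'k"
  where "free_gen K s = (\<lambda>t. if t = s then \<one>\<^bsub>K\<^esub> else \<zero>\<^bsub>K\<^esub>)"

definition tensor_rel ::
  "('k, 'r) ring_scheme \<Rightarrow> ('k, 'm, 'x) module_scheme \<Rightarrow> ('k, 'n, 'y) module_scheme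
    \<Rightarrow> ('m \<times> 'n \<Rightarrow> 'k) set"
  where "tensor_rel K M N =
    (let F = free_module K (carrier M \<times> carrier N); g = (\<lambda>m n. free_gen K (m, n)) in
     lin_span K F
      ({g (m \<oplus>\<^bsub>M\<^esub> m') n \<ominus>\<^bsub>F\<^esub> (g m n \<oplus>\<^bsub>F\<^esub> g m' n) | m m' n.
          m \<in> carrier M \<and> m' \<in> carrier M \<and> n \<in> carrier N}
       \<union> {g m (n \<oplus>\<^bsub>N\<^esub> n') \<ominus>\<^bsub>F\<^esub> (g m n \<oplus>\<^bsub>F\<^esub> g m n') | m n n'.
          m \<in> carrier M \<and> n \<in> carrier N \<and> n' \<in> carrier N}
       \<union> {g (a \<odot>\<^bsub>M\<^esub> m) n \<ominus>\<^bsub>F\<^esub> a \<odot>\<^bsub>F\<^esub> g m n | a m n.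
          a \<in> carrier K \<and> m \<in> carrier M \<and> n \<in> carrier N}
       \<union> {g m (a \<odot>\<^bsub>N\<^esub> n) \<ominus>\<^bsub>F\<^esub> a \<odot>\<^bsub>F\<^esub> g m n | a m n.
          a \<in> carrier K \<and> m \<in> carrier M \<and> n \<in> carrier N}))"

definition tensor ::
  "('k, 'r) ring_scheme \<Rightarrow> ('k, 'm, 'x) module_scheme \<Rightarrow> ('k, 'n, 'y) module_scheme
    \<Rightarrow> ('k, ('m \<times> 'n \<Rightarrow> 'k) set) module"
  where "tensor K M N = quot_module (free_module K (carrier M \<times> carrier N)) (tensor_rel K M N)"

definition pure_tensor ::
  "('k, 'r) ring_scheme \<Rightarrow> ('k, 'm, 'x) module_scheme \<Rightarrow> ('k, 'n, 'y) module_scheme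
    \<Rightarrow> 'm \<Rightarrow> 'n \<Rightarrow> ('m \<times> 'n \<Rightarrow> 'k) set"
  where "pure_tensor K M N m n =
    tensor_rel K M N +>\<^bsub>free_module K (carrier M \<times> carrier N)\<^esub> free_gen K (m, n)"

text \<open>For bilinear \<open>b : M \<times> N \<rightarrow> P\<close>, \<open>tlift K P b\<close> is the linear map on the tensor product of
  \<open>M\<close> and \<open>N\<close> sending every pure tensor of \<open>m\<close> and \<open>n\<close> to \<open>b m n\<close>, computed on a representing
  formal sum.  It is how all Sweedler-style formulas are written: if \<open>t\<close> is the sum of the tensors
  of \<open>x\<^sub>i\<close> and \<open>y\<^sub>i\<close>, then \<open>tlift K P b t\<close> is the sum of the \<open>b x\<^sub>i y\<^sub>i\<close>.\<close>

definition tlift ::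
  "('k, 'r) ring_scheme \<Rightarrow> ('k, 'p, 'z) module_scheme \<Rightarrow> ('m \<Rightarrow> 'n \<Rightarrow> 'p) \<Rightarrow> ('m \<times> 'n \<Rightarrow> 'k) set \<Rightarrow> 'p"
  where "tlift K P b t =
    (let f = (SOME f. f \<in> t) in
     \<Oplus>\<^bsub>P\<^esub>z\<in>{z. f z \<noteq> \<zero>\<^bsub>K\<^esub>}. f z \<odot>\<^bsub>P\<^esub> b (fst z) (snd z))"

text \<open>\<open>tmap K M' N' f g\<close> is the tensor product of \<open>f : M \<rightarrow> M'\<close> and \<open>g : N \<rightarrow> N'\<close>.\<close>

definition tmap ::
  "('k, 'r) ring_scheme \<Rightarrow> ('k, 'm2, 'x) module_scheme \<Rightarrow> ('k, 'n2, 'y) module_scheme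
    \<Rightarrow> ('m \<Rightarrow> 'm2) \<Rightarrow> ('n \<Rightarrow> 'n2) \<Rightarrow> ('m \<times> 'n \<Rightarrow> 'k) set \<Rightarrow> ('m2 \<times> 'n2 \<Rightarrow> 'k) set"
  where "tmap K M' N' f g = tlift K (tensor K M' N') (\<lambda>m n. pure_tensor K M' N' (f m) (g n))"

definition tassoc ::
  "('k, 'r) ring_scheme \<Rightarrow> ('k, 'm, 'x) module_scheme \<Rightarrow> ('k, 'n, 'y) module_scheme
    \<Rightarrow> ('k, 'p, 'z) module_scheme
    \<Rightarrow> (('m \<times> 'n \<Rightarrow> 'k) set \<times> 'p \<Rightarrow> 'k) set \<Rightarrow> ('m \<times> ('n \<times> 'p \<Rightarrow> 'k) set \<Rightarrow> 'k) set"
  where "tassoc K M N P =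
    (let T = tensor K M (tensor K N P) in
     tlift K T (\<lambda>t p. tlift K T (\<lambda>m n. pure_tensor K M (tensor K N P) m (pure_tensor K N P n p)) t))"


section \<open>Coalgebras, Hopf algebras, module coalgebras\<close>

record ('k, 'c) coalgebra = "('k, 'c) module" +
  comult :: "'c \<Rightarrow> ('c \<times> 'c \<Rightarrow> 'k) set"
  counit :: "'c \<Rightarrow> 'k"

locale coalgebra = field K + module K C
  for K :: "('k, 'r) ring_scheme" and C :: "('k, 'c, 'x) coalgebra_scheme" +
  assumes comult_linear: "comult C \<in> lin_hom K C (tensor K C C)"
    and counit_linear: "counit C \<in> lin_hom K C (scalar_module K)"
    and coassoc: "c \<in> carrier C \<Longrightarrow>
      tassoc K C C C (tmap K (tensor K C C) C (comult C) id (comult C c))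
        = tmap K C (tensor K C C) id (comult C) (comult C c)"
    and counit_left: "c \<in> carrier C \<Longrightarrow> tlift K C (\<lambda>x y. counit C x \<odot>\<^bsub>C\<^esub> y) (comult C c) = c"
    and counit_right: "c \<in> carrier C \<Longrightarrow> tlift K C (\<lambda>x y. counit C y \<odot>\<^bsub>C\<^esub> x) (comult C c) = c"

definition cocommutative :: "('k, 'r) ring_scheme \<Rightarrow> ('k, 'c, 'x) coalgebra_scheme \<Rightarrow> bool"
  where "cocommutative K C \<longleftrightarrow>
    (\<forall>c\<in>carrier C.
      tlift K (tensor K C C) (\<lambda>x y. pure_tensor K C C y x) (comult C c) = comult C c)"

text \<open>\<open>tensor_act K M N P Q f g t u\<close> applies \<open>f : M \<times> P \<rightarrow> M\<close> and \<open>g : N \<times> Q \<rightarrow> N\<close> factorwise: the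
  tensor of \<open>m\<close> and \<open>n\<close> and the tensor of \<open>p\<close> and \<open>q\<close> go to the tensor of \<open>f m p\<close> and \<open>g n q\<close>.\<close>

definition tensor_act ::
  "('k, 'r) ring_scheme \<Rightarrow> ('k, 'm, 'x) module_scheme \<Rightarrow> ('k, 'n, 'y) module_scheme
    \<Rightarrow> ('m \<Rightarrow> 'p \<Rightarrow> 'm) \<Rightarrow> ('n \<Rightarrow> 'q \<Rightarrow> 'n)
    \<Rightarrow> ('m \<times> 'n \<Rightarrow> 'k) set \<Rightarrow> ('p \<times> 'q \<Rightarrow> 'k) set \<Rightarrow> ('m \<times> 'n \<Rightarrow> 'k) set"
  where "tensor_act K M N f g t u =
    tlift K (tensor K M N)
      (\<lambda>m n. tlift K (tensor K M N) (\<lambda>p q. pure_tensor K M N (f m p) (g n q)) u) t"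

locale bialgebra = ring H + coalgebra K H
  for K :: "('k, 'r) ring_scheme" and H :: "('k, 'h, 'x) coalgebra_scheme" +
  assumes smult_mult_left: "\<lbrakk>a \<in> carrier K; g \<in> carrier H; h \<in> carrier H\<rbrakk> \<Longrightarrow>
      (a \<odot>\<^bsub>H\<^esub> g) \<otimes>\<^bsub>H\<^esub> h = a \<odot>\<^bsub>H\<^esub> (g \<otimes>\<^bsub>H\<^esub> h)"
    and smult_mult_right: "\<lbrakk>a \<in> carrier K; g \<in> carrier H; h \<in> carrier H\<rbrakk> \<Longrightarrow>
      g \<otimes>\<^bsub>H\<^esub> (a \<odot>\<^bsub>H\<^esub> h) = a \<odot>\<^bsub>H\<^esub> (g \<otimes>\<^bsub>H\<^esub> h)"
    and comult_mult: "\<lbrakk>g \<in> carrier H; h \<in> carrier H\<rbrakk> \<Longrightarrow>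
      comult H (g \<otimes>\<^bsub>H\<^esub> h) = tensor_act K H H (mult H) (mult H) (comult H g) (comult H h)"
    and comult_one: "comult H \<one>\<^bsub>H\<^esub> = pure_tensor K H H \<one>\<^bsub>H\<^esub> \<one>\<^bsub>H\<^esub>"
    and counit_mult: "\<lbrakk>g \<in> carrier H; h \<in> carrier H\<rbrakk> \<Longrightarrow>
      counit H (g \<otimes>\<^bsub>H\<^esub> h) = counit H g \<otimes>\<^bsub>K\<^esub> counit H h"
    and counit_one: "counit H \<one>\<^bsub>H\<^esub> = \<one>\<^bsub>K\<^esub>"

definition antipode :: "('k, 'r) ring_scheme \<Rightarrow> ('k, 'h, 'x) coalgebra_scheme \<Rightarrow> ('h \<Rightarrow> 'h) \<Rightarrow> bool"
  where "antipode K H S \<longleftrightarrow> S \<in> lin_hom K H H \<and>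
    (\<forall>h\<in>carrier H.
      tlift K H (\<lambda>x y. S x \<otimes>\<^bsub>H\<^esub> y) (comult H h) = counit H h \<odot>\<^bsub>H\<^esub> \<one>\<^bsub>H\<^esub> \<and>
      tlift K H (\<lambda>x y. x \<otimes>\<^bsub>H\<^esub> S y) (comult H h) = counit H h \<odot>\<^bsub>H\<^esub> \<one>\<^bsub>H\<^esub>)"

text \<open>By convention, all Hopf algebras have an invertible antipode.\<close>

locale hopf_algebra = bialgebra K H
  for K :: "('k, 'r) ring_scheme" and H :: "('k, 'h, 'x) coalgebra_scheme" +
  assumes invertible_antipode: "\<exists>S. antipode K H S \<and> bij_betw S (carrier H) (carrier H)"

locale right_module_coalgebra = H: hopf_algebra K H + C: coalgebra K C
  for K :: "('k, 'r) ring_scheme" and H :: "('k, 'h, 'x) coalgebra_scheme"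
    and C :: "('k, 'c, 'y) coalgebra_scheme" and act :: "'c \<Rightarrow> 'h \<Rightarrow> 'c" +
  assumes act_linear_left: "h \<in> carrier H \<Longrightarrow> (\<lambda>c. act c h) \<in> lin_hom K C C"
    and act_linear_right: "c \<in> carrier C \<Longrightarrow> act c \<in> lin_hom K H C"
    and act_mult: "\<lbrakk>c \<in> carrier C; g \<in> carrier H; h \<in> carrier H\<rbrakk> \<Longrightarrow>
      act c (g \<otimes>\<^bsub>H\<^esub> h) = act (act c g) h"
    and act_one: "c \<in> carrier C \<Longrightarrow> act c \<one>\<^bsub>H\<^esub> = c"
    and comult_act: "\<lbrakk>c \<in> carrier C; h \<in> carrier H\<rbrakk> \<Longrightarrow>
      comult C (act c h) = tensor_act K C C act act (comult C c) (comult H h)"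
    and counit_act: "\<lbrakk>c \<in> carrier C; h \<in> carrier H\<rbrakk> \<Longrightarrow>
      counit C (act c h) = counit C c \<otimes>\<^bsub>K\<^esub> counit H h"


section \<open>The quotient coalgebra D and the cotensor product\<close>

definition coideal ::
  "('k, 'r) ring_scheme \<Rightarrow> ('k, 'h, 'x) coalgebra_scheme \<Rightarrow> ('k, 'c, 'y) coalgebra_scheme
    \<Rightarrow> ('c \<Rightarrow> 'h \<Rightarrow> 'c) \<Rightarrow> 'c set"
  where "coideal K H C act =
    lin_span K C {act c h \<ominus>\<^bsub>C\<^esub> counit H h \<odot>\<^bsub>C\<^esub> c | c h. c \<in> carrier C \<and> h \<in> carrier H}"

definition quot_coalgebra ::
  "('k, 'r) ring_scheme \<Rightarrow> ('k, 'c, 'x) coalgebra_scheme \<Rightarrow> 'c set \<Rightarrow> ('k, 'c set) coalgebra"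
  where "quot_coalgebra K C I =
    (let D = quot_module C I; \<pi> = (\<lambda>c. I +>\<^bsub>C\<^esub> c) in
     module.extend D (coalgebra.fields
       (induced (\<lambda>c. tmap K D D \<pi> \<pi> (comult C c)))
       (induced (counit C))))"

definition right_coaction ::
  "('k, 'r) ring_scheme \<Rightarrow> ('k, 'c, 'x) coalgebra_scheme \<Rightarrow> 'c set
    \<Rightarrow> 'c \<Rightarrow> ('c \<times> 'c set \<Rightarrow> 'k) set"
  where "right_coaction K C I c =
    tmap K C (quot_coalgebra K C I) id (\<lambda>x. I +>\<^bsub>C\<^esub> x) (comult C c)"

definition left_coaction ::
  "('k, 'r) ring_scheme \<Rightarrow> ('k, 'c, 'x) coalgebra_scheme \<Rightarrow> 'c set
    \<Rightarrow> 'c \<Rightarrow> ('c set \<times> 'c \<Rightarrow> 'k) set"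
  where "left_coaction K C I c =
    tmap K (quot_coalgebra K C I) C (\<lambda>x. I +>\<^bsub>C\<^esub> x) id (comult C c)"

definition cotensor ::
  "('k, 'r) ring_scheme \<Rightarrow> ('k, 'd, 'x) module_scheme
    \<Rightarrow> ('k, 'm, 'y) module_scheme \<Rightarrow> ('m \<Rightarrow> ('m \<times> 'd \<Rightarrow> 'k) set)
    \<Rightarrow> ('k, 'n, 'z) module_scheme \<Rightarrow> ('n \<Rightarrow> ('d \<times> 'n \<Rightarrow> 'k) set)
    \<Rightarrow> ('m \<times> 'n \<Rightarrow> 'k) set set"
  where "cotensor K D M \<rho> N \<gamma> =
    {t \<in> carrier (tensor K M N).
      tassoc K M D N (tmap K (tensor K M D) N \<rho> id t) = tmap K M (tensor K D N) id \<gamma> t}"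

text \<open>The cotensor square of \<open>C\<close> over \<open>D = C/I\<close>, as a set.\<close>

definition cotensor_square ::
  "('k, 'r) ring_scheme \<Rightarrow> ('k, 'c, 'x) coalgebra_scheme \<Rightarrow> 'c set \<Rightarrow> ('c \<times> 'c \<Rightarrow> 'k) set set"
  where "cotensor_square K C I =
    cotensor K (quot_coalgebra K C I) C (right_coaction K C I) C (left_coaction K C I)"

definition can ::
  "('k, 'r) ring_scheme \<Rightarrow> ('k, 'c, 'x) coalgebra_scheme \<Rightarrow> ('c \<Rightarrow> 'h \<Rightarrow> 'c)
    \<Rightarrow> ('c \<times> 'h \<Rightarrow> 'k) set \<Rightarrow> ('c \<times> 'c \<Rightarrow> 'k) set"
  where "can K C act =
    tlift K (tensor K C C)
      (\<lambda>c h. tlift K (tensor K C C) (\<lambda>c1 c2. pure_tensor K C C c1 (act c2 h)) (comult C c))"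

locale hopf_galois_coextension = right_module_coalgebra K H C act
  for K :: "('k, 'r) ring_scheme" and H :: "('k, 'h, 'x) coalgebra_scheme"
    and C :: "('k, 'c, 'y) coalgebra_scheme" and act :: "'c \<Rightarrow> 'h \<Rightarrow> 'c" +
  assumes can_bij:
    "bij_betw (can K C act) (carrier (tensor K C H)) (cotensor_square K C (coideal K H C act))"


section \<open>The coalgebra of D-coinvariants of the cotensor square\<close>

text \<open>\<open>coinv_rel\<close> is the subspace \<open>W\<close> of the cotensor square spanned by the differences between
  the right and the left action of functionals \<open>\<phi>\<close> on \<open>D\<close>; the quotient by it is
  \<open>coinv_module\<close>, and \<open>coinv_class x\<close> is the class of \<open>x\<close>.\<close>

definition coinv_rel ::
  "('k, 'r) ring_scheme \<Rightarrow> ('k, 'c, 'x) coalgebra_scheme \<Rightarrow> 'c set \<Rightarrow> ('c \<times> 'c \<Rightarrow> 'k) set set"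
  where "coinv_rel K C I =
    (let T = tensor K C C; \<pi> = (\<lambda>c. I +>\<^bsub>C\<^esub> c) in
     lin_span K T
      {tlift K T (\<lambda>c c'. tlift K T (\<lambda>c1' c2'. \<phi> (\<pi> c2') \<odot>\<^bsub>T\<^esub> pure_tensor K C C c c1') (comult C c')) x
        \<ominus>\<^bsub>T\<^esub>
       tlift K T (\<lambda>c c'. tlift K T (\<lambda>c1 c2. \<phi> (\<pi> c1) \<odot>\<^bsub>T\<^esub> pure_tensor K C C c2 c') (comult C c)) x
       | \<phi> x. \<phi> \<in> lin_hom K (quot_coalgebra K C I) (scalar_module K) \<and> x \<in> cotensor_square K C I})"

definition coinv_module ::
  "('k, 'r) ring_scheme \<Rightarrow> ('k, 'c, 'x) coalgebra_scheme \<Rightarrow> 'c set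
    \<Rightarrow> ('k, ('c \<times> 'c \<Rightarrow> 'k) set set) module"
  where "coinv_module K C I =
    quot_module ((tensor K C C)\<lparr>carrier := cotensor_square K C I\<rparr>) (coinv_rel K C I)"

definition coinv_class ::
  "('k, 'r) ring_scheme \<Rightarrow> ('k, 'c, 'x) coalgebra_scheme \<Rightarrow> 'c set
    \<Rightarrow> ('c \<times> 'c \<Rightarrow> 'k) set \<Rightarrow> ('c \<times> 'c \<Rightarrow> 'k) set set"
  where "coinv_class K C I x = coinv_rel K C I +>\<^bsub>tensor K C C\<^esub> x"

text \<open>In the formula for the comultiplication, the two legs (the tensors of \<open>c\<^sup>1\<close> and \<open>c'\<^sup>2\<close>, and of
  \<open>c\<^sup>2\<close> and \<open>c'\<^sup>1\<close>) of an element of the cotensor square need not lie in the cotensor square one by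
  one.  The formula is therefore read in the tensor square of \<open>ambient_quot\<close>, the quotient of the
  whole of the tensor square of \<open>C\<close> by the same relations, which contains the tensor square of
  \<open>coinv_module\<close>: the carrier of \<open>coinv_module\<close> is literally a subset of that of \<open>ambient_quot\<close>,
  and \<open>ambient_incl\<close> is the (injective) map of tensor squares induced by this inclusion.\<close>

definition ambient_quot ::
  "('k, 'r) ring_scheme \<Rightarrow> ('k, 'c, 'x) coalgebra_scheme \<Rightarrow> 'c set
    \<Rightarrow> ('k, ('c \<times> 'c \<Rightarrow> 'k) set set) module"
  where "ambient_quot K C I = quot_module (tensor K C C) (coinv_rel K C I)"

definition ambient_incl ::
  "('k, 'r) ring_scheme \<Rightarrow> ('k, 'c, 'x) coalgebra_scheme \<Rightarrow> 'c set
    \<Rightarrow> (('c \<times> 'c \<Rightarrow> 'k) set set \<times> ('c \<times> 'c \<Rightarrow> 'k) set set \<Rightarrow> 'k) set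
    \<Rightarrow> (('c \<times> 'c \<Rightarrow> 'k) set set \<times> ('c \<times> 'c \<Rightarrow> 'k) set set \<Rightarrow> 'k) set"
  where "ambient_incl K C I = tmap K (ambient_quot K C I) (ambient_quot K C I) id id"

definition coinv_comult_formula ::
  "('k, 'r) ring_scheme \<Rightarrow> ('k, 'c, 'x) coalgebra_scheme \<Rightarrow> 'c set \<Rightarrow> ('c \<times> 'c \<Rightarrow> 'k) set
    \<Rightarrow> (('c \<times> 'c \<Rightarrow> 'k) set set \<times> ('c \<times> 'c \<Rightarrow> 'k) set set \<Rightarrow> 'k) set"
  where "coinv_comult_formula K C I =
    (let E = ambient_quot K C I; EE = tensor K E E;
         cls = (\<lambda>c c'. coinv_class K C I (pure_tensor K C C c c')) in
     tlift K EE (\<lambda>c c'.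
       tlift K EE (\<lambda>c1 c2.
         tlift K EE (\<lambda>c1' c2'. pure_tensor K E E (cls c1 c2') (cls c2 c1'))
           (comult C c'))
         (comult C c)))"

definition coinv_counit_formula ::
  "('k, 'r) ring_scheme \<Rightarrow> ('k, 'c, 'x) coalgebra_scheme \<Rightarrow> ('c \<times> 'c \<Rightarrow> 'k) set \<Rightarrow> 'k"
  where "coinv_counit_formula K C =
    tlift K (scalar_module K) (\<lambda>c c'. counit C c \<otimes>\<^bsub>K\<^esub> counit C c')"

text \<open>The comultiplication at a class is the unique tensor over \<open>coinv_module\<close> that agrees with the
  formula on every representative of the class.\<close>

definition coinv_coalgebra ::
  "('k, 'r) ring_scheme \<Rightarrow> ('k, 'c, 'x) coalgebra_scheme \<Rightarrow> 'c set
    \<Rightarrow> ('k, ('c \<times> 'c \<Rightarrow> 'k) set set) coalgebra"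
  where "coinv_coalgebra K C I =
    (let Q = coinv_module K C I in
     module.extend Q (coalgebra.fields
       (\<lambda>U. THE t. t \<in> carrier (tensor K Q Q) \<and>
          (\<forall>x\<in>U. ambient_incl K C I t = coinv_comult_formula K C I x))
       (induced (coinv_counit_formula K C))))"

definition coinv_act ::
  "('k, 'r) ring_scheme \<Rightarrow> ('k, 'c, 'x) coalgebra_scheme \<Rightarrow> ('c \<Rightarrow> 'h \<Rightarrow> 'c) \<Rightarrow> 'c set
    \<Rightarrow> ('c \<times> 'c \<Rightarrow> 'k) set set \<Rightarrow> 'h \<Rightarrow> ('c \<times> 'c \<Rightarrow> 'k) set set"
  where "coinv_act K C act I U h =
    induced (\<lambda>x. coinv_class K C I (tmap K C C id (\<lambda>c'. act c' h) x)) U"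

definition translation_map ::
  "('k, 'r) ring_scheme \<Rightarrow> ('k, 'h, 'x) coalgebra_scheme \<Rightarrow> ('k, 'c, 'y) coalgebra_scheme
    \<Rightarrow> ('c \<Rightarrow> 'h \<Rightarrow> 'c) \<Rightarrow> ('c \<times> 'c \<Rightarrow> 'k) set \<Rightarrow> 'h"
  where "translation_map K H C act x =
    tlift K H (\<lambda>c h. counit C c \<odot>\<^bsub>H\<^esub> h) (inv_into (carrier (tensor K C H)) (can K C act) x)"

definition kappa ::
  "('k, 'r) ring_scheme \<Rightarrow> ('k, 'h, 'x) coalgebra_scheme \<Rightarrow> ('k, 'c, 'y) coalgebra_scheme
    \<Rightarrow> ('c \<Rightarrow> 'h \<Rightarrow> 'c) \<Rightarrow> ('c \<times> 'c \<Rightarrow> 'k) set set \<Rightarrow> 'h"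
  where "kappa K H C act = induced (translation_map K H C act)"


section \<open>Total cointegrals and convolution\<close>

definition total_cointegral ::
  "('k, 'r) ring_scheme \<Rightarrow> ('k, 'h, 'x) coalgebra_scheme \<Rightarrow> ('k, 'e, 'y) coalgebra_scheme
    \<Rightarrow> ('e \<Rightarrow> 'h \<Rightarrow> 'e) \<Rightarrow> ('e \<Rightarrow> 'h) \<Rightarrow> bool"
  where "total_cointegral K H E act f \<longleftrightarrow>
    f \<in> lin_hom K E H
    \<and> (\<forall>e\<in>carrier E. counit H (f e) = counit E e)
    \<and> (\<forall>e\<in>carrier E. \<forall>h\<in>carrier H. f (act e h) = f e \<otimes>\<^bsub>H\<^esub> h)"

definition convolution ::
  "('k, 'r) ring_scheme \<Rightarrow> ('k, 'e, 'x) coalgebra_scheme \<Rightarrow> ('k, 'h, 'y) module_scheme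
    \<Rightarrow> ('e \<Rightarrow> 'h) \<Rightarrow> ('e \<Rightarrow> 'h) \<Rightarrow> 'e \<Rightarrow> 'h"
  where "convolution K E H f g e = tlift K H (\<lambda>x y. f x \<otimes>\<^bsub>H\<^esub> g y) (comult E e)"

definition convolution_invertible ::
  "('k, 'r) ring_scheme \<Rightarrow> ('k, 'e, 'x) coalgebra_scheme \<Rightarrow> ('k, 'h, 'y) module_scheme
    \<Rightarrow> ('e \<Rightarrow> 'h) \<Rightarrow> bool"
  where "convolution_invertible K E H f \<longleftrightarrow> f \<in> lin_hom K E H \<and>
    (\<exists>g\<in>lin_hom K E H. \<forall>e\<in>carrier E.
      convolution K E H f g e = counit E e \<odot>\<^bsub>H\<^esub> \<one>\<^bsub>H\<^esub> \<and>
      convolution K E H g f e = counit E e \<odot>\<^bsub>H\<^esub> \<one>\<^bsub>H\<^esub>)"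

end

theory Submission
  imports Defs
begin

text \<open>
  The canonical map identifies the cotensor square with \<open>C \<otimes> H\<close>: it is spanned by the elements
  \<open>cn c h\<close>, the sums of the \<open>c\<^sup>1 \<otimes> c\<^sup>2h\<close>.  A functional \<open>\<phi>\<close> on \<open>D\<close> acts on \<open>C\<close> by the slices
  \<open>c\<^sup>1\<phi>(c\<^sup>2)\<close> and \<open>\<phi>(c\<^sup>1)c\<^sup>2\<close>.  Because \<open>\<pi>(ch) = \<epsilon>(h)\<pi>(c)\<close>, its two actions on \<open>cn c h\<close> are the
  two slices of \<open>c\<close> alone (\<open>ract_cn\<close>, \<open>lact_cn\<close>).  So the relations \<open>W\<close> correspond to \<open>V \<otimes> H\<close>,
  where \<open>V\<close> is spanned by the differences of right and left slices, and a linear map on the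
  cotensor square descends to the quotient as soon as it does not distinguish the slices of \<open>c\<close>
  (\<open>W_vanish\<close>).  For \<open>\<kappa>(cn c h) = \<epsilon>(c)h\<close>, the counit and the action of \<open>H\<close> this is immediate.

  The comultiplication is the delicate part.  At \<open>cn c h\<close> its formula is the sum of the
  \<open>[c\<^sup>1 \<otimes> c\<^sup>3h\<^sup>2] \<otimes> [cn c\<^sup>2 h\<^sup>1]\<close> (\<open>swA_cn\<close>), whose second leg visibly lies in the quotient of the
  cotensor square.  A functional on the second leg turns the formula into the sum of the classes of
  the \<open>c\<^sup>1 \<otimes> \<chi>(c\<^sup>2)c\<^sup>3h\<^sup>2\<close>, where \<open>\<chi>\<close> is a functional on \<open>C\<close> that vanishes on \<open>V\<close>, one for each \<open>h\<^sup>1\<close>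
  (\<open>\<Delta>_second_leg\<close>).  Such a \<open>\<chi>\<close> satisfies \<open>\<pi>(c\<^sup>1)\<chi>(c\<^sup>2) = \<chi>(c\<^sup>1)\<pi>(c\<^sup>2)\<close>, since functionals separate
  the points of \<open>D\<close>, and this puts \<open>c\<^sup>1 \<otimes> \<chi>(c\<^sup>2)c\<^sup>3\<close> into the cotensor square (\<open>cut_CS\<close>).  Moreover,
  the slices of \<open>c\<close> correspond to the two actions on this element, which agree modulo \<open>W\<close>.  As
  tensors over a field are separated by the functionals on one factor
  (\<open>tensor_separate_right\<close>), the first leg lies in the quotient of the cotensor square as well
  (\<open>incl_retr_\<Delta>\<close>), and the formula kills \<open>W\<close> (\<open>\<Delta>_W\<close>).

  Hence the formula is a comultiplication on \<open>(C \<otimes> C)/W\<close>, where \<open>C \<otimes> C\<close> carries the structure of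
  \<open>C \<otimes> C\<^sup>c\<^sup>o\<^sup>p\<close>, and it restricts to the quotient of the cotensor square.  Coassociativity and the
  counit laws are those of \<open>C\<close>.  The action is compatible with it because \<open>H\<close> is cocommutative: the
  reversal in the second factor also reverses the parts of \<open>h\<close>.  Finally \<open>\<kappa>\<close> sends the two legs at
  \<open>cn c h\<close> to \<open>\<epsilon>(c)h\<^sup>2\<close> and \<open>h\<^sup>1\<close>, so by cocommutativity it is a morphism of coalgebras, and its
  convolution inverse is its composition with the antipode.
\<close>

section \<open>Linear maps, subspaces and quotients\<close>

locale scalars = field K for K :: "('k, 'r) ring_scheme" (structure)
begin

abbreviation vs :: "('k, 'm, 'x) module_scheme \<Rightarrow> bool"
  where "vs M \<equiv> module K M"

abbreviation L :: "('k, 'm, 'x) module_scheme \<Rightarrow> ('k, 'n, 'y) module_scheme \<Rightarrow> ('m \<Rightarrow> 'n) set"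
  where "L M N \<equiv> lin_hom K M N"

lemma linI:
  assumes "\<And>x. x \<in> carrier M \<Longrightarrow> f x \<in> carrier N"
    and "\<And>x y. \<lbrakk>x \<in> carrier M; y \<in> carrier M\<rbrakk> \<Longrightarrow> f (x \<oplus>\<^bsub>M\<^esub> y) = f x \<oplus>\<^bsub>N\<^esub> f y"
    and "\<And>a x. \<lbrakk>a \<in> carrier K; x \<in> carrier M\<rbrakk> \<Longrightarrow> f (a \<odot>\<^bsub>M\<^esub> x) = a \<odot>\<^bsub>N\<^esub> f x"
  shows "f \<in> L M N"
  using assms by (auto simp: lin_hom_def)

lemma lin_closed: "\<lbrakk>f \<in> L M N; x \<in> carrier M\<rbrakk> \<Longrightarrow> f x \<in> carrier N"
  and lin_add: "\<lbrakk>f \<in> L M N; x \<in> carrier M; y \<in> carrier M\<rbrakk> \<Longrightarrow> f (x \<oplus>\<^bsub>M\<^esub> y) = f x \<oplus>\<^bsub>N\<^esub> f y"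
  and lin_smult: "\<lbrakk>f \<in> L M N; a \<in> carrier K; x \<in> carrier M\<rbrakk> \<Longrightarrow> f (a \<odot>\<^bsub>M\<^esub> x) = a \<odot>\<^bsub>N\<^esub> f x"
  by (auto simp: lin_hom_def)

lemma vs_zero: "vs M \<Longrightarrow> \<zero>\<^bsub>M\<^esub> \<in> carrier M"
  and vs_add: "\<lbrakk>vs M; x \<in> carrier M; y \<in> carrier M\<rbrakk> \<Longrightarrow> x \<oplus>\<^bsub>M\<^esub> y \<in> carrier M"
  and vs_minus: "\<lbrakk>vs M; x \<in> carrier M; y \<in> carrier M\<rbrakk> \<Longrightarrow> x \<ominus>\<^bsub>M\<^esub> y \<in> carrier M"
  and vs_smult: "\<lbrakk>vs M; a \<in> carrier K; x \<in> carrier M\<rbrakk> \<Longrightarrow> a \<odot>\<^bsub>M\<^esub> x \<in> carrier M"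
proof -
  assume M: "vs M"
  interpret M: module K M by (rule M)
  show "\<zero>\<^bsub>M\<^esub> \<in> carrier M" by simp
  show "\<lbrakk>x \<in> carrier M; y \<in> carrier M\<rbrakk> \<Longrightarrow> x \<oplus>\<^bsub>M\<^esub> y \<in> carrier M" by simp
  show "\<lbrakk>x \<in> carrier M; y \<in> carrier M\<rbrakk> \<Longrightarrow> x \<ominus>\<^bsub>M\<^esub> y \<in> carrier M" by simp
  show "\<lbrakk>a \<in> carrier K; x \<in> carrier M\<rbrakk> \<Longrightarrow> a \<odot>\<^bsub>M\<^esub> x \<in> carrier M" by simp
qed

lemma vs_uminus_eq:
  assumes M: "vs M" and x: "x \<in> carrier M"
  shows "(\<ominus> \<one>) \<odot>\<^bsub>M\<^esub> x = \<ominus>\<^bsub>M\<^esub> x"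
proof -
  interpret M: module K M by (rule M)
  show ?thesis using x by (simp add: M.smult_l_minus)
qed

lemma vs_minus_eq:
  assumes M: "vs M" and x: "x \<in> carrier M" "y \<in> carrier M"
  shows "x \<ominus>\<^bsub>M\<^esub> y = x \<oplus>\<^bsub>M\<^esub> (\<ominus> \<one>) \<odot>\<^bsub>M\<^esub> y"
  using x by (simp add: vs_uminus_eq[OF M] a_minus_def)

lemma vs_minus_self:
  assumes M: "vs M" and x: "x \<in> carrier M" "y \<in> carrier M"
  shows "x \<ominus>\<^bsub>M\<^esub> y = \<zero>\<^bsub>M\<^esub> \<longleftrightarrow> x = y"
proof -
  interpret M: module K M by (rule M)
  show ?thesis using x by (metis M.r_neg M.minus_eq M.minus_equality M.minus_minus M.a_inv_closed M.a_comm)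
qed

lemma lin_zero:
  assumes "f \<in> L M N" "vs M" "vs N"
  shows "f \<zero>\<^bsub>M\<^esub> = \<zero>\<^bsub>N\<^esub>"
proof -
  interpret M: module K M by fact
  interpret N: module K N by fact
  have "f (\<zero> \<odot>\<^bsub>M\<^esub> \<zero>\<^bsub>M\<^esub>) = \<zero> \<odot>\<^bsub>N\<^esub> f \<zero>\<^bsub>M\<^esub>" by (rule lin_smult[OF assms(1)]) auto
  thus ?thesis using lin_closed[OF assms(1) M.zero_closed] by simp
qed

lemma lin_minus:
  assumes "f \<in> L M N" "vs M" "vs N" "x \<in> carrier M" "y \<in> carrier M"
  shows "f (x \<ominus>\<^bsub>M\<^esub> y) = f x \<ominus>\<^bsub>N\<^esub> f y"
proof -
  have "(\<ominus> \<one>) \<in> carrier K" by simp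
  thus ?thesis using assms vs_smult[OF assms(2), of "\<ominus> \<one>" y]
    by (simp add: vs_minus_eq lin_add[OF assms(1)] lin_smult[OF assms(1)] lin_closed[OF assms(1)])
qed

lemma lin_finsum:
  assumes f: "f \<in> L M N" and M: "vs M" and N: "vs N" and g: "g \<in> A \<rightarrow> carrier M" and A: "finite A"
  shows "f (finsum M g A) = finsum N (\<lambda>z. f (g z)) A"
proof -
  interpret M: module K M by fact
  interpret N: module K N by fact
  show ?thesis using A g
  proof (induction A rule: finite_induct)
    case empty thus ?case using lin_zero[OF f M N] by simp
  next
    case (insert z A)
    hence g: "g z \<in> carrier M" "g \<in> A \<rightarrow> carrier M" by auto
    hence "(\<lambda>z. f (g z)) \<in> A \<rightarrow> carrier N" "f (g z) \<in> carrier N"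
      using lin_closed[OF f] by auto
    thus ?case using insert g lin_add[OF f]
      by simp
  qed
qed

lemma lin_id: "(\<lambda>x. x) \<in> L M M"
  by (rule linI) auto

lemma lin_comp: "\<lbrakk>g \<in> L N P; f \<in> L M N\<rbrakk> \<Longrightarrow> (\<lambda>x. g (f x)) \<in> L M P"
  by (auto simp: lin_hom_def Pi_iff)

lemma lin_restrict_dom:
  assumes "f \<in> L M N" "\<And>x. x \<in> carrier M \<Longrightarrow> f' x = f x" "vs M"
  shows "f' \<in> L M N"
  by (rule linI) (simp_all add: assms(2) vs_add[OF assms(3)] vs_smult[OF assms(3)]
    lin_closed[OF assms(1)] lin_add[OF assms(1)] lin_smult[OF assms(1)])

lemma lin_smult_left:
  assumes f: "f \<in> L X (scalar_module K)" and p: "p \<in> carrier P" and P: "vs P"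
  shows "(\<lambda>x. f x \<odot>\<^bsub>P\<^esub> p) \<in> L X P"
proof -
  interpret P: module K P by (rule P)
  have c: "f x \<in> carrier K" if "x \<in> carrier X" for x
    using lin_closed[OF f that] by (simp add: scalar_module_def)
  show ?thesis
    by (rule linI) (auto simp: c p lin_add[OF f] lin_smult[OF f] scalar_module_def P.smult_l_distr
       P.smult_assoc1)
qed

lemma lin_smult_right:
  assumes f: "f \<in> L X P" and a: "a \<in> carrier K" and P: "vs P"
  shows "(\<lambda>x. a \<odot>\<^bsub>P\<^esub> f x) \<in> L X P"
proof -
  interpret P: module K P by (rule P)
  have m: "a \<otimes> b = b \<otimes> a" if "b \<in> carrier K" for b using a that by (rule m_comm)
  show ?thesis
    by (rule linI) (auto simp: a m lin_closed[OF f] lin_add[OF f] lin_smult[OF f] P.smult_r_distr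
       P.smult_assoc1[symmetric])
qed

lemma lin_mult_left:
  assumes f: "f \<in> L X (scalar_module K)" and p: "p \<in> carrier K"
  shows "(\<lambda>x. f x \<otimes> p) \<in> L X (scalar_module K)"
  by (rule linI) (use lin_closed[OF f] in \<open>auto simp: p lin_add[OF f] lin_smult[OF f]
      scalar_module_def l_distr m_assoc\<close>)

lemma lin_mult_right:
  assumes f: "f \<in> L X (scalar_module K)" and p: "p \<in> carrier K"
  shows "(\<lambda>x. p \<otimes> f x) \<in> L X (scalar_module K)"
  by (rule linI) (use lin_closed[OF f] in \<open>auto simp: p lin_add[OF f] lin_smult[OF f]
      scalar_module_def r_distr m_lcomm\<close>)

lemma lin_sum:
  assumes f: "f \<in> L X P" and g: "g \<in> L X P" and P: "vs P"
  shows "(\<lambda>x. f x \<oplus>\<^bsub>P\<^esub> g x) \<in> L X P"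
proof -
  interpret P: module K P by (rule P)
  show ?thesis
    by (rule linI) (simp_all add: lin_closed[OF f] lin_add[OF f] lin_smult[OF f]
       lin_closed[OF g] lin_add[OF g] lin_smult[OF g] P.smult_r_distr P.a_ac)
qed

lemma lin_diff:
  assumes f: "f \<in> L X P" and g: "g \<in> L X P" and P: "vs P"
  shows "(\<lambda>x. f x \<ominus>\<^bsub>P\<^esub> g x) \<in> L X P"
proof -
  interpret P: module K P by (rule P)
  show ?thesis
    by (rule linI) (simp_all add: lin_closed[OF f] lin_add[OF f] lin_smult[OF f]
       lin_closed[OF g] lin_add[OF g] lin_smult[OF g] P.smult_r_distr P.a_ac P.minus_add
       P.minus_eq P.smult_r_minus)
qed

lemma vs_scalar: "vs (scalar_module K)"
  by (rule moduleI)
    (auto simp: scalar_module_def l_distr r_distr m_assoc cring_axioms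
      intro!: abelian_groupI a_assoc a_comm bexI[of _ "\<ominus> _"] l_neg)

lemma carrier_scalar [simp]: "carrier (scalar_module K) = carrier K"
  by (simp add: scalar_module_def)

lemma vs_cong:
  assumes M: "vs M"
    and "carrier M' = carrier M" "add M' = add M" "zero M' = zero M" "smult M' = smult M"
  shows "vs M'"
proof -
  interpret M: module K M by (rule M)
  show ?thesis
    by (rule moduleI)
      (auto simp: assms(2-) cring_axioms M.smult_l_distr M.smult_r_distr M.smult_assoc1
         M.a_ac intro!: abelian_groupI intro: M.l_neg M.a_inv_closed)
qed

lemma subspaceI:
  assumes M: "vs M" and "U \<subseteq> carrier M" "\<zero>\<^bsub>M\<^esub> \<in> U"
    and "\<And>x y. \<lbrakk>x \<in> U; y \<in> U\<rbrakk> \<Longrightarrow> x \<oplus>\<^bsub>M\<^esub> y \<in> U"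
    and "\<And>a x. \<lbrakk>a \<in> carrier K; x \<in> U\<rbrakk> \<Longrightarrow> a \<odot>\<^bsub>M\<^esub> x \<in> U"
  shows "submodule U K M"
proof -
  interpret M: module K M by (rule M)
  have "\<ominus>\<^bsub>M\<^esub> x \<in> U" if "x \<in> U" for x
  proof -
    have "(\<ominus> \<one>) \<odot>\<^bsub>M\<^esub> x \<in> U" using assms that by simp
    thus ?thesis using that assms(2) by (simp add: vs_uminus_eq[OF M] subset_iff)
  qed
  thus ?thesis using assms by (intro M.submoduleI) auto
qed

lemma subspaceD:
  assumes "submodule U K M"
  shows subspace_subset: "U \<subseteq> carrier M" and subspace_zero: "\<zero>\<^bsub>M\<^esub> \<in> U"
    and subspace_add: "\<lbrakk>x \<in> U; y \<in> U\<rbrakk> \<Longrightarrow> x \<oplus>\<^bsub>M\<^esub> y \<in> U"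
    and subspace_smult: "\<lbrakk>a \<in> carrier K; x \<in> U\<rbrakk> \<Longrightarrow> a \<odot>\<^bsub>M\<^esub> x \<in> U"
proof -
  interpret U: submodule U K M by fact
  show "U \<subseteq> carrier M" using U.subset by simp
  show "\<zero>\<^bsub>M\<^esub> \<in> U" using U.one_closed by simp
  show "\<lbrakk>x \<in> U; y \<in> U\<rbrakk> \<Longrightarrow> x \<oplus>\<^bsub>M\<^esub> y \<in> U" using U.m_closed by simp
  show "\<lbrakk>a \<in> carrier K; x \<in> U\<rbrakk> \<Longrightarrow> a \<odot>\<^bsub>M\<^esub> x \<in> U" by simp
qed

lemma subspace_minus:
  assumes "vs M" "submodule U K M" "x \<in> U" "y \<in> U"
  shows "x \<ominus>\<^bsub>M\<^esub> y \<in> U"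
proof -
  have "x \<ominus>\<^bsub>M\<^esub> y = x \<oplus>\<^bsub>M\<^esub> (\<ominus> \<one>) \<odot>\<^bsub>M\<^esub> y"
    using assms subspace_subset[OF assms(2)] by (intro vs_minus_eq) auto
  thus ?thesis using assms by (simp add: subspace_add subspace_smult)
qed

lemma vs_subspace: "\<lbrakk>vs M; submodule U K M\<rbrakk> \<Longrightarrow> vs (M\<lparr>carrier := U\<rparr>)"
  by (rule submodule.submodule_is_module)

lemma subspace_vimage:
  assumes f: "f \<in> L M N" and M: "vs M" and N: "vs N" and U: "submodule U K N"
  shows "submodule {x \<in> carrier M. f x \<in> U} K M"
  by (rule subspaceI[OF M])
    (auto simp: lin_add[OF f] lin_smult[OF f] lin_zero[OF f M N] vs_add[OF M] vs_smult[OF M]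
       vs_zero[OF M] intro: subspaceD[OF U])

lemma subspace_equalizer:
  assumes f: "f \<in> L M N" and g: "g \<in> L M N" and M: "vs M" and N: "vs N"
  shows "submodule {x \<in> carrier M. f x = g x} K M"
  by (rule subspaceI[OF M])
    (auto simp: lin_add[OF f] lin_smult[OF f] lin_zero[OF f M N]
       lin_add[OF g] lin_smult[OF g] lin_zero[OF g M N] vs_add[OF M] vs_smult[OF M] vs_zero[OF M])

lemma subspace_image:
  assumes f: "f \<in> L M N" and M: "vs M" and N: "vs N"
  shows "submodule (f ` carrier M) K N"
proof (rule subspaceI[OF N])
  show "f ` carrier M \<subseteq> carrier N" using lin_closed[OF f] by auto
  show "\<zero>\<^bsub>N\<^esub> \<in> f ` carrier M" using lin_zero[OF f M N] vs_zero[OF M] by (metis imageI)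
qed (auto simp: lin_add[OF f, symmetric] lin_smult[OF f, symmetric] vs_add[OF M] vs_smult[OF M])

lemma span_subspace:
  assumes M: "vs M" and A: "A \<subseteq> carrier M"
  shows "submodule (lin_span K M A) K M"
proof -
  have c: "submodule (carrier M) K M" using M by (rule module.carrier_is_submodule)
  show ?thesis unfolding lin_span_def
  proof (rule subspaceI[OF M])
    show "\<Inter> {N. submodule N K M \<and> A \<subseteq> N} \<subseteq> carrier M" using c A by blast
  qed (auto intro: subspaceD)
qed

lemma span_superset: "A \<subseteq> lin_span K M A"
  by (auto simp: lin_span_def)

lemma span_least: "\<lbrakk>submodule U K M; A \<subseteq> U\<rbrakk> \<Longrightarrow> lin_span K M A \<subseteq> U"
  by (auto simp: lin_span_def)

lemma coset_def': "U +>\<^bsub>M\<^esub> x = {u \<oplus>\<^bsub>M\<^esub> x | u. u \<in> U}"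
  by (auto simp: a_r_coset_def r_coset_def)

lemma abelian_subgroup_of_subspace:
  assumes M: "vs M" and U: "submodule U K M" 
  shows "abelian_subgroup U M"
proof -
  interpret M: module K M by (rule M)
  show ?thesis by (rule abelian_subgroupI3)
    (auto simp: additive_subgroup_def submodule.axioms[OF U] M.abelian_group_axioms)
qed

lemma coset_eq_iff:
  assumes M: "vs M" and U: "submodule U K M" and "x \<in> carrier M" "y \<in> carrier M"
  shows "U +>\<^bsub>M\<^esub> x = U +>\<^bsub>M\<^esub> y \<longleftrightarrow> x \<ominus>\<^bsub>M\<^esub> y \<in> U"
proof -
  interpret abelian_subgroup U M by (rule abelian_subgroup_of_subspace[OF M U])
  have "x \<ominus>\<^bsub>M\<^esub> y \<in> U \<longleftrightarrow> x \<in> U +>\<^bsub>M\<^esub> y"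
    using a_rcos_module[of y x] assms(3,4) by (simp add: minus_eq)
  also have "\<dots> \<longleftrightarrow> U +>\<^bsub>M\<^esub> x = U +>\<^bsub>M\<^esub> y"
    using a_repr_independence'[of x y] a_rcos_self[of x] assms(3,4) by auto
  finally show ?thesis by simp
qed

lemma vs_surj:
  assumes M: "vs M" and q: "q ` carrier M = carrier N"
    and a: "\<And>x y. \<lbrakk>x \<in> carrier M; y \<in> carrier M\<rbrakk> \<Longrightarrow> q x \<oplus>\<^bsub>N\<^esub> q y = q (x \<oplus>\<^bsub>M\<^esub> y)"
    and s: "\<And>a x. \<lbrakk>a \<in> carrier K; x \<in> carrier M\<rbrakk> \<Longrightarrow> a \<odot>\<^bsub>N\<^esub> q x = q (a \<odot>\<^bsub>M\<^esub> x)"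
    and z: "\<zero>\<^bsub>N\<^esub> = q \<zero>\<^bsub>M\<^esub>"
  shows "vs N"
proof -
  interpret M: module K M by (rule M)
  have inv: "\<exists>y\<in>carrier M. q (y \<oplus>\<^bsub>M\<^esub> x) = q \<zero>\<^bsub>M\<^esub>" if "x \<in> carrier M" for x
    using that by (intro bexI[of _ "\<ominus>\<^bsub>M\<^esub> x"]) (auto simp: M.l_neg)
  have asc: "q ((x \<oplus>\<^bsub>M\<^esub> y) \<oplus>\<^bsub>M\<^esub> z) = q (x \<oplus>\<^bsub>M\<^esub> (y \<oplus>\<^bsub>M\<^esub> z))"
    if "x \<in> carrier M" "y \<in> carrier M" "z \<in> carrier M" for x y z
    using that by (simp add: M.a_ac)
  have com: "q (x \<oplus>\<^bsub>M\<^esub> y) = q (y \<oplus>\<^bsub>M\<^esub> x)" if "x \<in> carrier M" "y \<in> carrier M" for x y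
    using that by (simp add: M.a_ac)
  have "abelian_group N"
    by (rule abelian_groupI) (auto simp: q[symmetric] a z asc inv intro: com)
  thus ?thesis
    by (intro moduleI)
      (auto simp: q[symmetric] a s cring_axioms M.smult_l_distr M.smult_r_distr M.smult_assoc1)
qed

lemma quot_carrier: "carrier (quot_module M U) = (\<lambda>x. U +>\<^bsub>M\<^esub> x) ` carrier M"
  by (auto simp: quot_module_def A_RCOSETS_def' coset_def')

lemma coset_self:
  assumes M: "vs M" and U: "submodule U K M" and "x \<in> carrier M"
  shows "x \<in> U +>\<^bsub>M\<^esub> x"
proof -
  interpret abelian_subgroup U M by (rule abelian_subgroup_of_subspace[OF M U])
  show ?thesis using assms by (simp add: a_rcos_self)
qed

lemma coset_memD:
  assumes M: "vs M" and U: "submodule U K M" and "x \<in> carrier M" "y \<in> U +>\<^bsub>M\<^esub> x"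
  shows "y \<in> carrier M" "U +>\<^bsub>M\<^esub> y = U +>\<^bsub>M\<^esub> x" "y \<ominus>\<^bsub>M\<^esub> x \<in> U"
proof -
  interpret abelian_subgroup U M by (rule abelian_subgroup_of_subspace[OF M U])
  show 1: "y \<in> carrier M" using assms a_elemrcos_carrier by blast
  show 2: "U +>\<^bsub>M\<^esub> y = U +>\<^bsub>M\<^esub> x" using assms a_repr_independence' by metis
  show "y \<ominus>\<^bsub>M\<^esub> x \<in> U" using coset_eq_iff[OF M U 1 assms(3)] 2 by simp
qed

lemma quot_add:
  assumes M: "vs M" and U: "submodule U K M" and "x \<in> carrier M" "y \<in> carrier M"
  shows "(U +>\<^bsub>M\<^esub> x) \<oplus>\<^bsub>quot_module M U\<^esub> (U +>\<^bsub>M\<^esub> y) = U +>\<^bsub>M\<^esub> (x \<oplus>\<^bsub>M\<^esub> y)"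
proof -
  interpret abelian_subgroup U M by (rule abelian_subgroup_of_subspace[OF M U])
  show ?thesis using assms by (simp add: quot_module_def a_rcos_sum)
qed

lemma quot_smult:
  assumes M: "vs M" and U: "submodule U K M" and a: "a \<in> carrier K" and x: "x \<in> carrier M"
  shows "a \<odot>\<^bsub>quot_module M U\<^esub> (U +>\<^bsub>M\<^esub> x) = U +>\<^bsub>M\<^esub> (a \<odot>\<^bsub>M\<^esub> x)"
proof -
  have *: "U +>\<^bsub>M\<^esub> (a \<odot>\<^bsub>M\<^esub> y) = U +>\<^bsub>M\<^esub> (a \<odot>\<^bsub>M\<^esub> x)" if y: "y \<in> U +>\<^bsub>M\<^esub> x" for y
  proof -
    note y' = coset_memD[OF M U x y]
    have "(\<lambda>x. a \<odot>\<^bsub>M\<^esub> x) \<in> L M M" by (rule lin_smult_right[OF lin_id a M])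
    from lin_minus[OF this M M y'(1) x] show ?thesis
      using y' x subspace_smult[OF U a y'(3)]
      by (simp add: coset_eq_iff[OF M U] vs_smult[OF M] a)
  qed
  have "(\<Union>y\<in>U +>\<^bsub>M\<^esub> x. U +>\<^bsub>M\<^esub> (a \<odot>\<^bsub>M\<^esub> y)) = (\<Union>y\<in>U +>\<^bsub>M\<^esub> x. U +>\<^bsub>M\<^esub> (a \<odot>\<^bsub>M\<^esub> x))"
    using * by (intro SUP_cong refl)
  also have "\<dots> = U +>\<^bsub>M\<^esub> (a \<odot>\<^bsub>M\<^esub> x)" using coset_self[OF M U x] by blast
  finally show ?thesis by (simp add: quot_module_def)
qed

lemma quot_zero: "vs M \<Longrightarrow> submodule U K M \<Longrightarrow> \<zero>\<^bsub>quot_module M U\<^esub> = U +>\<^bsub>M\<^esub> \<zero>\<^bsub>M\<^esub>"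
proof -
  assume M: "vs M" and U: "submodule U K M"
  interpret M: module K M by (rule M)
  show ?thesis using subspace_subset[OF U] by (simp add: quot_module_def M.a_coset_add_zero)
qed

lemma vs_quot: "\<lbrakk>vs M; submodule U K M\<rbrakk> \<Longrightarrow> vs (quot_module M U)"
  by (rule vs_surj[of M "\<lambda>x. U +>\<^bsub>M\<^esub> x"])
    (simp_all add: quot_carrier quot_add quot_smult quot_zero)

lemma lin_coset: "\<lbrakk>vs M; submodule U K M\<rbrakk> \<Longrightarrow> (\<lambda>x. U +>\<^bsub>M\<^esub> x) \<in> L M (quot_module M U)"
  by (rule linI) (simp_all add: quot_carrier quot_add quot_smult)

lemma coset_eq_zero_iff:
  assumes M: "vs M" and U: "submodule U K M" and x: "x \<in> carrier M"
  shows "U +>\<^bsub>M\<^esub> x = \<zero>\<^bsub>quot_module M U\<^esub> \<longleftrightarrow> x \<in> U"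
proof -
  interpret M: module K M by (rule M)
  show ?thesis
    using coset_eq_iff[OF M U x vs_zero[OF M]] x
    by (simp add: quot_zero[OF M U] vs_minus_eq[OF M] M.smult_r_null)
qed

lemma induced_coset:
  assumes M: "vs M" and U: "submodule U K M" and N: "vs N"
    and f: "f \<in> L M N" and U0: "\<And>u. u \<in> U \<Longrightarrow> f u = \<zero>\<^bsub>N\<^esub>" and x: "x \<in> carrier M"
  shows "induced f (U +>\<^bsub>M\<^esub> x) = f x"
proof -
  have fxy: "f y = f x" if y: "y \<in> U +>\<^bsub>M\<^esub> x" for y
  proof -
    note y' = coset_memD[OF M U x y]
    have "f y \<ominus>\<^bsub>N\<^esub> f x = \<zero>\<^bsub>N\<^esub>" using lin_minus[OF f M N y'(1) x] U0[OF y'(3)] by simp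
    thus ?thesis using vs_minus_self[OF N] lin_closed[OF f] y'(1) x by blast
  qed
  have "x \<in> U +>\<^bsub>M\<^esub> x" by (rule coset_self[OF M U x])
  with fxy have "f ` (U +>\<^bsub>M\<^esub> x) = {f x}" by blast
  thus ?thesis by (simp add: induced_def)
qed

lemma lin_from_quot:
  assumes M: "vs M" and U: "submodule U K M" and f: "f \<in> L M N"
    and g: "\<And>x. x \<in> carrier M \<Longrightarrow> g (U +>\<^bsub>M\<^esub> x) = f x"
  shows "g \<in> L (quot_module M U) N"
proof (rule linI)
  fix x assume "x \<in> carrier (quot_module M U)"
  then obtain x' where x: "x' \<in> carrier M" "x = U +>\<^bsub>M\<^esub> x'" by (auto simp: quot_carrier)
  show "g x \<in> carrier N" using x by (simp add: g lin_closed[OF f])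
  fix y assume "y \<in> carrier (quot_module M U)"
  then obtain y' where y: "y' \<in> carrier M" "y = U +>\<^bsub>M\<^esub> y'" by (auto simp: quot_carrier)
  show "g (x \<oplus>\<^bsub>quot_module M U\<^esub> y) = g x \<oplus>\<^bsub>N\<^esub> g y"
    using x y by (simp add: quot_add[OF M U] g vs_add[OF M] lin_add[OF f])
next
  fix a x assume a: "a \<in> carrier K" and "x \<in> carrier (quot_module M U)"
  then obtain x' where x: "x' \<in> carrier M" "x = U +>\<^bsub>M\<^esub> x'" by (auto simp: quot_carrier)
  show "g (a \<odot>\<^bsub>quot_module M U\<^esub> x) = a \<odot>\<^bsub>N\<^esub> g x"
    using x a by (simp add: quot_smult[OF M U] g vs_smult[OF M] lin_smult[OF f])
qed

lemma lin_induced: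
  assumes M: "vs M" and U: "submodule U K M" and N: "vs N"
    and f: "f \<in> L M N" and U0: "\<And>u. u \<in> U \<Longrightarrow> f u = \<zero>\<^bsub>N\<^esub>"
  shows "induced f \<in> L (quot_module M U) N"
  by (rule lin_from_quot[OF M U f]) (rule induced_coset[OF assms])


section \<open>Complements and functionals\<close>

lemma subspace_adjoin:
  assumes M: "vs M" and N: "submodule N K M" and x: "x \<in> carrier M"
  shows "submodule {n \<oplus>\<^bsub>M\<^esub> a \<odot>\<^bsub>M\<^esub> x | n a. n \<in> N \<and> a \<in> carrier K} K M" (is "submodule ?N K M")
proof -
  interpret M: module K M by (rule M)
  note D = subspaceD[OF N]
  have N': "n \<in> carrier M" if "n \<in> N" for n using that D(1) by auto
  show ?thesis
  proof (rule subspaceI[OF M])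
    show "?N \<subseteq> carrier M" using x by (auto simp: N')
    show "\<zero>\<^bsub>M\<^esub> \<in> ?N" using D(2) x by (auto intro!: exI[of _ "\<zero>\<^bsub>M\<^esub>"] exI[of _ "\<zero>"])
  next
    fix u v assume "u \<in> ?N" "v \<in> ?N"
    then obtain n a m b where *: "u = n \<oplus>\<^bsub>M\<^esub> a \<odot>\<^bsub>M\<^esub> x" "v = m \<oplus>\<^bsub>M\<^esub> b \<odot>\<^bsub>M\<^esub> x"
      "n \<in> N" "a \<in> carrier K" "m \<in> N" "b \<in> carrier K" by auto
    hence "u \<oplus>\<^bsub>M\<^esub> v = (n \<oplus>\<^bsub>M\<^esub> m) \<oplus>\<^bsub>M\<^esub> (a \<oplus> b) \<odot>\<^bsub>M\<^esub> x"
      using x by (simp add: N' M.smult_l_distr M.a_ac)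
    thus "u \<oplus>\<^bsub>M\<^esub> v \<in> ?N" using * D(3) by blast
  next
    fix c u assume c: "c \<in> carrier K" and "u \<in> ?N"
    then obtain n a where *: "u = n \<oplus>\<^bsub>M\<^esub> a \<odot>\<^bsub>M\<^esub> x" "n \<in> N" "a \<in> carrier K" by auto
    hence "c \<odot>\<^bsub>M\<^esub> u = c \<odot>\<^bsub>M\<^esub> n \<oplus>\<^bsub>M\<^esub> (c \<otimes> a) \<odot>\<^bsub>M\<^esub> x"
      using x c by (simp add: N' M.smult_r_distr M.smult_assoc1)
    thus "c \<odot>\<^bsub>M\<^esub> u \<in> ?N" using * c D(4) by blast
  qed
qed

lemma subspace_zero_space: "vs M \<Longrightarrow> submodule {\<zero>\<^bsub>M\<^esub>} K M"
proof -
  assume M: "vs M"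
  interpret M: module K M by (rule M)
  show ?thesis by (rule subspaceI[OF M]) auto
qed

text \<open>A maximal subspace \<open>N\<close> that meets \<open>U\<close> only in zero is a complement: a vector outside \<open>U + N\<close>
  could be adjoined to \<open>N\<close>.\<close>

lemma complement_exists:
  assumes M: "vs M" and U: "submodule U K M"
  obtains N where "submodule N K M" "U \<inter> N = {\<zero>\<^bsub>M\<^esub>}"
    "\<And>x. x \<in> carrier M \<Longrightarrow> \<exists>u\<in>U. \<exists>n\<in>N. x = u \<oplus>\<^bsub>M\<^esub> n"
proof -
  interpret M: module K M by (rule M)
  let ?A = "{N. submodule N K M \<and> U \<inter> N = {\<zero>\<^bsub>M\<^esub>}}"
  have U': "u \<in> carrier M" if "u \<in> U" for u using that subspace_subset[OF U] by auto
  have "\<exists>N\<in>?A. \<forall>X\<in>?A. N \<subseteq> X \<longrightarrow> X = N"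
  proof (rule subset_Zorn_nonempty)
    have "{\<zero>\<^bsub>M\<^esub>} \<in> ?A" using subspace_zero_space[OF M] subspace_zero[OF U] by auto
    thus "?A \<noteq> {}" by blast
  next
    fix \<C> assume ne: "\<C> \<noteq> {}" and ch: "subset.chain ?A \<C>"
    have sub: "submodule N K M" "U \<inter> N = {\<zero>\<^bsub>M\<^esub>}" if "N \<in> \<C>" for N
      using ch that by (auto simp: subset.chain_def)
    have "submodule (\<Union>\<C>) K M"
    proof (rule subspaceI[OF M])
      show "\<Union>\<C> \<subseteq> carrier M" using sub(1) subspace_subset by blast
      show "\<zero>\<^bsub>M\<^esub> \<in> \<Union>\<C>" using ne sub(1) subspace_zero by blast
      show "a \<odot>\<^bsub>M\<^esub> x \<in> \<Union>\<C>" if "a \<in> carrier K" "x \<in> \<Union>\<C>" for a x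
      proof -
        obtain X where X: "X \<in> \<C>" "x \<in> X" using \<open>x \<in> \<Union>\<C>\<close> by blast
        from subspace_smult[OF sub(1)[OF X(1)] \<open>a \<in> carrier K\<close> X(2)] X(1) show ?thesis by blast
      qed
      fix x y assume "x \<in> \<Union>\<C>" "y \<in> \<Union>\<C>"
      then obtain X Y where XY: "X \<in> \<C>" "Y \<in> \<C>" "x \<in> X" "y \<in> Y" by auto
      hence "X \<subseteq> Y \<or> Y \<subseteq> X" using ch unfolding subset.chain_def by blast
      then obtain Z where Z: "Z \<in> \<C>" "x \<in> Z" "y \<in> Z" using XY by blast
      from subspace_add[OF sub(1)[OF Z(1)] Z(2,3)] Z(1) show "x \<oplus>\<^bsub>M\<^esub> y \<in> \<Union>\<C>" by blast
    qed
    moreover have "U \<inter> \<Union>\<C> = {\<zero>\<^bsub>M\<^esub>}" using sub(2) ne by blast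
    ultimately show "\<Union>\<C> \<in> ?A" by (intro CollectI conjI)
  qed
  then obtain N where NA: "N \<in> ?A" and mx': "\<forall>X\<in>?A. N \<subseteq> X \<longrightarrow> X = N" by (rule bexE)
  have N: "submodule N K M" "U \<inter> N = {\<zero>\<^bsub>M\<^esub>}" using NA by auto
  have mx: "X = N" if "submodule X K M" "U \<inter> X = {\<zero>\<^bsub>M\<^esub>}" "N \<subseteq> X" for X
    using mx' that by simp
  have N': "n \<in> carrier M" if "n \<in> N" for n using that subspace_subset[OF N(1)] by auto
  have "\<exists>u\<in>U. \<exists>n\<in>N. x = u \<oplus>\<^bsub>M\<^esub> n" if x: "x \<in> carrier M" for x
  proof (rule ccontr)
    assume no: "\<not> ?thesis"
    let ?N = "{n \<oplus>\<^bsub>M\<^esub> a \<odot>\<^bsub>M\<^esub> x | n a. n \<in> N \<and> a \<in> carrier K}"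
    have "u = \<zero>\<^bsub>M\<^esub>" if u: "u \<in> U" "u \<in> ?N" for u
    proof -
      from u obtain n a where *: "u = n \<oplus>\<^bsub>M\<^esub> a \<odot>\<^bsub>M\<^esub> x" "n \<in> N" "a \<in> carrier K" by auto
      show ?thesis
      proof (cases "a = \<zero>")
        case True
        hence "u = n" using * x N' by simp
        thus ?thesis using u * N(2) by blast
      next
        case False
        hence a: "inv a \<in> carrier K" "inv a \<otimes> a = \<one>" using *(3) by (auto simp: field_Units)
        have "x = (inv a \<otimes> a) \<odot>\<^bsub>M\<^esub> x" using a x by simp
        also have "\<dots> = inv a \<odot>\<^bsub>M\<^esub> (a \<odot>\<^bsub>M\<^esub> x)" using a * x M.smult_assoc1 by blast
        also have ax: "a \<odot>\<^bsub>M\<^esub> x = u \<oplus>\<^bsub>M\<^esub> (\<ominus> \<one>) \<odot>\<^bsub>M\<^esub> n"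
        proof -
          have c: "n \<in> carrier M" "a \<odot>\<^bsub>M\<^esub> x \<in> carrier M" using * x N' by auto
          have "u \<oplus>\<^bsub>M\<^esub> \<ominus>\<^bsub>M\<^esub> n = (a \<odot>\<^bsub>M\<^esub> x \<oplus>\<^bsub>M\<^esub> n) \<oplus>\<^bsub>M\<^esub> \<ominus>\<^bsub>M\<^esub> n"
            using *(1) c by (simp add: M.a_comm)
          also have "\<dots> = a \<odot>\<^bsub>M\<^esub> x" using c by (simp add: M.a_assoc M.r_neg)
          finally show ?thesis using c by (simp add: vs_uminus_eq[OF M])
        qed
        also have "inv a \<odot>\<^bsub>M\<^esub> (u \<oplus>\<^bsub>M\<^esub> (\<ominus> \<one>) \<odot>\<^bsub>M\<^esub> n) = inv a \<odot>\<^bsub>M\<^esub> u \<oplus>\<^bsub>M\<^esub> inv a \<odot>\<^bsub>M\<^esub> ((\<ominus> \<one>) \<odot>\<^bsub>M\<^esub> n)"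
          using a u(1) * N' U' by (simp add: M.smult_r_distr)
        finally have "x = inv a \<odot>\<^bsub>M\<^esub> u \<oplus>\<^bsub>M\<^esub> inv a \<odot>\<^bsub>M\<^esub> ((\<ominus> \<one>) \<odot>\<^bsub>M\<^esub> n)" .
        moreover have "inv a \<odot>\<^bsub>M\<^esub> u \<in> U" "inv a \<odot>\<^bsub>M\<^esub> ((\<ominus> \<one>) \<odot>\<^bsub>M\<^esub> n) \<in> N"
          using a u(1) *(2) subspace_smult[OF U] subspace_smult[OF N(1)] by auto
        ultimately show ?thesis using no by blast
      qed
    qed
    moreover have sN: "submodule ?N K M" by (rule subspace_adjoin[OF M N(1) x])
    ultimately have "U \<inter> ?N = {\<zero>\<^bsub>M\<^esub>}" using subspace_zero[OF U] subspace_zero[OF sN] by blast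
    moreover have "N \<subseteq> ?N"
    proof
      fix n assume "n \<in> N"
      moreover hence "n = n \<oplus>\<^bsub>M\<^esub> \<zero> \<odot>\<^bsub>M\<^esub> x" using x N' by simp
      ultimately show "n \<in> ?N" by blast
    qed
    ultimately have "?N = N" using mx sN by blast
    moreover have "x = \<zero>\<^bsub>M\<^esub> \<oplus>\<^bsub>M\<^esub> \<one> \<odot>\<^bsub>M\<^esub> x" using x by simp
    hence "x \<in> ?N" using subspace_zero[OF N(1)] by blast
    ultimately have "x \<in> N" by simp
    moreover have "x = \<zero>\<^bsub>M\<^esub> \<oplus>\<^bsub>M\<^esub> x" using x by simp
    ultimately show False using no subspace_zero[OF U] by blast
  qed
  thus ?thesis using that N by blast
qed

lemma minus_cancel_right:
  assumes M: "vs M" and c: "x \<in> carrier M" "y \<in> carrier M" "z \<in> carrier M"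
  shows "(x \<oplus>\<^bsub>M\<^esub> z) \<ominus>\<^bsub>M\<^esub> (y \<oplus>\<^bsub>M\<^esub> z) = x \<ominus>\<^bsub>M\<^esub> y"
proof -
  interpret M: module K M by (rule M)
  have "(x \<oplus>\<^bsub>M\<^esub> z) \<oplus>\<^bsub>M\<^esub> (\<ominus>\<^bsub>M\<^esub> z \<oplus>\<^bsub>M\<^esub> \<ominus>\<^bsub>M\<^esub> y) = x \<oplus>\<^bsub>M\<^esub> (z \<oplus>\<^bsub>M\<^esub> (\<ominus>\<^bsub>M\<^esub> z \<oplus>\<^bsub>M\<^esub> \<ominus>\<^bsub>M\<^esub> y))"
    using c by (simp add: M.a_assoc)
  also have "\<dots> = x \<oplus>\<^bsub>M\<^esub> \<ominus>\<^bsub>M\<^esub> y" using c by (simp add: M.r_neg2)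
  finally show ?thesis using c by (simp add: M.minus_eq M.minus_add M.a_comm)
qed

lemma minus_cancel_left:
  assumes M: "vs M" and c: "x \<in> carrier M" "y \<in> carrier M" "z \<in> carrier M"
  shows "(z \<oplus>\<^bsub>M\<^esub> x) \<ominus>\<^bsub>M\<^esub> (z \<oplus>\<^bsub>M\<^esub> y) = x \<ominus>\<^bsub>M\<^esub> y"
proof -
  interpret M: module K M by (rule M)
  show ?thesis using minus_cancel_right[OF assms] c by (simp add: M.a_comm)
qed

lemma retraction_exists:
  assumes M: "vs M" and U: "submodule U K M"
  obtains p where "p \<in> L M M" "\<And>x. x \<in> carrier M \<Longrightarrow> p x \<in> U" "\<And>u. u \<in> U \<Longrightarrow> p u = u"
proof -
  interpret M: module K M by (rule M)
  obtain N where N: "submodule N K M" "U \<inter> N = {\<zero>\<^bsub>M\<^esub>}"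
    and ex: "\<And>x. x \<in> carrier M \<Longrightarrow> \<exists>u\<in>U. \<exists>n\<in>N. x = u \<oplus>\<^bsub>M\<^esub> n"
    using complement_exists[OF M U] by blast
  have U': "u \<in> carrier M" if "u \<in> U" for u using that subspace_subset[OF U] by auto
  have N': "n \<in> carrier M" if "n \<in> N" for n using that subspace_subset[OF N(1)] by auto
  have uniq: "u = u'" if "u \<in> U" "u' \<in> U" "n \<in> N" "n' \<in> N" "u \<oplus>\<^bsub>M\<^esub> n = u' \<oplus>\<^bsub>M\<^esub> n'" for u u' n n'
  proof -
    have c: "u \<in> carrier M" "u' \<in> carrier M" "n \<in> carrier M" "n' \<in> carrier M" using that U' N' by auto
    have "u \<ominus>\<^bsub>M\<^esub> u' = (u \<oplus>\<^bsub>M\<^esub> n) \<ominus>\<^bsub>M\<^esub> (u' \<oplus>\<^bsub>M\<^esub> n)"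
      using c by (simp add: minus_cancel_right[OF M])
    also have "\<dots> = (u' \<oplus>\<^bsub>M\<^esub> n') \<ominus>\<^bsub>M\<^esub> (u' \<oplus>\<^bsub>M\<^esub> n)" using that by simp
    also have "\<dots> = n' \<ominus>\<^bsub>M\<^esub> n"
      using c by (simp add: minus_cancel_left[OF M])
    finally have eq: "u \<ominus>\<^bsub>M\<^esub> u' = n' \<ominus>\<^bsub>M\<^esub> n" .
    have "u \<ominus>\<^bsub>M\<^esub> u' \<in> U" by (rule subspace_minus[OF M U that(1,2)])
    moreover have "u \<ominus>\<^bsub>M\<^esub> u' \<in> N"
      unfolding eq by (rule subspace_minus[OF M N(1) that(4,3)])
    ultimately have "u \<ominus>\<^bsub>M\<^esub> u' \<in> U \<inter> N" by blast
    hence "u \<ominus>\<^bsub>M\<^esub> u' = \<zero>\<^bsub>M\<^esub>" using N(2) by blast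
    thus ?thesis using vs_minus_self[OF M c(1,2)] by simp
  qed
  define p where "p x = (SOME u. u \<in> U \<and> (\<exists>n\<in>N. x = u \<oplus>\<^bsub>M\<^esub> n))" for x
  have p: "p x \<in> U \<and> (\<exists>n\<in>N. x = p x \<oplus>\<^bsub>M\<^esub> n)" if "x \<in> carrier M" for x
    unfolding p_def by (rule someI_ex) (use ex[OF that] in blast)
  have pI: "p x = u" if "x = u \<oplus>\<^bsub>M\<^esub> n" "u \<in> U" "n \<in> N" for x u n
  proof -
    have "x \<in> carrier M" using that U' N' by simp
    then obtain n' where "p x \<in> U" "n' \<in> N" "x = p x \<oplus>\<^bsub>M\<^esub> n'" using p by blast
    thus ?thesis using uniq[of "p x" u n' n] that by simp
  qed
  have "p \<in> L M M"
  proof (rule linI)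
    fix x assume x: "x \<in> carrier M"
    show "p x \<in> carrier M" using p[OF x] U' by blast
    fix y assume y: "y \<in> carrier M"
    from p[OF x] p[OF y] obtain n m where *: "n \<in> N" "x = p x \<oplus>\<^bsub>M\<^esub> n" "m \<in> N" "y = p y \<oplus>\<^bsub>M\<^esub> m"
      and pu: "p x \<in> U" "p y \<in> U" by blast
    have c: "p x \<in> carrier M" "n \<in> carrier M" "p y \<in> carrier M" "m \<in> carrier M"
      using pu * U' N' by auto
    have "x \<oplus>\<^bsub>M\<^esub> y = (p x \<oplus>\<^bsub>M\<^esub> n) \<oplus>\<^bsub>M\<^esub> (p y \<oplus>\<^bsub>M\<^esub> m)" using * by simp
    also have "\<dots> = (p x \<oplus>\<^bsub>M\<^esub> p y) \<oplus>\<^bsub>M\<^esub> (n \<oplus>\<^bsub>M\<^esub> m)" using c by (simp add: M.a_ac)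
    finally show "p (x \<oplus>\<^bsub>M\<^esub> y) = p x \<oplus>\<^bsub>M\<^esub> p y"
      by (rule pI) (use pu * subspace_add[OF U] subspace_add[OF N(1)] in auto)
  next
    fix a x assume a: "a \<in> carrier K" and x: "x \<in> carrier M"
    from p[OF x] obtain n where *: "n \<in> N" "x = p x \<oplus>\<^bsub>M\<^esub> n" and pu: "p x \<in> U" by blast
    have "a \<odot>\<^bsub>M\<^esub> x = a \<odot>\<^bsub>M\<^esub> (p x \<oplus>\<^bsub>M\<^esub> n)" using * by simp
    also have "\<dots> = a \<odot>\<^bsub>M\<^esub> p x \<oplus>\<^bsub>M\<^esub> a \<odot>\<^bsub>M\<^esub> n" using pu *(1) a U' N' by (simp add: M.smult_r_distr)
    finally show "p (a \<odot>\<^bsub>M\<^esub> x) = a \<odot>\<^bsub>M\<^esub> p x"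
      by (rule pI) (use pu * a subspace_smult[OF U] subspace_smult[OF N(1)] in auto)
  qed
  moreover have "p u = u" if "u \<in> U" for u
    by (rule pI[of _ _ "\<zero>\<^bsub>M\<^esub>"]) (use that U' subspace_zero[OF N(1)] in auto)
  ultimately show ?thesis using that p by blast
qed

lemma smult_eq_zeroD:
  assumes M: "vs M" and x: "x \<in> carrier M" "x \<noteq> \<zero>\<^bsub>M\<^esub>" and a: "a \<in> carrier K" "a \<odot>\<^bsub>M\<^esub> x = \<zero>\<^bsub>M\<^esub>"
  shows "a = \<zero>"
proof (rule ccontr)
  interpret M: module K M by (rule M)
  assume "a \<noteq> \<zero>"
  hence i: "inv a \<in> carrier K" "inv a \<otimes> a = \<one>" using a(1) by (auto simp: field_Units)
  have "x = (inv a \<otimes> a) \<odot>\<^bsub>M\<^esub> x" using i x by simp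
  also have "\<dots> = inv a \<odot>\<^bsub>M\<^esub> (a \<odot>\<^bsub>M\<^esub> x)" using i a x M.smult_assoc1 by blast
  finally show False using a i x by simp
qed

lemma rank_one_factor:
  assumes M: "vs M" and N: "vs N" and x: "x \<in> carrier N" and f: "f \<in> L M N"
    and im: "\<And>y. y \<in> carrier M \<Longrightarrow> \<exists>a\<in>carrier K. f y = a \<odot>\<^bsub>N\<^esub> x"
  obtains \<phi> where "\<phi> \<in> L M (scalar_module K)" "\<And>y. y \<in> carrier M \<Longrightarrow> f y = \<phi> y \<odot>\<^bsub>N\<^esub> x"
proof (cases "x = \<zero>\<^bsub>N\<^esub>")
  interpret M: module K M by (rule M)
  interpret N: module K N by (rule N)
  case True
  have "(\<lambda>y. \<zero>) \<in> L M (scalar_module K)" by (rule linI) (auto simp: scalar_module_def)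
  thus ?thesis using that True im by fastforce
next
  interpret M: module K M by (rule M)
  interpret N: module K N by (rule N)
  case False
  have uniq: "a = b" if "a \<in> carrier K" "b \<in> carrier K" "a \<odot>\<^bsub>N\<^esub> x = b \<odot>\<^bsub>N\<^esub> x" for a b
  proof -
    have "(a \<ominus> b) \<odot>\<^bsub>N\<^esub> x = a \<odot>\<^bsub>N\<^esub> x \<ominus>\<^bsub>N\<^esub> b \<odot>\<^bsub>N\<^esub> x"
      using that x by (simp add: a_minus_def N.smult_l_distr N.smult_l_minus)
    also have "\<dots> = \<zero>\<^bsub>N\<^esub>" using that x by (simp add: N.minus_eq N.r_neg)
    finally have "a \<ominus> b = \<zero>" using smult_eq_zeroD[OF N x False, of "a \<ominus> b"] that by simp
    thus ?thesis using that by (metis minus_eq minus_equality minus_minus a_inv_closed)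
  qed
  define \<phi> where "\<phi> y = (SOME a. a \<in> carrier K \<and> f y = a \<odot>\<^bsub>N\<^esub> x)" for y
  have \<phi>: "\<phi> y \<in> carrier K \<and> f y = \<phi> y \<odot>\<^bsub>N\<^esub> x" if "y \<in> carrier M" for y
    unfolding \<phi>_def by (rule someI_ex) (use im[OF that] in blast)
  have "\<phi> \<in> L M (scalar_module K)"
  proof (rule linI)
    fix y z assume y: "y \<in> carrier M" and z: "z \<in> carrier M"
    have "\<phi> (y \<oplus>\<^bsub>M\<^esub> z) \<odot>\<^bsub>N\<^esub> x = f (y \<oplus>\<^bsub>M\<^esub> z)" using \<phi>[of "y \<oplus>\<^bsub>M\<^esub> z"] y z by simp
    also have "\<dots> = (\<phi> y \<oplus> \<phi> z) \<odot>\<^bsub>N\<^esub> x"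
      using \<phi>[OF y] \<phi>[OF z] x y z by (simp add: lin_add[OF f] N.smult_l_distr)
    finally have "\<phi> (y \<oplus>\<^bsub>M\<^esub> z) = \<phi> y \<oplus> \<phi> z" using uniq \<phi> y z by simp
    thus "\<phi> (y \<oplus>\<^bsub>M\<^esub> z) = \<phi> y \<oplus>\<^bsub>scalar_module K\<^esub> \<phi> z" by (simp add: scalar_module_def)
  next
    fix a y assume a: "a \<in> carrier K" and y: "y \<in> carrier M"
    have "\<phi> (a \<odot>\<^bsub>M\<^esub> y) \<odot>\<^bsub>N\<^esub> x = f (a \<odot>\<^bsub>M\<^esub> y)" using \<phi>[of "a \<odot>\<^bsub>M\<^esub> y"] y a by simp
    also have "\<dots> = (a \<otimes> \<phi> y) \<odot>\<^bsub>N\<^esub> x"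
      using \<phi>[OF y] x y a by (simp add: lin_smult[OF f] N.smult_assoc1)
    finally have "\<phi> (a \<odot>\<^bsub>M\<^esub> y) = a \<otimes> \<phi> y" using uniq \<phi> y a by simp
    thus "\<phi> (a \<odot>\<^bsub>M\<^esub> y) = a \<odot>\<^bsub>scalar_module K\<^esub> \<phi> y" by (simp add: scalar_module_def)
  qed (use \<phi> in auto)
  thus ?thesis using that \<phi> by blast
qed

lemma subspace_line: 
  assumes M: "vs M" and x: "x \<in> carrier M"
  shows "submodule {a \<odot>\<^bsub>M\<^esub> x | a. a \<in> carrier K} K M"
proof -
  interpret M: module K M by (rule M)
  have "{n \<oplus>\<^bsub>M\<^esub> a \<odot>\<^bsub>M\<^esub> x | n a. n \<in> {\<zero>\<^bsub>M\<^esub>} \<and> a \<in> carrier K} = {a \<odot>\<^bsub>M\<^esub> x | a. a \<in> carrier K}"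
    using x by auto (metis M.l_zero M.smult_closed)
  thus ?thesis using subspace_adjoin[OF M subspace_zero_space[OF M] x] by simp
qed

text \<open>A retraction onto the line through a nonzero vector is a functional that does not vanish at
  this vector.\<close>

lemma functionals_separate:
  assumes M: "vs M" and x: "x \<in> carrier M"
    and 0: "\<And>\<phi>. \<phi> \<in> L M (scalar_module K) \<Longrightarrow> \<phi> x = \<zero>"
  shows "x = \<zero>\<^bsub>M\<^esub>"
proof -
  interpret M: module K M by (rule M)
  let ?U = "{a \<odot>\<^bsub>M\<^esub> x | a. a \<in> carrier K}"
  obtain p where p: "p \<in> L M M" "\<And>y. y \<in> carrier M \<Longrightarrow> p y \<in> ?U" "\<And>u. u \<in> ?U \<Longrightarrow> p u = u"
    using retraction_exists[OF M subspace_line[OF M x]] by blast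
  have im: "\<exists>a\<in>carrier K. p y = a \<odot>\<^bsub>M\<^esub> x" if "y \<in> carrier M" for y
    using p(2)[OF that] by auto
  obtain \<phi> where \<phi>: "\<phi> \<in> L M (scalar_module K)" "\<And>y. y \<in> carrier M \<Longrightarrow> p y = \<phi> y \<odot>\<^bsub>M\<^esub> x"
    by (rule rank_one_factor[OF M M x p(1) im], assumption, rule that)
  have "x = \<one> \<odot>\<^bsub>M\<^esub> x" using x by simp
  hence "x \<in> ?U" by blast
  thus ?thesis using p(3) \<phi>(2)[OF x] 0[OF \<phi>(1)] x by simp
qed

section \<open>Tensor products\<close>

subsection \<open>The free module\<close>

lemma free_carrier: "f \<in> carrier (free_module K S) \<longleftrightarrow>
    (\<forall>s. f s \<in> carrier K) \<and> (\<forall>s. s \<notin> S \<longrightarrow> f s = \<zero>) \<and> finite {s. f s \<noteq> \<zero>}"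
  by (auto simp: free_module_def)

lemma free_simps:
  "\<zero>\<^bsub>free_module K S\<^esub> = (\<lambda>s. \<zero>)"
  "f \<oplus>\<^bsub>free_module K S\<^esub> g = (\<lambda>s. f s \<oplus> g s)"
  "a \<odot>\<^bsub>free_module K S\<^esub> f = (\<lambda>s. a \<otimes> f s)"
  by (simp_all add: free_module_def)

lemma vs_free: "vs (free_module K S)"
proof (rule moduleI)
  have fin: "finite {s. f s \<oplus> g s \<noteq> \<zero>}" if "finite {s. f s \<noteq> \<zero>}" "finite {s. g s \<noteq> \<zero>}" for f g
  proof (rule finite_subset)
    show "{s. f s \<oplus> g s \<noteq> \<zero>} \<subseteq> {s. f s \<noteq> \<zero>} \<union> {s. g s \<noteq> \<zero>}" by auto
  qed (use that in auto)
  have fin': "finite {s. a \<otimes> f s \<noteq> \<zero>}" if "finite {s. f s \<noteq> \<zero>}" "a \<in> carrier K" for f a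
  proof (rule finite_subset)
    show "{s. a \<otimes> f s \<noteq> \<zero>} \<subseteq> {s. f s \<noteq> \<zero>}" using that by auto
  qed (use that in auto)
  show "cring K" by (rule cring_axioms)
  show "abelian_group (free_module K S)"
  proof (rule abelian_groupI)
    fix f assume "f \<in> carrier (free_module K S)"
    hence f: "\<And>s. f s \<in> carrier K" "\<And>s. s \<notin> S \<Longrightarrow> f s = \<zero>" "finite {s. f s \<noteq> \<zero>}"
      by (auto simp: free_carrier)
    have "{s. \<ominus> f s \<noteq> \<zero>} \<subseteq> {s. f s \<noteq> \<zero>}" by auto
    hence "(\<lambda>s. \<ominus> f s) \<in> carrier (free_module K S)"
      using f by (auto simp: free_carrier intro: finite_subset)
    thus "\<exists>g\<in>carrier (free_module K S). g \<oplus>\<^bsub>free_module K S\<^esub> f = \<zero>\<^bsub>free_module K S\<^esub>"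
      by (intro bexI[of _ "\<lambda>s. \<ominus> f s"]) (auto simp: free_simps l_neg f)
  qed (auto simp: free_carrier free_simps fin a_ac)
  show "a \<odot>\<^bsub>free_module K S\<^esub> f \<in> carrier (free_module K S)"
    if "a \<in> carrier K" "f \<in> carrier (free_module K S)" for a f
    using that by (auto simp: free_carrier free_simps fin')
qed (auto simp: free_carrier free_simps l_distr r_distr m_assoc)

lemma free_gen_carrier: "s \<in> S \<Longrightarrow> free_gen K s \<in> carrier (free_module K S)"
proof -
  have "{t. free_gen K s t \<noteq> \<zero>} \<subseteq> {s}" by (auto simp: free_gen_def)
  hence "finite {t. free_gen K s t \<noteq> \<zero>}" by (rule finite_subset) simp
  thus "s \<in> S \<Longrightarrow> ?thesis" by (auto simp: free_carrier free_gen_def)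
qed

lemma free_span:
  assumes U: "submodule U K (free_module K S)" and g: "\<And>s. s \<in> S \<Longrightarrow> free_gen K s \<in> U"
  shows "carrier (free_module K S) \<subseteq> U"
proof
  fix f assume f: "f \<in> carrier (free_module K S)"
  have "f \<in> U" if "finite A" "f \<in> carrier (free_module K S)" "{s. f s \<noteq> \<zero>} \<subseteq> A" for A f
    using that
  proof (induction A arbitrary: f rule: finite_induct)
    case empty
    hence "f = \<zero>\<^bsub>free_module K S\<^esub>" by (auto simp: free_simps)
    thus ?case using subspace_zero[OF U] by simp
  next
    case (insert z A)
    show ?case
    proof (cases "f z = \<zero>")
      case True
      thus ?thesis using insert by blast
    next
      case False
      hence z: "z \<in> S" and fz: "f z \<in> carrier K" using insert.prems by (auto simp: free_carrier)
      have sub: "{s. (f(z := \<zero>)) s \<noteq> \<zero>} \<subseteq> {s. f s \<noteq> \<zero>}" by auto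
      have f': "f(z := \<zero>) \<in> carrier (free_module K S)"
        using insert.prems(1) finite_subset[OF sub] by (auto simp: free_carrier)
      have "f(z := \<zero>) \<in> U" by (rule insert.IH[OF f']) (use insert.prems in auto)
      moreover have "f z \<odot>\<^bsub>free_module K S\<^esub> free_gen K z \<in> U"
        by (rule subspace_smult[OF U fz g[OF z]])
      ultimately have "f z \<odot>\<^bsub>free_module K S\<^esub> free_gen K z \<oplus>\<^bsub>free_module K S\<^esub> f(z := \<zero>) \<in> U"
        using subspace_add[OF U] by blast
      also have "f z \<odot>\<^bsub>free_module K S\<^esub> free_gen K z \<oplus>\<^bsub>free_module K S\<^esub> f(z := \<zero>) = f"
        using insert.prems(1) by (auto simp: free_simps free_gen_def free_carrier)
      finally show ?thesis .
    qed
  qed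
  thus "f \<in> U" using f by (auto simp: free_carrier)
qed

text \<open>The linear extension of \<open>b\<close> to formal sums.\<close>

definition lsum :: "('k, 'p, 'z) module_scheme \<Rightarrow> ('s \<Rightarrow> 'p) \<Rightarrow> ('s \<Rightarrow> 'k) \<Rightarrow> 'p"
  where "lsum P b f = (\<Oplus>\<^bsub>P\<^esub>z\<in>{z. f z \<noteq> \<zero>}. f z \<odot>\<^bsub>P\<^esub> b z)"

lemma lsum_superset:
  assumes P: "vs P" and b: "\<And>s. s \<in> S \<Longrightarrow> b s \<in> carrier P"
    and f: "f \<in> carrier (free_module K S)" and A: "finite A" "{z. f z \<noteq> \<zero>} \<subseteq> A" "A \<subseteq> S"
  shows "lsum P b f = (\<Oplus>\<^bsub>P\<^esub>z\<in>A. f z \<odot>\<^bsub>P\<^esub> b z)"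
proof -
  interpret P: module K P by (rule P)
  have "f s \<in> carrier K" for s using f by (auto simp: free_carrier)
  thus ?thesis unfolding lsum_def
    using A b by (intro P.add.finprod_mono_neutral_cong_left) auto
qed

lemma lin_lsum:
  assumes P: "vs P" and b: "\<And>s. s \<in> S \<Longrightarrow> b s \<in> carrier P"
  shows "lsum P b \<in> L (free_module K S) P"
proof (rule linI)
  interpret P: module K P by (rule P)
  fix f assume f: "f \<in> carrier (free_module K S)"
  hence f': "\<And>s. f s \<in> carrier K" "{s. f s \<noteq> \<zero>} \<subseteq> S" "finite {s. f s \<noteq> \<zero>}"
    by (auto simp: free_carrier)
  have fb: "(\<lambda>z. f z \<odot>\<^bsub>P\<^esub> b z) \<in> A \<rightarrow> carrier P" if "A \<subseteq> S" for A using f' b that by auto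
  show "lsum P b f \<in> carrier P" unfolding lsum_def by (rule P.finsum_closed[OF fb[OF f'(2)]])
  {
    fix g assume g: "g \<in> carrier (free_module K S)"
    hence g': "\<And>s. g s \<in> carrier K" "{s. g s \<noteq> \<zero>} \<subseteq> S" "finite {s. g s \<noteq> \<zero>}"
      by (auto simp: free_carrier)
    define A where "A = {s. f s \<noteq> \<zero>} \<union> {s. g s \<noteq> \<zero>}"
    have A: "finite A" "A \<subseteq> S" using f' g' by (auto simp: A_def)
    have gb: "(\<lambda>z. g z \<odot>\<^bsub>P\<^esub> b z) \<in> A \<rightarrow> carrier P" using g' b A by auto
    have "lsum P b (f \<oplus>\<^bsub>free_module K S\<^esub> g) = (\<Oplus>\<^bsub>P\<^esub>z\<in>A. (f z \<oplus> g z) \<odot>\<^bsub>P\<^esub> b z)"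
    proof -
      have "{z. (f \<oplus>\<^bsub>free_module K S\<^esub> g) z \<noteq> \<zero>} \<subseteq> A" by (auto simp: free_simps A_def)
      from lsum_superset[where P = P and b = b, OF P b vs_add[OF vs_free f g] A(1) this A(2)]
      show ?thesis by (simp add: free_simps)
    qed
    also have "\<dots> = (\<Oplus>\<^bsub>P\<^esub>z\<in>A. f z \<odot>\<^bsub>P\<^esub> b z \<oplus>\<^bsub>P\<^esub> g z \<odot>\<^bsub>P\<^esub> b z)"
      by (rule P.finsum_cong') (use f' g' b A in \<open>auto simp: P.smult_l_distr\<close>)
    also have "\<dots> = (\<Oplus>\<^bsub>P\<^esub>z\<in>A. f z \<odot>\<^bsub>P\<^esub> b z) \<oplus>\<^bsub>P\<^esub> (\<Oplus>\<^bsub>P\<^esub>z\<in>A. g z \<odot>\<^bsub>P\<^esub> b z)"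
      by (rule P.finsum_addf[OF fb[OF A(2)] gb])
    also have "\<dots> = lsum P b f \<oplus>\<^bsub>P\<^esub> lsum P b g"
      using lsum_superset[OF P b f A(1) _ A(2)] lsum_superset[OF P b g A(1) _ A(2)]
      by (auto simp: A_def)
    finally show "lsum P b (f \<oplus>\<^bsub>free_module K S\<^esub> g) = lsum P b f \<oplus>\<^bsub>P\<^esub> lsum P b g" .
  next
    fix a assume a: "a \<in> carrier K"
    have "lsum P b (a \<odot>\<^bsub>free_module K S\<^esub> f) = (\<Oplus>\<^bsub>P\<^esub>z\<in>{s. f s \<noteq> \<zero>}. (a \<otimes> f z) \<odot>\<^bsub>P\<^esub> b z)"
    proof -
      have "{z. (a \<odot>\<^bsub>free_module K S\<^esub> f) z \<noteq> \<zero>} \<subseteq> {s. f s \<noteq> \<zero>}" using a by (auto simp: free_simps)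
      from lsum_superset[where P = P and b = b, OF P b vs_smult[OF vs_free a f] f'(3) this f'(2)]
      show ?thesis by (simp add: free_simps)
    qed
    also have "\<dots> = (\<Oplus>\<^bsub>P\<^esub>z\<in>{s. f s \<noteq> \<zero>}. a \<odot>\<^bsub>P\<^esub> (f z \<odot>\<^bsub>P\<^esub> b z))"
      by (rule P.finsum_cong') (use f' b a in \<open>auto simp: P.smult_assoc1 subset_iff\<close>)
    also have "\<dots> = a \<odot>\<^bsub>P\<^esub> lsum P b f"
      unfolding lsum_def by (rule P.finsum_smult_ldistr[symmetric, OF f'(3) a fb[OF f'(2)]])
    finally show "lsum P b (a \<odot>\<^bsub>free_module K S\<^esub> f) = a \<odot>\<^bsub>P\<^esub> lsum P b f" .
  }
qed

lemma lsum_gen: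
  assumes P: "vs P" and b: "\<And>s. s \<in> S \<Longrightarrow> b s \<in> carrier P" and s: "s \<in> S"
  shows "lsum P b (free_gen K s) = b s"
proof -
  interpret P: module K P by (rule P)
  have "lsum P b (free_gen K s) = (\<Oplus>\<^bsub>P\<^esub>z\<in>{s}. free_gen K s z \<odot>\<^bsub>P\<^esub> b z)"
    by (rule lsum_superset[OF P b free_gen_carrier[OF s]]) (auto simp: free_gen_def s)
  also have "\<dots> = b s" using b[OF s] by (simp add: free_gen_def)
  finally show ?thesis .
qed


lemma lin_finsum_fun:
  assumes P: "vs P" and X: "vs X" and "finite A" "\<And>z. z \<in> A \<Longrightarrow> (\<lambda>x. h x z) \<in> L X P"
  shows "(\<lambda>x. \<Oplus>\<^bsub>P\<^esub>z\<in>A. h x z) \<in> L X P"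
proof -
  interpret P: module K P by (rule P)
  show ?thesis using assms(3,4)
  proof (induction A rule: finite_induct)
    case empty
    show ?case by (rule linI) auto
  next
    case (insert z A)
    have "(\<lambda>x. h x z \<oplus>\<^bsub>P\<^esub> (\<Oplus>\<^bsub>P\<^esub>z\<in>A. h x z)) \<in> L X P"
      by (rule lin_sum[OF _ insert.IH P]) (use insert.prems in auto)
    moreover have "(\<Oplus>\<^bsub>P\<^esub>z\<in>insert z A. h x z) = h x z \<oplus>\<^bsub>P\<^esub> (\<Oplus>\<^bsub>P\<^esub>z\<in>A. h x z)"
      if "x \<in> carrier X" for x
      by (rule P.finsum_insert) (use insert lin_closed[OF insert.prems that] in auto)
    ultimately show ?case by (rule lin_restrict_dom[OF _ _ X])
  qed
qed

subsection \<open>Bilinear maps and the universal property\<close>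

definition bilin ::
  "('k, 'm, 'x) module_scheme \<Rightarrow> ('k, 'n, 'y) module_scheme \<Rightarrow> ('k, 'p, 'z) module_scheme
    \<Rightarrow> ('m \<Rightarrow> 'n \<Rightarrow> 'p) \<Rightarrow> bool"
  where "bilin M N P b \<longleftrightarrow> (\<forall>m\<in>carrier M. (\<lambda>n. b m n) \<in> L N P) \<and> (\<forall>n\<in>carrier N. (\<lambda>m. b m n) \<in> L M P)"

lemma bilinI:
  "\<lbrakk>\<And>m. m \<in> carrier M \<Longrightarrow> (\<lambda>n. b m n) \<in> L N P; \<And>n. n \<in> carrier N \<Longrightarrow> (\<lambda>m. b m n) \<in> L M P\<rbrakk>
    \<Longrightarrow> bilin M N P b"
  by (simp add: bilin_def)

lemma bilinD:
  assumes "bilin M N P b"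
  shows bilin_right: "m \<in> carrier M \<Longrightarrow> (\<lambda>n. b m n) \<in> L N P"
    and bilin_left: "n \<in> carrier N \<Longrightarrow> (\<lambda>m. b m n) \<in> L M P"
    and bilin_closed: "\<lbrakk>m \<in> carrier M; n \<in> carrier N\<rbrakk> \<Longrightarrow> b m n \<in> carrier P"
  using assms lin_closed[of "\<lambda>n. b m n" N P n] by (auto simp: bilin_def)

context
  fixes M :: "('k, 'm, 'x) module_scheme" and N :: "('k, 'n, 'y) module_scheme"
  assumes M: "vs M" and N: "vs N"
begin

abbreviation (input) "F \<equiv> free_module K (carrier M \<times> carrier N)"
abbreviation (input) "R \<equiv> tensor_rel K M N"

lemma gen_F: "m \<in> carrier M \<Longrightarrow> n \<in> carrier N \<Longrightarrow> free_gen K (m, n) \<in> carrier F"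
  by (rule free_gen_carrier) simp

lemma subspace_tensor_rel: "submodule R K F"
  unfolding tensor_rel_def Let_def
  by (rule span_subspace[OF vs_free])
    (auto intro!: vs_minus[OF vs_free] vs_add[OF vs_free] vs_smult[OF vs_free] gen_F
       vs_add[OF M] vs_add[OF N] vs_smult[OF M] vs_smult[OF N])

lemma vs_tensor: "vs (tensor K M N)"
  unfolding tensor_def by (rule vs_quot[OF vs_free subspace_tensor_rel])

lemma bilin_pure: "bilin M N (tensor K M N) (pure_tensor K M N)"
proof -
  note q = quot_add[OF vs_free subspace_tensor_rel] quot_smult[OF vs_free subspace_tensor_rel]
  note c = gen_F vs_add[OF vs_free] vs_smult[OF vs_free] vs_add[OF M] vs_add[OF N]
     vs_smult[OF M] vs_smult[OF N]
  note e = coset_eq_iff[OF vs_free subspace_tensor_rel]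
  have r: "x \<in> R" if "x \<in> {free_gen K (m \<oplus>\<^bsub>M\<^esub> m', n) \<ominus>\<^bsub>F\<^esub> (free_gen K (m, n) \<oplus>\<^bsub>F\<^esub> free_gen K (m', n)) | m m' n.
          m \<in> carrier M \<and> m' \<in> carrier M \<and> n \<in> carrier N}
       \<union> {free_gen K (m, n \<oplus>\<^bsub>N\<^esub> n') \<ominus>\<^bsub>F\<^esub> (free_gen K (m, n) \<oplus>\<^bsub>F\<^esub> free_gen K (m, n')) | m n n'.
          m \<in> carrier M \<and> n \<in> carrier N \<and> n' \<in> carrier N}
       \<union> {free_gen K (a \<odot>\<^bsub>M\<^esub> m, n) \<ominus>\<^bsub>F\<^esub> a \<odot>\<^bsub>F\<^esub> free_gen K (m, n) | a m n.
          a \<in> carrier K \<and> m \<in> carrier M \<and> n \<in> carrier N}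
       \<union> {free_gen K (m, a \<odot>\<^bsub>N\<^esub> n) \<ominus>\<^bsub>F\<^esub> a \<odot>\<^bsub>F\<^esub> free_gen K (m, n) | a m n.
          a \<in> carrier K \<and> m \<in> carrier M \<and> n \<in> carrier N}" for x
    unfolding tensor_rel_def Let_def by (rule subsetD[OF span_superset that])
  have cl: "pure_tensor K M N m n \<in> carrier (tensor K M N)" if "m \<in> carrier M" "n \<in> carrier N" for m n
    using gen_F[OF that] by (simp add: pure_tensor_def tensor_def quot_carrier)
  show ?thesis
  proof (intro bilinI linI)
    fix m n n' assume a: "m \<in> carrier M" "n \<in> carrier N" "n' \<in> carrier N"
    show "pure_tensor K M N m (n \<oplus>\<^bsub>N\<^esub> n') = pure_tensor K M N m n \<oplus>\<^bsub>tensor K M N\<^esub> pure_tensor K M N m n'"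
      unfolding pure_tensor_def tensor_def
      by (subst q(1)) (use a in \<open>auto simp: c e intro!: r\<close>)
  next
    fix m n x assume a: "m \<in> carrier M" "n \<in> carrier N" "x \<in> carrier K"
    show "pure_tensor K M N m (x \<odot>\<^bsub>N\<^esub> n) = x \<odot>\<^bsub>tensor K M N\<^esub> pure_tensor K M N m n"
      unfolding pure_tensor_def tensor_def
      by (subst q(2)) (use a in \<open>auto simp: c e intro!: r\<close>)
    show "pure_tensor K M N (x \<odot>\<^bsub>M\<^esub> m) n = x \<odot>\<^bsub>tensor K M N\<^esub> pure_tensor K M N m n"
      unfolding pure_tensor_def tensor_def
      by (subst q(2)) (use a in \<open>auto simp: c e intro!: r\<close>)
  next
    fix m m' n assume a: "m \<in> carrier M" "m' \<in> carrier M" "n \<in> carrier N"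
    show "pure_tensor K M N (m \<oplus>\<^bsub>M\<^esub> m') n = pure_tensor K M N m n \<oplus>\<^bsub>tensor K M N\<^esub> pure_tensor K M N m' n"
      unfolding pure_tensor_def tensor_def
      by (subst q(1)) (use a in \<open>auto simp: c e intro!: r\<close>)
  qed (use cl in auto)
qed

lemma tensor_span:
  assumes U: "submodule U K (tensor K M N)"
    and p: "\<And>m n. \<lbrakk>m \<in> carrier M; n \<in> carrier N\<rbrakk> \<Longrightarrow> pure_tensor K M N m n \<in> U"
  shows "carrier (tensor K M N) \<subseteq> U"
proof -
  have "submodule {f \<in> carrier F. R +>\<^bsub>F\<^esub> f \<in> U} K F"
    by (rule subspace_vimage[OF lin_coset[OF vs_free subspace_tensor_rel] vs_free
          vs_quot[OF vs_free subspace_tensor_rel]]) (use U in \<open>simp add: tensor_def\<close>)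
  hence "carrier F \<subseteq> {f \<in> carrier F. R +>\<^bsub>F\<^esub> f \<in> U}"
    by (rule free_span) (use p in \<open>auto simp: gen_F pure_tensor_def\<close>)
  thus ?thesis by (auto simp: tensor_def quot_carrier)
qed

lemma tensor_ext:
  assumes f: "f \<in> L (tensor K M N) P" and g: "g \<in> L (tensor K M N) P" and P: "vs P"
    and eq: "\<And>m n. \<lbrakk>m \<in> carrier M; n \<in> carrier N\<rbrakk> \<Longrightarrow> f (pure_tensor K M N m n) = g (pure_tensor K M N m n)"
    and t: "t \<in> carrier (tensor K M N)"
  shows "f t = g t"
proof -
  have "carrier (tensor K M N) \<subseteq> {t \<in> carrier (tensor K M N). f t = g t}"
    by (rule tensor_span[OF subspace_equalizer[OF f g vs_tensor P]])
      (auto simp: eq bilin_closed[OF bilin_pure])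
  thus ?thesis using t by auto
qed

lemma tlift_lsum: "tlift K P b t = lsum P (\<lambda>z. b (fst z) (snd z)) (SOME f. f \<in> t)"
  by (simp add: tlift_def lsum_def Let_def)

lemma rep_F:
  assumes t: "t \<in> carrier (tensor K M N)"
  shows "(SOME f. f \<in> t) \<in> carrier F" "t = R +>\<^bsub>F\<^esub> (SOME f. f \<in> t)"
proof -
  from t obtain f where f: "f \<in> carrier F" "t = R +>\<^bsub>F\<^esub> f" by (auto simp: tensor_def quot_carrier)
  have "f \<in> t" using coset_self[OF vs_free subspace_tensor_rel f(1)] f(2) by simp
  hence *: "(SOME f. f \<in> t) \<in> R +>\<^bsub>F\<^esub> f" unfolding f(2)
    using someI[of "\<lambda>g. g \<in> R +>\<^bsub>F\<^esub> f" f] by simp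
  show "(SOME f. f \<in> t) \<in> carrier F" "t = R +>\<^bsub>F\<^esub> (SOME f. f \<in> t)"
    using coset_memD[OF vs_free subspace_tensor_rel f(1) *] f(2) by auto
qed

lemma tlift_closed:
  assumes t: "t \<in> carrier (tensor K M N)" and P: "vs P"
    and b: "\<And>m n. \<lbrakk>m \<in> carrier M; n \<in> carrier N\<rbrakk> \<Longrightarrow> b m n \<in> carrier P"
  shows "tlift K P b t \<in> carrier P"
  unfolding tlift_lsum by (rule lin_closed[OF lin_lsum[OF P] rep_F(1)[OF t]]) (use b in auto)

lemma tlift_cong:
  assumes t: "t \<in> carrier (tensor K M N)" and P: "vs P"
    and b: "\<And>m n. \<lbrakk>m \<in> carrier M; n \<in> carrier N\<rbrakk> \<Longrightarrow> b' m n \<in> carrier P"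
    and eq: "\<And>m n. \<lbrakk>m \<in> carrier M; n \<in> carrier N\<rbrakk> \<Longrightarrow> b m n = b' m n"
  shows "tlift K P b t = tlift K P b' t"
proof -
  interpret P: module K P by (rule P)
  have f: "(SOME f. f \<in> t) s \<in> carrier K" "(SOME f. f \<in> t) s \<noteq> \<zero> \<Longrightarrow> s \<in> carrier M \<times> carrier N" for s
    using rep_F(1)[OF t] unfolding free_carrier by blast+
  show ?thesis unfolding tlift_lsum lsum_def
    by (rule P.finsum_cong') (use f b eq in \<open>auto simp: mem_Times_iff\<close>)
qed

lemma tlift_commute:
  assumes t: "t \<in> carrier (tensor K M N)" and P: "vs P" and P': "vs P'" and f: "f \<in> L P P'"
    and b: "\<And>m n. \<lbrakk>m \<in> carrier M; n \<in> carrier N\<rbrakk> \<Longrightarrow> b m n \<in> carrier P"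
  shows "f (tlift K P b t) = tlift K P' (\<lambda>m n. f (b m n)) t"
proof -
  interpret P: module K P by (rule P)
  interpret P': module K P' by (rule P')
  have g: "(SOME f. f \<in> t) s \<in> carrier K" "(SOME f. f \<in> t) s \<noteq> \<zero> \<Longrightarrow> s \<in> carrier M \<times> carrier N"
    "finite {s. (SOME f. f \<in> t) s \<noteq> \<zero>}" for s
    using rep_F(1)[OF t] unfolding free_carrier by blast+
  have b': "b m n \<in> carrier P" if "(SOME f. f \<in> t) (m, n) \<noteq> \<zero>" for m n
    using g(2)[OF that] b by auto
  show ?thesis unfolding tlift_lsum lsum_def
    by (subst lin_finsum[OF f P P'])
      (auto simp: g b' lin_smult[OF f] lin_closed[OF f] intro!: P'.finsum_cong' P.smult_closed
         P'.smult_closed)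
qed

lemma tlift_lin_param:
  assumes t: "t \<in> carrier (tensor K M N)" and P: "vs P" and X: "vs X"
    and b: "\<And>m n. \<lbrakk>m \<in> carrier M; n \<in> carrier N\<rbrakk> \<Longrightarrow> (\<lambda>x. b x m n) \<in> L X P"
  shows "(\<lambda>x. tlift K P (b x) t) \<in> L X P"
proof -
  interpret P: module K P by (rule P)
  interpret X: module K X by (rule X)
  have g: "(SOME f. f \<in> t) s \<in> carrier K" "(SOME f. f \<in> t) s \<noteq> \<zero> \<Longrightarrow> s \<in> carrier M \<times> carrier N"
    "finite {s. (SOME f. f \<in> t) s \<noteq> \<zero>}" for s
    using rep_F(1)[OF t] unfolding free_carrier by blast+
  have b': "(\<lambda>x. b x (fst s) (snd s)) \<in> L X P" if "(SOME f. f \<in> t) s \<noteq> \<zero>" for s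
    using g(2)[OF that] b by auto
  show ?thesis unfolding tlift_lsum lsum_def
    by (rule lin_finsum_fun[OF P X g(3)]) (use g(1) b' in \<open>auto intro!: lin_smult_right[OF _ _ P]\<close>)
qed

text \<open>For bilinear \<open>b\<close> the linear extension kills the defining relations of the tensor product, so it
  does not depend on the formal sum that represents a tensor.\<close>

lemma tlift_coset:
  assumes P: "vs P" and b: "bilin M N P b" and f: "f \<in> carrier F"
  shows "tlift K P b (R +>\<^bsub>F\<^esub> f) = lsum P (\<lambda>z. b (fst z) (snd z)) f"
proof -
  interpret P: module K P by (rule P)
  let ?b = "\<lambda>z. b (fst z) (snd z)"
  have lb: "lsum P ?b \<in> L F P" by (rule lin_lsum[OF P]) (use bilin_closed[OF b] in auto)
  have lg: "lsum P ?b (free_gen K (m, n)) = b m n" if "m \<in> carrier M" "n \<in> carrier N" for m n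
    using lsum_gen[OF P, of "carrier M \<times> carrier N" ?b "(m, n)"] bilin_closed[OF b] that by auto
  note c = gen_F vs_add[OF vs_free] vs_smult[OF vs_free] vs_add[OF M] vs_add[OF N]
     vs_smult[OF M] vs_smult[OF N]
  note br = bilin_right[OF b] and bl = bilin_left[OF b]
  have "submodule {f \<in> carrier F. lsum P ?b f \<in> {\<zero>\<^bsub>P\<^esub>}} K F"
    by (rule subspace_vimage[OF lb vs_free P subspace_zero_space[OF P]])
  hence "R \<subseteq> {f \<in> carrier F. lsum P ?b f \<in> {\<zero>\<^bsub>P\<^esub>}}"
    unfolding tensor_rel_def Let_def
  proof (rule span_least, goal_cases)
    case 1
    show ?case
      by (auto simp: c lg lin_minus[OF lb vs_free P] lin_add[OF lb] lin_smult[OF lb]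
           vs_minus[OF vs_free] lin_add[OF br] lin_smult[OF br] lin_add[OF bl] lin_smult[OF bl]
           vs_minus_self[OF P] bilin_closed[OF b])
  qed
  hence k: "lsum P ?b r = \<zero>\<^bsub>P\<^esub>" if "r \<in> R" for r using that by auto
  have t: "R +>\<^bsub>F\<^esub> f \<in> carrier (tensor K M N)" using f by (simp add: tensor_def quot_carrier)
  let ?g = "SOME g. g \<in> R +>\<^bsub>F\<^esub> f"
  have g: "?g \<in> carrier F" "?g \<ominus>\<^bsub>F\<^esub> f \<in> R"
    using rep_F[OF t] coset_eq_iff[OF vs_free subspace_tensor_rel rep_F(1)[OF t] f] by auto
  have "lsum P ?b ?g \<ominus>\<^bsub>P\<^esub> lsum P ?b f = \<zero>\<^bsub>P\<^esub>"
    using k[OF g(2)] lin_minus[OF lb vs_free P g(1) f] by simp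
  thus ?thesis unfolding tlift_lsum
    using vs_minus_self[OF P lin_closed[OF lb g(1)] lin_closed[OF lb f]] by simp
qed

lemma lin_tlift:
  assumes P: "vs P" and b: "bilin M N P b"
  shows "tlift K P b \<in> L (tensor K M N) P"
  unfolding tensor_def
  by (rule lin_from_quot[OF vs_free subspace_tensor_rel lin_lsum[OF P] tlift_coset[OF P b]])
    (use bilin_closed[OF b] in auto)

lemma tlift_pure:
  assumes P: "vs P" and b: "bilin M N P b" and m: "m \<in> carrier M" and n: "n \<in> carrier N"
  shows "tlift K P b (pure_tensor K M N m n) = b m n"
  unfolding pure_tensor_def
  using tlift_coset[OF P b gen_F[OF m n]]
    lsum_gen[OF P, of "carrier M \<times> carrier N" "\<lambda>z. b (fst z) (snd z)" "(m, n)"]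
    bilin_closed[OF b] m n by auto

end


lemma lin_pure_right:
  "\<lbrakk>m \<in> carrier M; f \<in> L X N; vs M; vs N\<rbrakk> \<Longrightarrow> (\<lambda>x. pure_tensor K M N m (f x)) \<in> L X (tensor K M N)"
  by (rule lin_comp[OF bilin_right[OF bilin_pure]])

lemma lin_pure_left:
  "\<lbrakk>n \<in> carrier N; f \<in> L X M; vs M; vs N\<rbrakk> \<Longrightarrow> (\<lambda>x. pure_tensor K M N (f x) n) \<in> L X (tensor K M N)"
  by (rule lin_comp[OF bilin_left[OF bilin_pure]])

lemma pure_closed:
  "\<lbrakk>m \<in> carrier M; n \<in> carrier N; vs M; vs N\<rbrakk> \<Longrightarrow> pure_tensor K M N m n \<in> carrier (tensor K M N)"
  by (rule bilin_closed[OF bilin_pure])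

lemma lin_tlift_arg:
  "\<lbrakk>f \<in> L X (tensor K M N); bilin M N P b; vs M; vs N; vs P\<rbrakk> \<Longrightarrow> (\<lambda>x. tlift K P b (f x)) \<in> L X P"
  by (rule lin_comp[OF lin_tlift])

lemma tlift_swap:
  assumes t: "t \<in> carrier (tensor K M N)" and u: "u \<in> carrier (tensor K M' N')"
    and vs: "vs M" "vs N" "vs M'" "vs N'" "vs P"
    and b: "\<And>m n. \<lbrakk>m \<in> carrier M; n \<in> carrier N\<rbrakk> \<Longrightarrow> bilin M' N' P (b m n)"
  shows "tlift K P (\<lambda>m n. tlift K P (b m n) u) t
    = tlift K P (\<lambda>p q. tlift K P (\<lambda>m n. b m n p q) t) u"
proof (rule tensor_ext[OF vs(3,4) _ _ vs(5) _ u])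
  have l: "tlift K P (b m n) \<in> L (tensor K M' N') P" if "m \<in> carrier M" "n \<in> carrier N" for m n
    by (rule lin_tlift[OF vs(3,4,5) b[OF that]])
  show "(\<lambda>u. tlift K P (\<lambda>m n. tlift K P (b m n) u) t) \<in> L (tensor K M' N') P"
    by (rule tlift_lin_param[OF vs(1,2) t vs(5) vs_tensor[OF vs(3,4)]]) (rule l)
  have b': "bilin M' N' P (\<lambda>p q. tlift K P (\<lambda>m n. b m n p q) t)"
    by (intro bilinI tlift_lin_param[OF vs(1,2) t vs(5)] vs) (auto intro: bilin_left[OF b] bilin_right[OF b])
  show "tlift K P (\<lambda>p q. tlift K P (\<lambda>m n. b m n p q) t) \<in> L (tensor K M' N') P"
    by (rule lin_tlift[OF vs(3,4,5) b'])
  fix p q assume p: "p \<in> carrier M'" "q \<in> carrier N'"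
  show "tlift K P (\<lambda>m n. tlift K P (b m n) (pure_tensor K M' N' p q)) t =
    tlift K P (\<lambda>p q. tlift K P (\<lambda>m n. b m n p q) t) (pure_tensor K M' N' p q)"
    unfolding tlift_pure[OF vs(3,4,5) b' p]
    by (rule tlift_cong[OF vs(1,2) t vs(5)])
      (auto simp: tlift_pure[OF vs(3,4,5) b p] intro: bilin_closed[OF b] p)
qed

lemma bilin_tmap:
  assumes "vs M'" "vs N'" "f \<in> L M M'" "g \<in> L N N'"
  shows "bilin M N (tensor K M' N') (\<lambda>m n. pure_tensor K M' N' (f m) (g n))"
  using assms by (intro bilinI lin_pure_right lin_pure_left) (auto intro: lin_closed)

lemma lin_tmap:
  assumes "vs M" "vs N" "vs M'" "vs N'" "f \<in> L M M'" "g \<in> L N N'"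
  shows "tmap K M' N' f g \<in> L (tensor K M N) (tensor K M' N')"
  unfolding tmap_def using assms by (intro lin_tlift bilin_tmap vs_tensor)

lemma tmap_pure:
  assumes "vs M" "vs N" "vs M'" "vs N'" "f \<in> L M M'" "g \<in> L N N'" "m \<in> carrier M" "n \<in> carrier N"
  shows "tmap K M' N' f g (pure_tensor K M N m n) = pure_tensor K M' N' (f m) (g n)"
  unfolding tmap_def using assms by (intro tlift_pure bilin_tmap vs_tensor)

lemma
  assumes vs: "vs M" "vs N" "vs P"
  shows lin_tassoc: "tassoc K M N P \<in> L (tensor K (tensor K M N) P) (tensor K M (tensor K N P))"
    and tassoc_pure: "\<lbrakk>t \<in> carrier (tensor K M N); p \<in> carrier P\<rbrakk> \<Longrightarrow>
      tassoc K M N P (pure_tensor K (tensor K M N) P t p)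
        = tlift K (tensor K M (tensor K N P))
            (\<lambda>m n. pure_tensor K M (tensor K N P) m (pure_tensor K N P n p)) t"
proof -
  let ?T = "tensor K M (tensor K N P)"
  note v = vs vs_tensor
  have vT: "vs ?T" by (intro v)
  have b: "bilin M N ?T (\<lambda>m n. pure_tensor K M (tensor K N P) m (pure_tensor K N P n p))"
    if "p \<in> carrier P" for p
    by (intro bilinI lin_pure_right lin_pure_left lin_id v pure_closed that)
  have bb: "bilin (tensor K M N) P ?T (\<lambda>t p. tlift K ?T (\<lambda>m n. pure_tensor K M (tensor K N P) m (pure_tensor K N P n p)) t)"
  proof (rule bilinI)
    fix t assume t: "t \<in> carrier (tensor K M N)"
    show "(\<lambda>p. tlift K ?T (\<lambda>m n. pure_tensor K M (tensor K N P) m (pure_tensor K N P n p)) t) \<in> L P ?T"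
      by (rule tlift_lin_param[OF vs(1,2) t vT vs(3)]) (intro lin_pure_right lin_id v pure_closed)
  next
    fix p assume p: "p \<in> carrier P"
    show "(\<lambda>t. tlift K ?T (\<lambda>m n. pure_tensor K M (tensor K N P) m (pure_tensor K N P n p)) t) \<in> L (tensor K M N) ?T"
      by (rule lin_tlift[OF vs(1,2) vT b[OF p]])
  qed
  show "tassoc K M N P \<in> L (tensor K (tensor K M N) P) ?T"
    unfolding tassoc_def Let_def by (rule lin_tlift[OF vs_tensor[OF vs(1,2)] vs(3) vT bb])
  show "\<lbrakk>t \<in> carrier (tensor K M N); p \<in> carrier P\<rbrakk> \<Longrightarrow>
      tassoc K M N P (pure_tensor K (tensor K M N) P t p)
        = tlift K ?T (\<lambda>m n. pure_tensor K M (tensor K N P) m (pure_tensor K N P n p)) t"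
    unfolding tassoc_def Let_def by (rule tlift_pure[OF vs_tensor[OF vs(1,2)] vs(3) vT bb])
qed

lemma tensor_cong:
  assumes "carrier M' = carrier M" "add M' = add M" "smult M' = smult M"
    "carrier N' = carrier N" "add N' = add N" "smult N' = smult N"
  shows "tensor K M' N' = tensor K M N" "pure_tensor K M' N' = pure_tensor K M N"
proof -
  have "tensor_rel K M' N' = tensor_rel K M N" by (simp add: tensor_rel_def assms)
  thus "tensor K M' N' = tensor K M N" "pure_tensor K M' N' = pure_tensor K M N"
    by (auto simp: tensor_def pure_tensor_def assms fun_eq_iff)
qed


subsection \<open>Functionals separate tensors\<close>

text \<open>This says that \<open>t\<close> comes from \<open>M \<otimes> N'\<close> with \<open>N'\<close> spanned by the finite set \<open>B\<close>.  Phrased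
  through the maps that fix \<open>B\<close>, it is inherited by sums without any choice of bases.\<close>

lemma tensor_finite_support:
  assumes M: "vs M" and N: "vs N" and t: "t \<in> carrier (tensor K M N)"
  shows "\<exists>B. finite B \<and> B \<subseteq> carrier N
    \<and> (\<forall>f\<in>L N N. (\<forall>b\<in>B. f b = b) \<longrightarrow> tmap K M N (\<lambda>m. m) f t = t)"
    (is "?Q t")
proof -
  note lm = lin_tmap[OF M N M N lin_id]
  let ?T = "tensor K M N"
  have T: "vs ?T" by (rule vs_tensor[OF M N])
  have "submodule {t \<in> carrier ?T. ?Q t} K ?T"
  proof (rule subspaceI[OF T])
    show "\<zero>\<^bsub>?T\<^esub> \<in> {t \<in> carrier ?T. ?Q t}"
      using vs_zero[OF T] lin_zero[OF lm T T] by (auto intro!: exI[of _ "{}"])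
  next
    fix s t assume "s \<in> {t \<in> carrier ?T. ?Q t}" "t \<in> {t \<in> carrier ?T. ?Q t}"
    then obtain A B where c: "s \<in> carrier ?T" "t \<in> carrier ?T" and A: "finite A" "A \<subseteq> carrier N"
      "\<And>f. \<lbrakk>f \<in> L N N; \<forall>b\<in>A. f b = b\<rbrakk> \<Longrightarrow> tmap K M N (\<lambda>m. m) f s = s" and B: "finite B" "B \<subseteq> carrier N"
      "\<And>f. \<lbrakk>f \<in> L N N; \<forall>b\<in>B. f b = b\<rbrakk> \<Longrightarrow> tmap K M N (\<lambda>m. m) f t = t" by auto
    have "?Q (s \<oplus>\<^bsub>?T\<^esub> t)"
      by (rule exI[of _ "A \<union> B"]) (use A B c in \<open>auto simp: lin_add[OF lm]\<close>)
    thus "s \<oplus>\<^bsub>?T\<^esub> t \<in> {t \<in> carrier ?T. ?Q t}" using c vs_add[OF T] by simp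
  next
    fix a t assume a: "a \<in> carrier K" "t \<in> {t \<in> carrier ?T. ?Q t}"
    then obtain B where c: "t \<in> carrier ?T" and B: "finite B" "B \<subseteq> carrier N"
      "\<And>f. \<lbrakk>f \<in> L N N; \<forall>b\<in>B. f b = b\<rbrakk> \<Longrightarrow> tmap K M N (\<lambda>m. m) f t = t" by auto
    have "?Q (a \<odot>\<^bsub>?T\<^esub> t)"
      by (rule exI[of _ B]) (use a B c in \<open>auto simp: lin_smult[OF lm]\<close>)
    thus "a \<odot>\<^bsub>?T\<^esub> t \<in> {t \<in> carrier ?T. ?Q t}" using a c vs_smult[OF T] by simp
  qed auto
  hence "carrier ?T \<subseteq> {t \<in> carrier ?T. ?Q t}"
  proof (rule tensor_span[OF M N])
    fix m n assume mn: "m \<in> carrier M" "n \<in> carrier N"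
    have "?Q (pure_tensor K M N m n)"
      by (rule exI[of _ "{n}"]) (use mn in \<open>auto simp: tmap_pure[OF M N M N lin_id]\<close>)
    thus "pure_tensor K M N m n \<in> {t \<in> carrier ?T. ?Q t}" using pure_closed[OF mn M N] by simp
  qed
  thus ?thesis using t by auto
qed

text \<open>If \<open>f\<close> maps \<open>N\<close> into a finite-dimensional subspace, then \<open>id \<otimes> f\<close> kills \<open>t\<close>: when the subspace
  \<open>U\<close> grows by one vector, a map into the larger subspace differs from a map into \<open>U\<close> by one of rank
  one, that is, by a functional times a vector.  But \<open>t\<close> is fixed by \<open>id \<otimes> p\<close> for the retraction \<open>p\<close>
  onto a sufficiently large such subspace.\<close>

lemma tensor_separate_right:
  assumes M: "vs M" and N: "vs N" and t: "t \<in> carrier (tensor K M N)"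
    and 0: "\<And>\<psi>. \<psi> \<in> L N (scalar_module K) \<Longrightarrow> tlift K M (\<lambda>m n. \<psi> n \<odot>\<^bsub>M\<^esub> m) t = \<zero>\<^bsub>M\<^esub>"
  shows "t = \<zero>\<^bsub>tensor K M N\<^esub>"
proof -
  let ?T = "tensor K M N"
  interpret N: module K N by (rule N)
  have T: "vs ?T" by (rule vs_tensor[OF M N])
  \<comment> \<open>a property of subspaces that passes from \<open>U\<close> to \<open>U + Kx\<close>\<close>
  define kills where "kills U \<longleftrightarrow> submodule U K N \<and>
    (\<forall>f\<in>L N N. (\<forall>y\<in>carrier N. f y \<in> U) \<longrightarrow> tmap K M N (\<lambda>m. m) f t = \<zero>\<^bsub>?T\<^esub>)" for U
  have rank_one: "tmap K M N (\<lambda>m. m) (\<lambda>y. \<phi> y \<odot>\<^bsub>N\<^esub> x) t = \<zero>\<^bsub>?T\<^esub>"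
    if \<phi>: "\<phi> \<in> L N (scalar_module K)" and x: "x \<in> carrier N" for \<phi> x
  proof -
    have \<phi>c: "\<phi> y \<in> carrier K" if "y \<in> carrier N" for y using lin_closed[OF \<phi> that] by simp
    note r = bilin_right[OF bilin_pure[OF M N]] and l = bilin_left[OF bilin_pure[OF M N]]
    have "tmap K M N (\<lambda>m. m) (\<lambda>y. \<phi> y \<odot>\<^bsub>N\<^esub> x) t
        = tlift K ?T (\<lambda>m y. pure_tensor K M N (\<phi> y \<odot>\<^bsub>M\<^esub> m) x) t"
      unfolding tmap_def
      by (rule tlift_cong[OF M N t T])
        (auto simp: \<phi>c x lin_smult[OF r] lin_smult[OF l] vs_smult[OF M] intro!: pure_closed M N vs_smult[OF T])
    also have "\<dots> = pure_tensor K M N (tlift K M (\<lambda>m y. \<phi> y \<odot>\<^bsub>M\<^esub> m) t) x"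
      by (rule tlift_commute[OF M N t M T l[OF x], symmetric]) (auto simp: \<phi>c vs_smult[OF M])
    also have "\<dots> = \<zero>\<^bsub>?T\<^esub>" unfolding 0[OF \<phi>] by (rule lin_zero[OF l[OF x] M T])
    finally show ?thesis .
  qed
  have base: "kills {\<zero>\<^bsub>N\<^esub>}"
    unfolding kills_def
  proof (intro conjI ballI impI subspace_zero_space[OF N])
    fix f assume f: "f \<in> L N N" "\<forall>y\<in>carrier N. f y \<in> {\<zero>\<^bsub>N\<^esub>}"
    have "(\<lambda>y. \<zero>) \<in> L N (scalar_module K)" by (rule linI) (auto simp: scalar_module_def)
    hence "tmap K M N (\<lambda>m. m) (\<lambda>y. \<zero> \<odot>\<^bsub>N\<^esub> \<zero>\<^bsub>N\<^esub>) t = \<zero>\<^bsub>?T\<^esub>" by (rule rank_one) simp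
    moreover have "tmap K M N (\<lambda>m. m) f t = tmap K M N (\<lambda>m. m) (\<lambda>y. \<zero> \<odot>\<^bsub>N\<^esub> \<zero>\<^bsub>N\<^esub>) t"
      unfolding tmap_def by (rule tlift_cong[OF M N t T]) (use f in \<open>auto intro!: pure_closed M N\<close>)
    ultimately show "tmap K M N (\<lambda>m. m) f t = \<zero>\<^bsub>?T\<^esub>" by simp
  qed
  have step: "kills {n \<oplus>\<^bsub>N\<^esub> a \<odot>\<^bsub>N\<^esub> x | n a. n \<in> U \<and> a \<in> carrier K}"
    if U: "kills U" and x: "x \<in> carrier N" for U x
    unfolding kills_def
  proof (intro conjI ballI impI)
    have sU: "submodule U K N" using U by (simp add: kills_def)
    show "submodule {n \<oplus>\<^bsub>N\<^esub> a \<odot>\<^bsub>N\<^esub> x | n a. n \<in> U \<and> a \<in> carrier K} K N"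
      by (rule subspace_adjoin[OF N sU x])
    fix f assume f: "f \<in> L N N"
      and im: "\<forall>y\<in>carrier N. f y \<in> {n \<oplus>\<^bsub>N\<^esub> a \<odot>\<^bsub>N\<^esub> x | n a. n \<in> U \<and> a \<in> carrier K}"
    obtain q where q: "q \<in> L N N" "\<And>y. y \<in> carrier N \<Longrightarrow> q y \<in> U" "\<And>u. u \<in> U \<Longrightarrow> q u = u"
      using retraction_exists[OF N sU] by metis
    have qf: "(\<lambda>y. q (f y)) \<in> L N N" by (rule lin_comp[OF q(1) f])
    have d: "(\<lambda>y. f y \<ominus>\<^bsub>N\<^esub> q (f y)) \<in> L N N" by (rule lin_diff[OF f qf N])
    have x': "x \<ominus>\<^bsub>N\<^esub> q x \<in> carrier N" using x lin_closed[OF q(1) x] by simp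
    have "\<exists>a\<in>carrier K. f y \<ominus>\<^bsub>N\<^esub> q (f y) = a \<odot>\<^bsub>N\<^esub> (x \<ominus>\<^bsub>N\<^esub> q x)" if y: "y \<in> carrier N" for y
    proof -
      from im y obtain n a where *: "f y = n \<oplus>\<^bsub>N\<^esub> a \<odot>\<^bsub>N\<^esub> x" "n \<in> U" "a \<in> carrier K" by blast
      have n: "n \<in> carrier N" using *(2) subspace_subset[OF sU] by auto
      have "q (f y) = n \<oplus>\<^bsub>N\<^esub> a \<odot>\<^bsub>N\<^esub> q x"
        using * x n q(3) by (simp add: lin_add[OF q(1)] lin_smult[OF q(1)])
      hence "f y \<ominus>\<^bsub>N\<^esub> q (f y) = a \<odot>\<^bsub>N\<^esub> x \<ominus>\<^bsub>N\<^esub> a \<odot>\<^bsub>N\<^esub> q x"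
        using * n x lin_closed[OF q(1) x] by (simp add: minus_cancel_left[OF N])
      also have "\<dots> = a \<odot>\<^bsub>N\<^esub> (x \<ominus>\<^bsub>N\<^esub> q x)"
        using *(3) x lin_closed[OF q(1) x] by (simp add: N.minus_eq N.smult_r_distr N.smult_r_minus)
      finally show ?thesis using *(3) by blast
    qed
    then obtain \<phi> where \<phi>: "\<phi> \<in> L N (scalar_module K)"
      "\<And>y. y \<in> carrier N \<Longrightarrow> f y \<ominus>\<^bsub>N\<^esub> q (f y) = \<phi> y \<odot>\<^bsub>N\<^esub> (x \<ominus>\<^bsub>N\<^esub> q x)"
      using rank_one_factor[OF N N x' d] by metis
    have "tmap K M N (\<lambda>m. m) f t \<ominus>\<^bsub>?T\<^esub> tmap K M N (\<lambda>m. m) (\<lambda>y. q (f y)) t = \<zero>\<^bsub>?T\<^esub>"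
    proof -
      have fc: "f y \<in> carrier N" "q (f y) \<in> carrier N" if "y \<in> carrier N" for y
        using lin_closed[OF f that] lin_closed[OF qf that] by auto
      have "tmap K M N (\<lambda>m. m) (\<lambda>y. \<phi> y \<odot>\<^bsub>N\<^esub> (x \<ominus>\<^bsub>N\<^esub> q x)) t
        = tmap K M N (\<lambda>m. m) (\<lambda>y. f y \<ominus>\<^bsub>N\<^esub> q (f y)) t"
        unfolding tmap_def
        by (rule tlift_cong[OF M N t T])
          (auto simp: \<phi>(2)[symmetric] fc intro!: pure_closed M N vs_minus[OF N])
      also have "\<dots> = tmap K M N (\<lambda>m. m) f t \<ominus>\<^bsub>?T\<^esub> tmap K M N (\<lambda>m. m) (\<lambda>y. q (f y)) t"
      proof (rule tensor_ext[OF M N lin_tmap[OF M N M N lin_id d] _ T _ t])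
        show "(\<lambda>t. tmap K M N (\<lambda>m. m) f t \<ominus>\<^bsub>?T\<^esub> tmap K M N (\<lambda>m. m) (\<lambda>y. q (f y)) t) \<in> L ?T ?T"
          by (intro lin_diff lin_tmap M N lin_id f qf T)
        show "tmap K M N (\<lambda>m. m) (\<lambda>y. f y \<ominus>\<^bsub>N\<^esub> q (f y)) (pure_tensor K M N m n)
          = tmap K M N (\<lambda>m. m) f (pure_tensor K M N m n) \<ominus>\<^bsub>?T\<^esub> tmap K M N (\<lambda>m. m) (\<lambda>y. q (f y)) (pure_tensor K M N m n)"
          if mn: "m \<in> carrier M" "n \<in> carrier N" for m n
          using lin_minus[OF bilin_right[OF bilin_pure[OF M N] mn(1)] N T fc[OF mn(2)]]
          by (simp add: tmap_pure[OF M N M N lin_id] d f qf mn)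
      qed
      finally show ?thesis using rank_one[OF \<phi>(1) x'] by simp
    qed
    moreover have "tmap K M N (\<lambda>m. m) (\<lambda>y. q (f y)) t = \<zero>\<^bsub>?T\<^esub>"
      using U qf q(2) lin_closed[OF f] by (auto simp: kills_def)
    moreover have "tmap K M N (\<lambda>m. m) f t \<in> carrier ?T"
      by (rule lin_closed[OF lin_tmap[OF M N M N lin_id f] t])
    ultimately show "tmap K M N (\<lambda>m. m) f t = \<zero>\<^bsub>?T\<^esub>"
      using vs_minus_self[OF T _ vs_zero[OF T]] by metis
  qed
  obtain B where B: "finite B" "B \<subseteq> carrier N"
    and fix_t: "\<And>f. \<lbrakk>f \<in> L N N; \<forall>b\<in>B. f b = b\<rbrakk> \<Longrightarrow> tmap K M N (\<lambda>m. m) f t = t"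
    using tensor_finite_support[OF M N t] by blast
  from B have "\<exists>U. kills U \<and> B \<subseteq> U"
  proof (induction B rule: finite_induct)
    case empty
    show ?case using base by blast
  next
    case (insert x B)
    then obtain U where U: "kills U" "B \<subseteq> U" and x: "x \<in> carrier N" by auto
    have sU: "submodule U K N" using U by (simp add: kills_def)
    let ?U = "{n \<oplus>\<^bsub>N\<^esub> a \<odot>\<^bsub>N\<^esub> x | n a. n \<in> U \<and> a \<in> carrier K}"
    have "y \<in> ?U" if y: "y \<in> U" for y
    proof -
      have "y = y \<oplus>\<^bsub>N\<^esub> \<zero> \<odot>\<^bsub>N\<^esub> x" using y x subspace_subset[OF sU] by auto
      thus ?thesis using y by blast
    qed
    moreover have "x = \<zero>\<^bsub>N\<^esub> \<oplus>\<^bsub>N\<^esub> \<one> \<odot>\<^bsub>N\<^esub> x" using x by simp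
    hence "x \<in> ?U" using subspace_zero[OF sU] by blast
    ultimately have "insert x B \<subseteq> ?U" using U(2) by blast
    thus ?case using step[OF U(1) x] by blast
  qed
  then obtain U where U: "kills U" "B \<subseteq> U" by blast
  hence sU: "submodule U K N" by (simp add: kills_def)
  obtain p where p: "p \<in> L N N" "\<And>y. y \<in> carrier N \<Longrightarrow> p y \<in> U" "\<And>u. u \<in> U \<Longrightarrow> p u = u"
    using retraction_exists[OF N sU] by metis
  have "t = tmap K M N (\<lambda>m. m) p t" using fix_t[OF p(1)] p(3) U(2) by auto
  also have "\<dots> = \<zero>\<^bsub>?T\<^esub>" using U(1) p(1,2) by (auto simp: kills_def)
  finally show ?thesis .
qed

end

section \<open>Sweedler calculus\<close>

sublocale coalgebra \<subseteq> scalars K ..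

context coalgebra
begin

lemma vsC: "vs C" ..

lemma vsCC: "vs (tensor K C C)" by (rule vs_tensor[OF vsC vsC])

lemma comult_closed: "c \<in> carrier C \<Longrightarrow> comult C c \<in> carrier (tensor K C C)"
  by (rule lin_closed[OF comult_linear])

lemma counit_closed: "c \<in> carrier C \<Longrightarrow> counit C c \<in> carrier K"
  using lin_closed[OF counit_linear] by simp

lemma lin_counit: "f \<in> L X C \<Longrightarrow> (\<lambda>x. counit C (f x)) \<in> L X (scalar_module K)"
  by (rule lin_comp[OF counit_linear])

text \<open>\<open>sw P b c\<close> is the Sweedler sum of the \<open>b c\<^sup>1 c\<^sup>2\<close>.\<close>

definition sw :: "('k, 'p, 'z) module_scheme \<Rightarrow> ('c \<Rightarrow> 'c \<Rightarrow> 'p) \<Rightarrow> 'c \<Rightarrow> 'p"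
  where "sw P b c = tlift K P b (comult C c)"

lemma sw_closed:
  "\<lbrakk>c \<in> carrier C; vs P; \<And>x y. \<lbrakk>x \<in> carrier C; y \<in> carrier C\<rbrakk> \<Longrightarrow> b x y \<in> carrier P\<rbrakk>
    \<Longrightarrow> sw P b c \<in> carrier P"
  unfolding sw_def by (rule tlift_closed[OF vsC vsC comult_closed])

lemma sw_cong:
  assumes "c \<in> carrier C" "vs P"
    and "\<And>x y. \<lbrakk>x \<in> carrier C; y \<in> carrier C\<rbrakk> \<Longrightarrow> b' x y \<in> carrier P"
    and "\<And>x y. \<lbrakk>x \<in> carrier C; y \<in> carrier C\<rbrakk> \<Longrightarrow> b x y = b' x y"
  shows "sw P b c = sw P b' c"
  unfolding sw_def by (rule tlift_cong[OF vsC vsC comult_closed]) (use assms in auto)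

lemma sw_commute:
  "\<lbrakk>c \<in> carrier C; f \<in> L P P'; vs P; vs P';
    \<And>x y. \<lbrakk>x \<in> carrier C; y \<in> carrier C\<rbrakk> \<Longrightarrow> b x y \<in> carrier P\<rbrakk>
    \<Longrightarrow> f (sw P b c) = sw P' (\<lambda>x y. f (b x y)) c"
  unfolding sw_def by (rule tlift_commute[OF vsC vsC comult_closed])

lemma lin_sw_arg:
  "\<lbrakk>f \<in> L X C; bilin C C P b; vs P\<rbrakk> \<Longrightarrow> (\<lambda>x. sw P b (f x)) \<in> L X P"
  unfolding sw_def
  by (rule lin_tlift_arg[OF lin_comp[OF comult_linear] _ vsC vsC])

lemma lin_sw_par:
  "\<lbrakk>c \<in> carrier C; vs P; vs X;
    \<And>y z. \<lbrakk>y \<in> carrier C; z \<in> carrier C\<rbrakk> \<Longrightarrow> (\<lambda>x. b x y z) \<in> L X P\<rbrakk>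
    \<Longrightarrow> (\<lambda>x. sw P (b x) c) \<in> L X P"
  unfolding sw_def by (rule tlift_lin_param[OF vsC vsC comult_closed])

lemma sw_tlift_swap:
  "\<lbrakk>c \<in> carrier C; u \<in> carrier (tensor K M N); vs M; vs N; vs P;
    \<And>x y. \<lbrakk>x \<in> carrier C; y \<in> carrier C\<rbrakk> \<Longrightarrow> bilin M N P (b x y)\<rbrakk>
   \<Longrightarrow> sw P (\<lambda>x y. tlift K P (b x y) u) c = tlift K P (\<lambda>p q. sw P (\<lambda>x y. b x y p q) c) u"
  unfolding sw_def by (rule tlift_swap[OF comult_closed _ vsC vsC])

lemma sw_swap:
  "\<lbrakk>c \<in> carrier C; d \<in> carrier C; vs P;
    \<And>x y. \<lbrakk>x \<in> carrier C; y \<in> carrier C\<rbrakk> \<Longrightarrow> bilin C C P (b x y)\<rbrakk>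
   \<Longrightarrow> sw P (\<lambda>x y. sw P (b x y) d) c = sw P (\<lambda>p q. sw P (\<lambda>x y. b x y p q) c) d"
  using sw_tlift_swap[OF _ comult_closed vsC vsC, of c d P b] by (simp add: sw_def)

text \<open>The linear map \<open>\<Phi>\<close> on \<open>C \<otimes> (C \<otimes> C)\<close> that a trilinear map induces turns the coassociativity of
  the coalgebra into an identity of iterated Sweedler sums.\<close>

lemma sw_coassoc:
  assumes c: "c \<in> carrier C" and P: "vs P"
    and b1: "\<And>y z. \<lbrakk>y \<in> carrier C; z \<in> carrier C\<rbrakk> \<Longrightarrow> (\<lambda>x. b x y z) \<in> L C P"
    and b2: "\<And>x z. \<lbrakk>x \<in> carrier C; z \<in> carrier C\<rbrakk> \<Longrightarrow> (\<lambda>y. b x y z) \<in> L C P"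
    and b3: "\<And>x y. \<lbrakk>x \<in> carrier C; y \<in> carrier C\<rbrakk> \<Longrightarrow> (\<lambda>z. b x y z) \<in> L C P"
  shows "sw P (\<lambda>x z. sw P (\<lambda>x1 x2. b x1 x2 z) x) c = sw P (\<lambda>x y. sw P (\<lambda>y1 y2. b x y1 y2) y) c"
proof -
  let ?CC = "tensor K C C"
  have bc: "b x y z \<in> carrier P" if "x \<in> carrier C" "y \<in> carrier C" "z \<in> carrier C" for x y z
    by (rule lin_closed[OF b1]) (use that in auto)
  have bb: "bilin C C P (b x)" if "x \<in> carrier C" for x by (rule bilinI) (auto intro: b2 b3 that)
  define \<Phi> where "\<Phi> = tlift K P (\<lambda>x t. tlift K P (b x) t)"
  have bP: "bilin C ?CC P (\<lambda>x t. tlift K P (b x) t)"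
    by (rule bilinI) (auto intro: lin_tlift[OF vsC vsC P] bb tlift_lin_param[OF vsC vsC _ P vsC] b1)
  have \<Phi>: "\<Phi> \<in> L (tensor K C ?CC) P" unfolding \<Phi>_def by (rule lin_tlift[OF vsC vsCC P bP])
  have \<Phi>p: "\<Phi> (pure_tensor K C ?CC x t) = tlift K P (b x) t" if "x \<in> carrier C" "t \<in> carrier ?CC" for x t
    unfolding \<Phi>_def by (rule tlift_pure[OF vsC vsCC P bP that])
  have T: "vs (tensor K C ?CC)" "vs (tensor K ?CC C)" by (intro vs_tensor vsC)+
  note pc = pure_closed[OF _ _ vsC vsC] pure_closed[OF _ _ vsC vsCC] pure_closed[OF _ _ vsCC vsC]
  note pb = bilin_pure[OF vsC vsC] bilin_pure[OF vsC vsCC] bilin_pure[OF vsCC vsC]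
  have "\<Phi> (tassoc K C C C (tmap K ?CC C (comult C) id (comult C c)))
      = sw P (\<lambda>x z. sw P (\<lambda>x1 x2. b x1 x2 z) x) c"
  proof -
    have "(\<lambda>t. \<Phi> (tassoc K C C C t)) \<in> L (tensor K ?CC C) P"
      by (rule lin_comp[OF \<Phi> lin_tassoc[OF vsC vsC vsC]])
    hence "\<Phi> (tassoc K C C C (tmap K ?CC C (comult C) id (comult C c)))
        = sw P (\<lambda>x z. \<Phi> (tassoc K C C C (pure_tensor K ?CC C (comult C x) z))) c"
      unfolding tmap_def sw_def id_def
      by (intro tlift_commute[OF vsC vsC comult_closed[OF c] T(2) P]) (auto intro: pc comult_closed)
    also have "\<dots> = sw P (\<lambda>x z. sw P (\<lambda>x1 x2. b x1 x2 z) x) c"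
    proof (rule sw_cong[OF c P])
      fix x z assume x: "x \<in> carrier C" "z \<in> carrier C"
      have "\<Phi> (tassoc K C C C (pure_tensor K ?CC C (comult C x) z))
         = sw P (\<lambda>m n. \<Phi> (pure_tensor K C ?CC m (pure_tensor K C C n z))) x"
        unfolding tassoc_pure[OF vsC vsC vsC comult_closed[OF x(1)] x(2)] sw_def
        by (rule tlift_commute[OF vsC vsC comult_closed[OF x(1)] T(1) P \<Phi>]) (auto intro: pc x)
      also have "\<dots> = sw P (\<lambda>x1 x2. b x1 x2 z) x"
        by (rule sw_cong[OF x(1) P]) (auto simp: x bc pc \<Phi>p tlift_pure[OF vsC vsC P bb])
      finally show "\<Phi> (tassoc K C C C (pure_tensor K ?CC C (comult C x) z)) = sw P (\<lambda>x1 x2. b x1 x2 z) x" .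
    qed (auto intro!: sw_closed P bc)
    finally show ?thesis .
  qed
  moreover have "\<Phi> (tmap K C ?CC id (comult C) (comult C c)) = sw P (\<lambda>x y. sw P (\<lambda>y1 y2. b x y1 y2) y) c"
  proof -
    have "\<Phi> (tmap K C ?CC id (comult C) (comult C c))
       = sw P (\<lambda>x y. \<Phi> (pure_tensor K C ?CC x (comult C y))) c"
      unfolding tmap_def sw_def id_def
      by (rule tlift_commute[OF vsC vsC comult_closed[OF c] T(1) P \<Phi>]) (auto intro: pc comult_closed)
    also have "\<dots> = sw P (\<lambda>x y. sw P (\<lambda>y1 y2. b x y1 y2) y) c"
      by (rule sw_cong[OF c P]) (auto simp: \<Phi>p comult_closed sw_def[symmetric] intro!: sw_closed P bc)
    finally show ?thesis .
  qed
  ultimately show ?thesis using coassoc[OF c] by simp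
qed

lemma sw_counit_left:
  assumes c: "c \<in> carrier C" and P: "vs P" and f: "f \<in> L C P"
  shows "sw P (\<lambda>x y. counit C x \<odot>\<^bsub>P\<^esub> f y) c = f c"
proof -
  have "f c = f (tlift K C (\<lambda>x y. counit C x \<odot>\<^bsub>C\<^esub> y) (comult C c))" by (simp add: counit_left[OF c])
  also have "\<dots> = sw P (\<lambda>x y. f (counit C x \<odot>\<^bsub>C\<^esub> y)) c"
    unfolding sw_def by (rule tlift_commute[OF vsC vsC comult_closed[OF c] vsC P f])
      (auto intro: vs_smult[OF vsC] counit_closed)
  also have "\<dots> = sw P (\<lambda>x y. counit C x \<odot>\<^bsub>P\<^esub> f y) c"
    by (rule sw_cong[OF c P]) (auto simp: lin_smult[OF f] counit_closed lin_closed[OF f] vs_smult[OF P])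
  finally show ?thesis by simp
qed

lemma sw_counit_right:
  assumes c: "c \<in> carrier C" and P: "vs P" and f: "f \<in> L C P"
  shows "sw P (\<lambda>x y. counit C y \<odot>\<^bsub>P\<^esub> f x) c = f c"
proof -
  have "f c = f (tlift K C (\<lambda>x y. counit C y \<odot>\<^bsub>C\<^esub> x) (comult C c))" by (simp add: counit_right[OF c])
  also have "\<dots> = sw P (\<lambda>x y. f (counit C y \<odot>\<^bsub>C\<^esub> x)) c"
    unfolding sw_def by (rule tlift_commute[OF vsC vsC comult_closed[OF c] vsC P f])
      (auto intro: vs_smult[OF vsC] counit_closed)
  also have "\<dots> = sw P (\<lambda>x y. counit C y \<odot>\<^bsub>P\<^esub> f x) c"
    by (rule sw_cong[OF c P]) (auto simp: lin_smult[OF f] counit_closed lin_closed[OF f] vs_smult[OF P])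
  finally show ?thesis by simp
qed

lemma sw_cocomm:
  assumes cc: "cocommutative K C" and c: "c \<in> carrier C" and P: "vs P" and b: "bilin C C P b"
  shows "sw P (\<lambda>x y. b y x) c = sw P b c"
proof -
  have "sw P b c = tlift K P b (tlift K (tensor K C C) (\<lambda>x y. pure_tensor K C C y x) (comult C c))"
    using cc c by (simp add: cocommutative_def sw_def)
  also have "\<dots> = sw P (\<lambda>x y. tlift K P b (pure_tensor K C C y x)) c"
    unfolding sw_def
    by (rule tlift_commute[OF vsC vsC comult_closed[OF c] vsCC P lin_tlift[OF vsC vsC P b]])
      (auto intro: pure_closed[OF _ _ vsC vsC])
  also have "\<dots> = sw P (\<lambda>x y. b y x) c"
    by (rule sw_cong[OF c P]) (auto simp: tlift_pure[OF vsC vsC P b] bilin_closed[OF b])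
  finally show ?thesis by simp
qed


text \<open>Splitting \<open>c\<close> into four parts by cutting both halves gives the same as cutting the middle one
  of three parts.\<close>

lemma sw_coassoc4:
  assumes c: "c \<in> carrier C" and P: "vs P"
    and b1: "\<And>x y z. \<lbrakk>x \<in> carrier C; y \<in> carrier C; z \<in> carrier C\<rbrakk> \<Longrightarrow> (\<lambda>w. b w x y z) \<in> L C P"
    and b2: "\<And>x y z. \<lbrakk>x \<in> carrier C; y \<in> carrier C; z \<in> carrier C\<rbrakk> \<Longrightarrow> (\<lambda>w. b x w y z) \<in> L C P"
    and b3: "\<And>x y z. \<lbrakk>x \<in> carrier C; y \<in> carrier C; z \<in> carrier C\<rbrakk> \<Longrightarrow> (\<lambda>w. b x y w z) \<in> L C P"
    and b4: "\<And>x y z. \<lbrakk>x \<in> carrier C; y \<in> carrier C; z \<in> carrier C\<rbrakk> \<Longrightarrow> (\<lambda>w. b x y z w) \<in> L C P"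
  shows "sw P (\<lambda>x y. sw P (\<lambda>x1 x2. sw P (\<lambda>y1 y2. b x1 x2 y1 y2) y) x) c
    = sw P (\<lambda>x y. sw P (\<lambda>w z. sw P (\<lambda>u v. b x u v z) w) y) c"
proof -
  have bc: "b x y z w \<in> carrier P" if "x \<in> carrier C" "y \<in> carrier C" "z \<in> carrier C" "w \<in> carrier C" for x y z w
    by (rule lin_closed[OF b1]) (use that in auto)
  have "sw P (\<lambda>x y. sw P (\<lambda>x1 x2. sw P (\<lambda>y1 y2. b x1 x2 y1 y2) y) x) c
    = sw P (\<lambda>x y. sw P (\<lambda>u v. sw P (\<lambda>y1 y2. b x u y1 y2) v) y) c"
    by (rule sw_coassoc[OF c P]) (assumption | rule lin_sw_par lin_sw_arg lin_id vsC P b1 b2 b3 b4 bilinI)+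
  also have "\<dots> = sw P (\<lambda>x y. sw P (\<lambda>w z. sw P (\<lambda>u v. b x u v z) w) y) c"
    by (rule sw_cong[OF c P])
      ((assumption | rule sw_closed P bc)+, rule sw_coassoc[symmetric], (assumption | rule P b2 b3 b4)+)
  finally show ?thesis .
qed


subsection \<open>Slices\<close>

text \<open>These are the actions \<open>c\<^sup>1\<chi>(c\<^sup>2)\<close> and \<open>\<chi>(c\<^sup>1)c\<^sup>2\<close> of the dual algebra on \<open>C\<close>.  The rules for Sweedler
  sums of slices below are coassociativity with one of the three parts evaluated at \<open>\<chi>\<close>; with them
  threefold sums can be written as twofold ones.\<close>

definition slice_right :: "('c \<Rightarrow> 'k) \<Rightarrow> 'c \<Rightarrow> 'c"
  where "slice_right \<chi> c = sw C (\<lambda>x y. \<chi> y \<odot>\<^bsub>C\<^esub> x) c"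

definition slice_left :: "('c \<Rightarrow> 'k) \<Rightarrow> 'c \<Rightarrow> 'c"
  where "slice_left \<chi> c = sw C (\<lambda>x y. \<chi> x \<odot>\<^bsub>C\<^esub> y) c"

context
  fixes \<chi> assumes \<chi>: "\<chi> \<in> L C (scalar_module K)"
begin

lemma \<chi>_closed: "c \<in> carrier C \<Longrightarrow> \<chi> c \<in> carrier K"
  using lin_closed[OF \<chi>] by simp

lemmas slice_rules = lin_sw_par lin_sw_arg lin_id lin_comp[OF \<chi>] lin_smult_right lin_smult_left
  vsC \<chi>_closed vs_smult sw_closed bilinI

lemma lin_slice_right: "f \<in> L X C \<Longrightarrow> (\<lambda>x. slice_right \<chi> (f x)) \<in> L X C"
  and lin_slice_left: "f \<in> L X C \<Longrightarrow> (\<lambda>x. slice_left \<chi> (f x)) \<in> L X C"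
  unfolding slice_right_def slice_left_def by (assumption | rule slice_rules)+

lemma slice_right_closed: "c \<in> carrier C \<Longrightarrow> slice_right \<chi> c \<in> carrier C"
  and slice_left_closed: "c \<in> carrier C \<Longrightarrow> slice_left \<chi> c \<in> carrier C"
  using lin_closed[OF lin_slice_right[OF lin_id]] lin_closed[OF lin_slice_left[OF lin_id]] by auto

lemma lin_slice_right_commute:
  assumes "f \<in> L C P" "vs P" "c \<in> carrier C"
  shows "f (slice_right \<chi> c) = sw P (\<lambda>x y. \<chi> y \<odot>\<^bsub>P\<^esub> f x) c"
proof -
  have "f (slice_right \<chi> c) = sw P (\<lambda>x y. f (\<chi> y \<odot>\<^bsub>C\<^esub> x)) c"
    unfolding slice_right_def
    by (rule sw_commute[OF assms(3,1) vsC assms(2)]) (assumption | rule slice_rules)+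
  also have "\<dots> = sw P (\<lambda>x y. \<chi> y \<odot>\<^bsub>P\<^esub> f x) c"
    by (rule sw_cong) (use assms in \<open>auto simp: \<chi>_closed lin_smult[OF assms(1)] lin_closed[OF assms(1)] vs_smult\<close>)
  finally show ?thesis .
qed

lemma lin_slice_left_commute:
  assumes "f \<in> L C P" "vs P" "c \<in> carrier C"
  shows "f (slice_left \<chi> c) = sw P (\<lambda>x y. \<chi> x \<odot>\<^bsub>P\<^esub> f y) c"
proof -
  have "f (slice_left \<chi> c) = sw P (\<lambda>x y. f (\<chi> x \<odot>\<^bsub>C\<^esub> y)) c"
    unfolding slice_left_def
    by (rule sw_commute[OF assms(3,1) vsC assms(2)]) (assumption | rule slice_rules)+
  also have "\<dots> = sw P (\<lambda>x y. \<chi> x \<odot>\<^bsub>P\<^esub> f y) c"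
    by (rule sw_cong) (use assms in \<open>auto simp: \<chi>_closed lin_smult[OF assms(1)] lin_closed[OF assms(1)] vs_smult\<close>)
  finally show ?thesis .
qed

context
  fixes P :: "('k, 'p, 'z) module_scheme" and b and c
  assumes P: "vs P" and b: "bilin C C P b" and c: "c \<in> carrier C"
begin

lemma sw_slice_right: "sw P b (slice_right \<chi> c) = sw P (\<lambda>x y. b x (slice_right \<chi> y)) c"
proof -
  note r = lin_comp[OF bilin_right[OF b]] lin_comp[OF bilin_left[OF b]] bilin_closed[OF b] P
  have "sw P b (slice_right \<chi> c) = sw P (\<lambda>x z. \<chi> z \<odot>\<^bsub>P\<^esub> sw P b x) c"
    by (rule lin_slice_right_commute[OF lin_sw_arg[OF lin_id b P] P c])
  also have "\<dots> = sw P (\<lambda>x z. sw P (\<lambda>x1 x2. \<chi> z \<odot>\<^bsub>P\<^esub> b x1 x2) x) c"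
    by (rule sw_cong[OF c P])
      ((assumption | rule slice_rules r)+, rule sw_commute[where P = P and P' = P], (assumption | rule slice_rules r)+)
  also have "\<dots> = sw P (\<lambda>x y. sw P (\<lambda>y1 y2. \<chi> y2 \<odot>\<^bsub>P\<^esub> b x y1) y) c"
    by (rule sw_coassoc[OF c P]) (assumption | rule slice_rules r)+
  also have "\<dots> = sw P (\<lambda>x y. b x (slice_right \<chi> y)) c"
    by (rule sw_cong[OF c P])
      ((assumption | rule r slice_right_closed)+, rule lin_slice_right_commute[symmetric], (assumption | rule bilin_right[OF b] P)+)
  finally show ?thesis .
qed

lemma sw_slice_left: "sw P b (slice_left \<chi> c) = sw P (\<lambda>x y. b (slice_left \<chi> x) y) c"
proof -
  note r = lin_comp[OF bilin_right[OF b]] lin_comp[OF bilin_left[OF b]] bilin_closed[OF b] P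
  have "sw P b (slice_left \<chi> c) = sw P (\<lambda>x z. \<chi> x \<odot>\<^bsub>P\<^esub> sw P b z) c"
    by (rule lin_slice_left_commute[OF lin_sw_arg[OF lin_id b P] P c])
  also have "\<dots> = sw P (\<lambda>x z. sw P (\<lambda>x1 x2. \<chi> x \<odot>\<^bsub>P\<^esub> b x1 x2) z) c"
    by (rule sw_cong[OF c P])
      ((assumption | rule slice_rules r)+, rule sw_commute[where P = P and P' = P], (assumption | rule slice_rules r)+)
  also have "\<dots> = sw P (\<lambda>x y. sw P (\<lambda>x1 x2. \<chi> x1 \<odot>\<^bsub>P\<^esub> b x2 y) x) c"
    by (rule sw_coassoc[OF c P, symmetric]) (assumption | rule slice_rules r)+
  also have "\<dots> = sw P (\<lambda>x y. b (slice_left \<chi> x) y) c"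
    by (rule sw_cong[OF c P])
      ((assumption | rule r slice_left_closed)+, rule lin_slice_left_commute[symmetric], (assumption | rule bilin_left[OF b] P)+)
  finally show ?thesis .
qed

lemma sw_slice_middle: "sw P (\<lambda>x y. b (slice_right \<chi> x) y) c = sw P (\<lambda>x y. b x (slice_left \<chi> y)) c"
proof -
  note r = lin_comp[OF bilin_right[OF b]] lin_comp[OF bilin_left[OF b]] bilin_closed[OF b] P
  have "sw P (\<lambda>x y. b (slice_right \<chi> x) y) c = sw P (\<lambda>x y. sw P (\<lambda>x1 x2. \<chi> x2 \<odot>\<^bsub>P\<^esub> b x1 y) x) c"
    by (rule sw_cong[OF c P])
      ((assumption | rule r slice_rules)+, rule lin_slice_right_commute, (assumption | rule bilin_left[OF b] P)+)
  also have "\<dots> = sw P (\<lambda>x y. sw P (\<lambda>y1 y2. \<chi> y1 \<odot>\<^bsub>P\<^esub> b x y2) y) c"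
    by (rule sw_coassoc[OF c P]) (assumption | rule slice_rules r)+
  also have "\<dots> = sw P (\<lambda>x y. b x (slice_left \<chi> y)) c"
    by (rule sw_cong[OF c P])
      ((assumption | rule r slice_left_closed)+, rule lin_slice_left_commute[symmetric], (assumption | rule bilin_right[OF b] P)+)
  finally show ?thesis .
qed

end

end

lemma slice_left_right:
  assumes \<chi>: "\<chi> \<in> L C (scalar_module K)" and \<psi>: "\<psi> \<in> L C (scalar_module K)" and c: "c \<in> carrier C"
  shows "slice_left \<chi> (slice_right \<psi> c) = slice_right \<psi> (slice_left \<chi> c)"
proof -
  have "slice_left \<chi> (slice_right \<psi> c) = sw C (\<lambda>x y. \<chi> x \<odot>\<^bsub>C\<^esub> slice_right \<psi> y) c"
    unfolding slice_left_def
    by (rule sw_slice_right[OF \<psi> vsC _ c]) (assumption | rule slice_rules[OF \<chi>])+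
  also have "\<dots> = slice_right \<psi> (slice_left \<chi> c)"
    by (rule lin_slice_left_commute[OF \<chi> lin_slice_right[OF \<psi> lin_id] vsC c, symmetric])
  finally show ?thesis .
qed

end

section \<open>The cotensor square and its coinvariants\<close>

locale galois = scalars K + hopf_galois_coextension K H C act
  for K :: "('k, 'r) ring_scheme" (structure) and H :: "('k, 'h, 'x) coalgebra_scheme"
    and C :: "('k, 'c, 'y) coalgebra_scheme" and act :: "'c \<Rightarrow> 'h \<Rightarrow> 'c" +
  fixes I :: "'c set"
  assumes I: "I = coideal K H C act" and cocomm: "cocommutative K H"
begin

abbreviation "S \<equiv> scalar_module K"
abbreviation "D \<equiv> quot_coalgebra K C I"
abbreviation "T \<equiv> tensor K C C"
abbreviation "CS \<equiv> cotensor_square K C I"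
abbreviation "pt \<equiv> pure_tensor K C C"
abbreviation proj :: "'c \<Rightarrow> 'c set" (\<open>\<pi>\<close>) where "\<pi> \<equiv> (\<lambda>c. I +>\<^bsub>C\<^esub> c)"

lemma act_closed: "\<lbrakk>c \<in> carrier C; h \<in> carrier H\<rbrakk> \<Longrightarrow> act c h \<in> carrier C"
  by (rule lin_closed[OF act_linear_right])

lemma lin_act_right: "\<lbrakk>c \<in> carrier C; f \<in> L X H\<rbrakk> \<Longrightarrow> (\<lambda>x. act c (f x)) \<in> L X C"
  by (rule lin_comp[OF act_linear_right])

lemma lin_act_left: "\<lbrakk>h \<in> carrier H; f \<in> L X C\<rbrakk> \<Longrightarrow> (\<lambda>x. act (f x) h) \<in> L X C"
  by (rule lin_comp[OF act_linear_left])

lemma mult_closed: "\<lbrakk>g \<in> carrier H; h \<in> carrier H\<rbrakk> \<Longrightarrow> g \<otimes>\<^bsub>H\<^esub> h \<in> carrier H"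
  by (rule H.m_closed)

lemma lin_Hmult_right: "\<lbrakk>g \<in> carrier H; f \<in> L X H\<rbrakk> \<Longrightarrow> (\<lambda>x. g \<otimes>\<^bsub>H\<^esub> f x) \<in> L X H"
  by (rule lin_comp[of "\<lambda>x. g \<otimes>\<^bsub>H\<^esub> x"])
    (auto intro!: linI simp: H.r_distr H.smult_mult_right)

lemma lin_Hmult_left: "\<lbrakk>h \<in> carrier H; f \<in> L X H\<rbrakk> \<Longrightarrow> (\<lambda>x. f x \<otimes>\<^bsub>H\<^esub> h) \<in> L X H"
  by (rule lin_comp[of "\<lambda>x. x \<otimes>\<^bsub>H\<^esub> h"])
    (auto intro!: linI simp: H.l_distr H.smult_mult_left)

lemma subspace_I: "submodule I K C"
  unfolding I coideal_def
  by (rule span_subspace[OF C.vsC])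
    (auto intro!: vs_minus[OF C.vsC] vs_smult[OF C.vsC] act_closed H.counit_closed)

lemma D_simps:
  "carrier D = carrier (quot_module C I)" "add D = add (quot_module C I)"
  "zero D = zero (quot_module C I)" "smult D = smult (quot_module C I)"
  by (simp_all add: quot_coalgebra_def Let_def module.defs coalgebra.defs)

lemma vsD: "vs D"
  by (rule vs_cong[OF vs_quot[OF C.vsC subspace_I] D_simps])

lemma lin_proj0: "(\<lambda>x. \<pi> x) \<in> L C D"
  using lin_coset[OF C.vsC subspace_I] by (simp add: lin_hom_def D_simps)

lemma lin_proj: "f \<in> L X C \<Longrightarrow> (\<lambda>x. \<pi> (f x)) \<in> L X D"
  by (rule lin_comp[OF lin_proj0])

lemma proj_closed: "c \<in> carrier C \<Longrightarrow> \<pi> c \<in> carrier D"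
  by (rule lin_closed[OF lin_proj[OF lin_id]])

lemma proj_act:
  assumes c: "c \<in> carrier C" and h: "h \<in> carrier H"
  shows "\<pi> (act c h) = counit H h \<odot>\<^bsub>D\<^esub> \<pi> c"
proof -
  have "act c h \<ominus>\<^bsub>C\<^esub> counit H h \<odot>\<^bsub>C\<^esub> c \<in> I"
    unfolding I coideal_def by (rule subsetD[OF span_superset]) (use c h in auto)
  hence "\<pi> (act c h) = \<pi> (counit H h \<odot>\<^bsub>C\<^esub> c)"
    by (subst coset_eq_iff[OF C.vsC subspace_I])
      (use c h in \<open>auto intro: act_closed vs_smult[OF C.vsC] H.counit_closed\<close>)
  thus ?thesis using lin_smult[OF lin_proj[OF lin_id] H.counit_closed[OF h] c] by simp
qed

lemma functional_closed: "\<lbrakk>\<phi> \<in> L X S; x \<in> carrier X\<rbrakk> \<Longrightarrow> \<phi> x \<in> carrier K"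
  using lin_closed[of \<phi> X S x] by simp

text \<open>Linearity of a Sweedler expression in one of its variables, and membership of its values in the
  right carrier, are decided by the outermost symbol.  Applied as introduction rules, the following
  facts discharge all such side conditions.\<close>

lemmas vsT = C.vsCC
lemmas vs_facts = C.vsC H.vsC vsD vs_scalar vsT vs_tensor
lemmas clo = pure_closed C.sw_closed H.sw_closed act_closed mult_closed proj_closed
  H.counit_closed C.counit_closed m_closed vs_smult C.comult_closed H.comult_closed
lemmas lins = lin_id lin_pure_right lin_pure_left C.lin_sw_arg C.lin_sw_par H.lin_sw_arg H.lin_sw_par
  lin_act_right lin_act_left lin_Hmult_right lin_Hmult_left lin_smult_right lin_smult_left
  lin_mult_right lin_mult_left lin_proj H.lin_counit C.lin_counit bilinI
lemmas mlin = vs_facts clo lins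

lemma sw_act:
  assumes c: "c \<in> carrier C" and h: "h \<in> carrier H" and P: "vs P" and b: "bilin C C P b"
  shows "C.sw P b (act c h) = C.sw P (\<lambda>x y. H.sw P (\<lambda>p q. b (act x p) (act y q)) h) c"
proof -
  note l = lin_tlift[OF C.vsC C.vsC P b]
  have "C.sw P b (act c h) = tlift K P b (C.sw T (\<lambda>x y. H.sw T (\<lambda>p q. pt (act x p) (act y q)) h) c)"
    by (simp add: C.sw_def H.sw_def comult_act[OF c h] tensor_act_def)
  also have "\<dots> = C.sw P (\<lambda>x y. tlift K P b (H.sw T (\<lambda>p q. pt (act x p) (act y q)) h)) c"
    by (rule C.sw_commute[OF c l vsT P]) (assumption | rule mlin c h)+
  also have "\<dots> = C.sw P (\<lambda>x y. H.sw P (\<lambda>p q. b (act x p) (act y q)) h) c"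
  proof (rule C.sw_cong[OF c P])
    fix x y assume x: "x \<in> carrier C" "y \<in> carrier C"
    have "tlift K P b (H.sw T (\<lambda>p q. pt (act x p) (act y q)) h)
      = H.sw P (\<lambda>p q. tlift K P b (pt (act x p) (act y q))) h" (is "?lhs = _")
      by (rule H.sw_commute[OF h l vsT P]) (assumption | rule mlin x)+
    also have "\<dots> = H.sw P (\<lambda>p q. b (act x p) (act y q)) h" (is "_ = ?rhs")
      by (rule H.sw_cong[OF h P])
        (auto simp: tlift_pure[OF C.vsC C.vsC P b] act_closed x bilin_closed[OF b])
    finally show "?lhs = ?rhs" .
  qed (auto intro!: H.sw_closed h P bilin_closed[OF b] act_closed)
  finally show ?thesis .
qed


subsection \<open>The cotensor square\<close>

abbreviation "CDC \<equiv> tensor K C (tensor K D C)"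

definition coact_right :: "('c \<times> 'c \<Rightarrow> 'k) set \<Rightarrow> ('c \<times> ('c set \<times> 'c \<Rightarrow> 'k) set \<Rightarrow> 'k) set"
  where "coact_right t = tassoc K C D C (tmap K (tensor K C D) C (right_coaction K C I) id t)"

definition coact_left :: "('c \<times> 'c \<Rightarrow> 'k) set \<Rightarrow> ('c \<times> ('c set \<times> 'c \<Rightarrow> 'k) set \<Rightarrow> 'k) set"
  where "coact_left t = tmap K C (tensor K D C) id (left_coaction K C I) t"

lemma CS_def: "CS = {t \<in> carrier T. coact_right t = coact_left t}"
  by (simp add: cotensor_square_def cotensor_def coact_right_def coact_left_def)

lemma right_coaction_sw: "right_coaction K C I c = C.sw (tensor K C D) (\<lambda>x y. pure_tensor K C D x (\<pi> y)) c"
  by (simp add: right_coaction_def tmap_def C.sw_def)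

lemma left_coaction_sw: "left_coaction K C I c = C.sw (tensor K D C) (\<lambda>x y. pure_tensor K D C (\<pi> x) y) c"
  by (simp add: left_coaction_def tmap_def C.sw_def)

lemma lin_coaction: "right_coaction K C I \<in> L C (tensor K C D)" "left_coaction K C I \<in> L C (tensor K D C)"
  unfolding right_coaction_sw[abs_def] left_coaction_sw[abs_def] by (assumption | rule mlin)+

lemma lin_id_const: "id \<in> L M M"
  using lin_id by (simp add: id_def)

lemma lin_coact_right: "coact_right \<in> L T CDC"
  unfolding coact_right_def
  by (rule lin_comp[OF lin_tassoc[OF C.vsC vsD C.vsC] lin_tmap]) (rule vs_facts lin_coaction lin_id_const)+

lemma lin_coact_left: "coact_left \<in> L T CDC"
  unfolding coact_left_def by (rule lin_tmap) (rule vs_facts lin_coaction lin_id_const)+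

lemma coact_right_pure:
  assumes c: "c \<in> carrier C" and d: "d \<in> carrier C"
  shows "coact_right (pt c d) = C.sw CDC (\<lambda>x y. pure_tensor K C (tensor K D C) x (pure_tensor K D C (\<pi> y) d)) c"
proof -
  have rc: "right_coaction K C I c \<in> carrier (tensor K C D)" by (rule lin_closed[OF lin_coaction(1) c])
  have "coact_right (pt c d) = tassoc K C D C (pure_tensor K (tensor K C D) C (right_coaction K C I c) d)"
    unfolding coact_right_def
    by (subst tmap_pure[where M = C and N = C]) (rule vs_facts lin_coaction lin_id_const c d refl | simp)+
  also have "\<dots> = tlift K CDC (\<lambda>m n. pure_tensor K C (tensor K D C) m (pure_tensor K D C n d)) (right_coaction K C I c)"
    by (rule tassoc_pure[OF C.vsC vsD C.vsC rc d])
  also have "\<dots> = C.sw CDC (\<lambda>x y. tlift K CDC (\<lambda>m n. pure_tensor K C (tensor K D C) m (pure_tensor K D C n d)) (pure_tensor K C D x (\<pi> y))) c"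
    unfolding right_coaction_sw
    by (rule C.sw_commute[OF c lin_tlift]) (assumption | rule mlin d)+
  also have "\<dots> = C.sw CDC (\<lambda>x y. pure_tensor K C (tensor K D C) x (pure_tensor K D C (\<pi> y) d)) c"
  proof (rule C.sw_cong[OF c])
    fix x y assume xy: "x \<in> carrier C" "y \<in> carrier C"
    show "tlift K CDC (\<lambda>m n. pure_tensor K C (tensor K D C) m (pure_tensor K D C n d)) (pure_tensor K C D x (\<pi> y))
      = pure_tensor K C (tensor K D C) x (pure_tensor K D C (\<pi> y) d)"
      by (rule tlift_pure) (assumption | rule mlin d xy)+
  qed (assumption | rule mlin d)+
  finally show ?thesis .
qed

lemma coact_left_pure:
  assumes c: "c \<in> carrier C" and d: "d \<in> carrier C"
  shows "coact_left (pt c d) = C.sw CDC (\<lambda>x y. pure_tensor K C (tensor K D C) c (pure_tensor K D C (\<pi> x) y)) d"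
proof -
  have "coact_left (pt c d) = pure_tensor K C (tensor K D C) c (left_coaction K C I d)"
    unfolding coact_left_def
    by (subst tmap_pure[where M = C and N = C]) (rule vs_facts lin_coaction lin_id_const c d refl | simp)+
  also have "\<dots> = C.sw CDC (\<lambda>x y. pure_tensor K C (tensor K D C) c (pure_tensor K D C (\<pi> x) y)) d"
    unfolding left_coaction_sw
    by (rule C.sw_commute[OF d lin_pure_right[OF c lin_id]]) (assumption | rule mlin)+
  finally show ?thesis .
qed

lemma subspace_CS: "submodule CS K T"
  unfolding CS_def by (rule subspace_equalizer[OF lin_coact_right lin_coact_left]) (rule vs_facts)+

lemma CS_closed: "x \<in> CS \<Longrightarrow> x \<in> carrier T"
  by (simp add: CS_def)

abbreviation "TCS \<equiv> T\<lparr>carrier := CS\<rparr>"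

lemma vsTCS: "vs TCS"
  by (rule vs_subspace[OF vsT subspace_CS])

lemma lin_TCS: "f \<in> L T P \<Longrightarrow> f \<in> L TCS P"
  using CS_closed by (auto simp: lin_hom_def Pi_iff)


subsection \<open>The canonical map\<close>

text \<open>The value of the canonical map at \<open>c \<otimes> h\<close>.\<close>

definition cn :: "'c \<Rightarrow> 'h \<Rightarrow> ('c \<times> 'c \<Rightarrow> 'k) set"
  where "cn c h = C.sw T (\<lambda>x y. pt x (act y h)) c"

lemma bilin_cn: "bilin C H T cn"
  unfolding cn_def by (assumption | rule mlin)+

lemma cn_closed: "\<lbrakk>c \<in> carrier C; h \<in> carrier H\<rbrakk> \<Longrightarrow> cn c h \<in> carrier T"
  by (rule bilin_closed[OF bilin_cn])

lemma lin_cn_left: "\<lbrakk>h \<in> carrier H; f \<in> L X C\<rbrakk> \<Longrightarrow> (\<lambda>x. cn (f x) h) \<in> L X T"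
  by (rule lin_comp[OF bilin_left[OF bilin_cn]])

lemma lin_cn_right: "\<lbrakk>c \<in> carrier C; f \<in> L X H\<rbrakk> \<Longrightarrow> (\<lambda>x. cn c (f x)) \<in> L X T"
  by (rule lin_comp[OF bilin_right[OF bilin_cn]])

lemma can_tlift: "can K C act = tlift K T cn"
  by (simp add: can_def cn_def[abs_def] C.sw_def)

lemma lin_can: "can K C act \<in> L (tensor K C H) T"
  unfolding can_tlift by (rule lin_tlift[OF C.vsC H.vsC vsT bilin_cn])

lemma can_pure: "\<lbrakk>c \<in> carrier C; h \<in> carrier H\<rbrakk> \<Longrightarrow> can K C act (pure_tensor K C H c h) = cn c h"
  unfolding can_tlift by (rule tlift_pure[OF C.vsC H.vsC vsT bilin_cn])

lemma can_bij': "bij_betw (can K C act) (carrier (tensor K C H)) CS"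
  using can_bij by (simp add: I)

lemma cn_CS: "\<lbrakk>c \<in> carrier C; h \<in> carrier H\<rbrakk> \<Longrightarrow> cn c h \<in> CS"
  using bij_betwE[OF can_bij'] pure_closed[OF _ _ C.vsC H.vsC] can_pure by metis

lemma vsCH: "vs (tensor K C H)" by (rule vs_tensor[OF C.vsC H.vsC])

lemma CS_span:
  assumes U: "submodule U K T" and cn: "\<And>c h. \<lbrakk>c \<in> carrier C; h \<in> carrier H\<rbrakk> \<Longrightarrow> cn c h \<in> U"
  shows "CS \<subseteq> U"
proof -
  have sub: "carrier (tensor K C H) \<subseteq> {t \<in> carrier (tensor K C H). can K C act t \<in> U}"
    by (rule tensor_span[OF C.vsC H.vsC subspace_vimage[OF lin_can vsCH vsT U]])
      (auto simp: can_pure cn pure_closed[OF _ _ C.vsC H.vsC])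
  show ?thesis
    unfolding bij_betw_imp_surj_on[OF can_bij', symmetric]
    by (rule image_subsetI) (use subsetD[OF sub] in simp)
qed

lemma CS_ext:
  assumes f: "f \<in> L TCS P" and g: "g \<in> L TCS P" and P: "vs P"
    and cn: "\<And>c h. \<lbrakk>c \<in> carrier C; h \<in> carrier H\<rbrakk> \<Longrightarrow> f (cn c h) = g (cn c h)" and x: "x \<in> CS"
  shows "f x = g x"
proof -
  have "submodule {x \<in> carrier TCS. f x = g x} K TCS" by (rule subspace_equalizer[OF f g vsTCS P])
  hence "submodule {x \<in> CS. f x = g x} K T"
    using subspace_subset[OF subspace_CS] subspaceD[of "{x \<in> CS. f x = g x}" TCS]
    by (intro subspaceI[OF vsT]) auto
  hence "CS \<subseteq> {x \<in> CS. f x = g x}" by (rule CS_span) (auto simp: cn cn_CS)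
  thus ?thesis using x by auto
qed

abbreviation "\<kappa>\<^sub>0 \<equiv> translation_map K H C act"

lemma inv_can:
  "(\<lambda>x. inv_into (carrier (tensor K C H)) (can K C act) x) \<in> L TCS (tensor K C H)"
  "t \<in> carrier (tensor K C H) \<Longrightarrow> inv_into (carrier (tensor K C H)) (can K C act) (can K C act t) = t"
proof -
  let ?i = "inv_into (carrier (tensor K C H)) (can K C act)"
  show i: "?i (can K C act t) = t" if "t \<in> carrier (tensor K C H)" for t
    by (rule bij_betw_inv_into_left[OF can_bij' that])
  have ex: "\<exists>t\<in>carrier (tensor K C H). x = can K C act t" if "x \<in> CS" for x
  proof -
    have "x \<in> can K C act ` carrier (tensor K C H)"
      using that bij_betw_imp_surj_on[OF can_bij'] by simp
    thus ?thesis by (elim imageE) (rule bexI)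
  qed
  show "(\<lambda>x. ?i x) \<in> L TCS (tensor K C H)"
  proof (rule linI)
    fix x assume "x \<in> carrier TCS"
    then obtain t where t: "t \<in> carrier (tensor K C H)" "x = can K C act t" using ex by auto
    show "?i x \<in> carrier (tensor K C H)" using t i by simp
    {
      fix y assume "y \<in> carrier TCS"
      then obtain u where u: "u \<in> carrier (tensor K C H)" "y = can K C act u" using ex by auto
      show "?i (x \<oplus>\<^bsub>TCS\<^esub> y) = ?i x \<oplus>\<^bsub>tensor K C H\<^esub> ?i y"
        using t u by (simp add: i lin_add[OF lin_can, symmetric] vs_add[OF vsCH])
    next
      fix a assume a: "a \<in> carrier K"
      show "?i (a \<odot>\<^bsub>TCS\<^esub> x) = a \<odot>\<^bsub>tensor K C H\<^esub> ?i x"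
        using t a by (simp add: i lin_smult[OF lin_can, symmetric] vs_smult[OF vsCH])
    }
  qed
qed

lemma lin_translation: "\<kappa>\<^sub>0 \<in> L TCS H"
  unfolding translation_map_def
  by (rule lin_tlift_arg[OF inv_can(1)]) (assumption | rule mlin)+

lemma translation_cn:
  assumes c: "c \<in> carrier C" and h: "h \<in> carrier H"
  shows "\<kappa>\<^sub>0 (cn c h) = counit C c \<odot>\<^bsub>H\<^esub> h"
proof -
  have "\<kappa>\<^sub>0 (cn c h) = tlift K H (\<lambda>c h. counit C c \<odot>\<^bsub>H\<^esub> h) (pure_tensor K C H c h)"
    unfolding translation_map_def can_pure[OF c h, symmetric]
    by (subst inv_can(2)) (use c h in \<open>auto intro: pure_closed C.vsC H.vsC\<close>)
  also have "\<dots> = counit C c \<odot>\<^bsub>H\<^esub> h"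
    by (rule tlift_pure) (assumption | rule mlin c h)+
  finally show ?thesis .
qed


subsection \<open>The relations\<close>

text \<open>\<open>\<chi>\<close> absorbs the part of \<open>h\<close> that acts on its argument, and the counit law removes it.\<close>

lemma slice_right_act:
  assumes \<chi>: "\<chi> \<in> L C S" and inv: "\<And>c h. \<lbrakk>c \<in> carrier C; h \<in> carrier H\<rbrakk> \<Longrightarrow> \<chi> (act c h) = counit H h \<otimes> \<chi> c"
    and c: "c \<in> carrier C" and h: "h \<in> carrier H"
  shows "C.slice_right \<chi> (act c h) = act (C.slice_right \<chi> c) h"
proof -
  note \<chi>r = C.\<chi>_closed[OF \<chi>] lin_comp[OF \<chi>]
  have "C.slice_right \<chi> (act c h) = C.sw C (\<lambda>x y. H.sw C (\<lambda>p q. \<chi> (act y q) \<odot>\<^bsub>C\<^esub> act x p) h) c"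
    unfolding C.slice_right_def
    by (rule sw_act[OF c h C.vsC]) (assumption | rule mlin \<chi>r)+
  also have "\<dots> = C.sw C (\<lambda>x y. \<chi> y \<odot>\<^bsub>C\<^esub> act x h) c"
  proof (rule C.sw_cong[OF c C.vsC])
    fix x y assume x: "x \<in> carrier C" and y: "y \<in> carrier C"
    have "H.sw C (\<lambda>p q. \<chi> (act y q) \<odot>\<^bsub>C\<^esub> act x p) h
      = H.sw C (\<lambda>p q. counit H q \<odot>\<^bsub>C\<^esub> (\<chi> y \<odot>\<^bsub>C\<^esub> act x p)) h" (is "?lhs = _")
    proof (rule H.sw_cong[OF h C.vsC])
      fix p q assume pq: "p \<in> carrier H" "q \<in> carrier H"
      show "\<chi> (act y q) \<odot>\<^bsub>C\<^esub> act x p = counit H q \<odot>\<^bsub>C\<^esub> (\<chi> y \<odot>\<^bsub>C\<^esub> act x p)"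
        using module.smult_assoc1[OF C.vsC H.counit_closed[OF pq(2)] \<chi>r(1)[OF y] act_closed[OF x pq(1)]]
        by (simp add: inv y pq)
    qed (assumption | rule mlin \<chi>r x y)+
    also have "\<dots> = \<chi> y \<odot>\<^bsub>C\<^esub> act x h" (is "_ = ?rhs")
      by (rule H.sw_counit_right[OF h C.vsC]) (assumption | rule mlin \<chi>r x y)+
    finally show "?lhs = ?rhs" .
  qed (assumption | rule mlin \<chi>r h)+
  also have "\<dots> = act (C.slice_right \<chi> c) h"
    by (rule C.lin_slice_right_commute[OF \<chi> lin_act_left[OF h lin_id] C.vsC c, symmetric])
  finally show ?thesis .
qed

abbreviation pull :: "('c set \<Rightarrow> 'k) \<Rightarrow> 'c \<Rightarrow> 'k" where "pull \<phi> \<equiv> (\<lambda>c. \<phi> (\<pi> c))"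

text \<open>In \<open>ract\<close> a functional on \<open>D\<close> slices the second tensor factor from the right, in \<open>lact\<close> the
  first one from the left.\<close>

definition ract :: "('c set \<Rightarrow> 'k) \<Rightarrow> ('c \<times> 'c \<Rightarrow> 'k) set \<Rightarrow> ('c \<times> 'c \<Rightarrow> 'k) set"
  where "ract \<phi> = tlift K T (\<lambda>c d. C.sw T (\<lambda>x y. \<phi> (\<pi> y) \<odot>\<^bsub>T\<^esub> pt c x) d)"

definition lact :: "('c set \<Rightarrow> 'k) \<Rightarrow> ('c \<times> 'c \<Rightarrow> 'k) set \<Rightarrow> ('c \<times> 'c \<Rightarrow> 'k) set"
  where "lact \<phi> = tlift K T (\<lambda>c d. C.sw T (\<lambda>x y. \<phi> (\<pi> x) \<odot>\<^bsub>T\<^esub> pt y d) c)"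

abbreviation "W \<equiv> coinv_rel K C I"

lemma W_def: "W = lin_span K T {ract \<phi> x \<ominus>\<^bsub>T\<^esub> lact \<phi> x | \<phi> x. \<phi> \<in> L D S \<and> x \<in> CS}"
  by (simp add: coinv_rel_def ract_def lact_def C.sw_def Let_def)

context
  fixes \<phi> assumes \<phi>: "\<phi> \<in> L D S"
begin

lemma lin_pull: "pull \<phi> \<in> L C S"
  by (rule lin_comp[OF \<phi> lin_proj[OF lin_id]])

lemma pull_act: "\<lbrakk>c \<in> carrier C; h \<in> carrier H\<rbrakk> \<Longrightarrow> pull \<phi> (act c h) = counit H h \<otimes> pull \<phi> c"
  using lin_smult[OF \<phi>, of "counit H h" "\<pi> c"]
  by (simp add: proj_act H.counit_closed proj_closed scalar_module_def)

lemmas pull_rules = lin_comp[OF \<phi>] functional_closed[OF \<phi>]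
lemmas slice_closed = C.slice_right_closed[OF lin_pull] C.slice_left_closed[OF lin_pull]

lemma lin_ract: "ract \<phi> \<in> L T T" and lin_lact: "lact \<phi> \<in> L T T"
  unfolding ract_def lact_def
  by (rule lin_tlift[OF C.vsC C.vsC vsT], (assumption | rule mlin pull_rules)+)+

lemma ract_pure:
  assumes c: "c \<in> carrier C" and d: "d \<in> carrier C"
  shows "ract \<phi> (pt c d) = pt c (C.slice_right (pull \<phi>) d)"
proof -
  have "ract \<phi> (pt c d) = C.sw T (\<lambda>x y. \<phi> (\<pi> y) \<odot>\<^bsub>T\<^esub> pt c x) d"
    unfolding ract_def
    by (rule tlift_pure[OF C.vsC C.vsC vsT _ c d]) (assumption | rule mlin pull_rules)+
  also have "\<dots> = pt c (C.slice_right (pull \<phi>) d)"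
    by (rule C.lin_slice_right_commute[OF lin_pull _ vsT d, symmetric]) (assumption | rule mlin c)+
  finally show ?thesis .
qed

lemma lact_pure:
  assumes c: "c \<in> carrier C" and d: "d \<in> carrier C"
  shows "lact \<phi> (pt c d) = pt (C.slice_left (pull \<phi>) c) d"
proof -
  have "lact \<phi> (pt c d) = C.sw T (\<lambda>x y. \<phi> (\<pi> x) \<odot>\<^bsub>T\<^esub> pt y d) c"
    unfolding lact_def
    by (rule tlift_pure[OF C.vsC C.vsC vsT _ c d]) (assumption | rule mlin pull_rules)+
  also have "\<dots> = pt (C.slice_left (pull \<phi>) c) d"
    by (rule C.lin_slice_left_commute[OF lin_pull _ vsT c, symmetric]) (assumption | rule mlin d)+
  finally show ?thesis .
qed

lemma ract_cn:
  assumes c: "c \<in> carrier C" and h: "h \<in> carrier H"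
  shows "ract \<phi> (cn c h) = cn (C.slice_right (pull \<phi>) c) h"
proof -
  have "ract \<phi> (cn c h) = C.sw T (\<lambda>x y. ract \<phi> (pt x (act y h))) c"
    unfolding cn_def by (rule C.sw_commute[OF c lin_ract vsT vsT]) (assumption | rule mlin h)+
  also have "\<dots> = C.sw T (\<lambda>x y. pt x (act (C.slice_right (pull \<phi>) y) h)) c"
    by (rule C.sw_cong[OF c vsT])
      (assumption | rule mlin slice_closed h |
       simp add: ract_pure act_closed h slice_right_act[OF lin_pull pull_act])+
  also have "\<dots> = cn (C.slice_right (pull \<phi>) c) h"
    unfolding cn_def
    by (rule C.sw_slice_right[OF lin_pull vsT _ c, symmetric]) (assumption | rule mlin h)+
  finally show ?thesis .
qed

lemma lact_cn:
  assumes c: "c \<in> carrier C" and h: "h \<in> carrier H"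
  shows "lact \<phi> (cn c h) = cn (C.slice_left (pull \<phi>) c) h"
proof -
  have "lact \<phi> (cn c h) = C.sw T (\<lambda>x y. lact \<phi> (pt x (act y h))) c"
    unfolding cn_def by (rule C.sw_commute[OF c lin_lact vsT vsT]) (assumption | rule mlin h)+
  also have "\<dots> = C.sw T (\<lambda>x y. pt (C.slice_left (pull \<phi>) x) (act y h)) c"
    by (rule C.sw_cong[OF c vsT]) (assumption | rule mlin slice_closed h lact_pure)+
  also have "\<dots> = cn (C.slice_left (pull \<phi>) c) h"
    unfolding cn_def
    by (rule C.sw_slice_left[OF lin_pull vsT _ c, symmetric]) (assumption | rule mlin h)+
  finally show ?thesis .
qed

lemma ract_CS: "x \<in> CS \<Longrightarrow> ract \<phi> x \<in> CS" and lact_CS: "x \<in> CS \<Longrightarrow> lact \<phi> x \<in> CS"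
proof -
  have "CS \<subseteq> {x \<in> carrier T. ract \<phi> x \<in> CS}"
    by (rule CS_span[OF subspace_vimage[OF lin_ract vsT vsT subspace_CS]])
      (auto simp: ract_cn cn_closed cn_CS slice_closed)
  moreover have "CS \<subseteq> {x \<in> carrier T. lact \<phi> x \<in> CS}"
    by (rule CS_span[OF subspace_vimage[OF lin_lact vsT vsT subspace_CS]])
      (auto simp: lact_cn cn_closed cn_CS slice_closed)
  ultimately show "x \<in> CS \<Longrightarrow> ract \<phi> x \<in> CS" "x \<in> CS \<Longrightarrow> lact \<phi> x \<in> CS" by auto
qed

text \<open>By the counit laws both sides are \<open>\<phi>(\<pi> c)\<close>.\<close>

lemma counit_slices:
  assumes c: "c \<in> carrier C"
  shows "counit C (C.slice_right (pull \<phi>) c) = counit C (C.slice_left (pull \<phi>) c)"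
proof -
  have m: "a \<odot>\<^bsub>S\<^esub> b = b \<odot>\<^bsub>S\<^esub> a" "a \<odot>\<^bsub>S\<^esub> b \<in> carrier S" if "a \<in> carrier K" "b \<in> carrier K" for a b
    using m_comm[OF that] that by (simp_all add: scalar_module_def)
  have k: "pull \<phi> y \<in> carrier K" "counit C y \<in> carrier K" if "y \<in> carrier C" for y
    using that by (auto intro: functional_closed[OF \<phi>] proj_closed C.counit_closed)
  have "counit C (C.slice_right (pull \<phi>) c) = C.sw S (\<lambda>x y. pull \<phi> y \<odot>\<^bsub>S\<^esub> counit C x) c"
    by (rule C.lin_slice_right_commute[OF lin_pull C.counit_linear vs_scalar c])
  also have "\<dots> = C.sw S (\<lambda>x y. counit C x \<odot>\<^bsub>S\<^esub> pull \<phi> y) c"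
    by (rule C.sw_cong[OF c vs_scalar]) (simp_all add: m[simplified] k)
  also have "\<dots> = pull \<phi> c" by (rule C.sw_counit_left[OF c vs_scalar lin_pull])
  also have "\<dots> = C.sw S (\<lambda>x y. counit C y \<odot>\<^bsub>S\<^esub> pull \<phi> x) c"
    by (rule C.sw_counit_right[OF c vs_scalar lin_pull, symmetric])
  also have "\<dots> = C.sw S (\<lambda>x y. pull \<phi> x \<odot>\<^bsub>S\<^esub> counit C y) c"
    by (rule C.sw_cong[OF c vs_scalar]) (simp_all add: m[simplified] k)
  also have "\<dots> = counit C (C.slice_left (pull \<phi>) c)"
    by (rule C.lin_slice_left_commute[OF lin_pull C.counit_linear vs_scalar c, symmetric])
  finally show ?thesis .
qed

end

lemma W_gens: "{ract \<phi> x \<ominus>\<^bsub>T\<^esub> lact \<phi> x | \<phi> x. \<phi> \<in> L D S \<and> x \<in> CS} \<subseteq> CS"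
  by (auto intro!: subspace_minus[OF vsT subspace_CS] ract_CS lact_CS)

lemma subspace_W: "submodule W K T"
  unfolding W_def by (rule span_subspace[OF vsT]) (use W_gens CS_closed in blast)

lemma W_CS: "W \<subseteq> CS"
  unfolding W_def by (rule span_least[OF subspace_CS W_gens])

lemma subspace_W_TCS: "submodule W K TCS"
  using subspaceD[OF subspace_W] W_CS by (intro subspaceI[OF vsTCS]) auto

lemma W_memI: "\<lbrakk>\<phi> \<in> L D S; x \<in> CS\<rbrakk> \<Longrightarrow> ract \<phi> x \<ominus>\<^bsub>T\<^esub> lact \<phi> x \<in> W"
  unfolding W_def by (rule subsetD[OF span_superset]) auto

text \<open>The two actions of \<open>\<phi>\<close> at \<open>cn c h\<close> are the values of \<open>cn\<close> at the two slices of \<open>c\<close>, and the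
  elements \<open>cn c h\<close> span the cotensor square.\<close>

lemma W_vanish:
  assumes f: "f \<in> L TCS P" and P: "vs P"
    and eq: "\<And>\<phi> c h. \<lbrakk>\<phi> \<in> L D S; c \<in> carrier C; h \<in> carrier H\<rbrakk>
      \<Longrightarrow> f (cn (C.slice_right (pull \<phi>) c) h) = f (cn (C.slice_left (pull \<phi>) c) h)"
    and w: "w \<in> W"
  shows "f w = \<zero>\<^bsub>P\<^esub>"
proof -
  have s: "submodule {x \<in> carrier TCS. f x \<in> {\<zero>\<^bsub>P\<^esub>}} K TCS"
    by (rule subspace_vimage[OF f vsTCS P subspace_zero_space[OF P]])
  have sub: "submodule {x \<in> CS. f x = \<zero>\<^bsub>P\<^esub>} K T"
    using CS_closed subspaceD[OF s] by (intro subspaceI[OF vsT]) auto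
  have z: "f (ract \<phi> x \<ominus>\<^bsub>T\<^esub> lact \<phi> x) = \<zero>\<^bsub>P\<^esub>" if \<phi>: "\<phi> \<in> L D S" and x: "x \<in> CS" for \<phi> x
  proof -
    have r: "(\<lambda>x. f (ract \<phi> x)) \<in> L TCS P" "(\<lambda>x. f (lact \<phi> x)) \<in> L TCS P"
      using lin_ract[OF \<phi>] lin_lact[OF \<phi>] ract_CS[OF \<phi>] lact_CS[OF \<phi>] CS_closed f
      by (auto simp: lin_hom_def Pi_iff)
    have "f (ract \<phi> x) = f (lact \<phi> x)"
      by (rule CS_ext[OF r P _ x]) (simp add: ract_cn lact_cn \<phi> eq)
    moreover have "ract \<phi> x \<ominus>\<^bsub>T\<^esub> lact \<phi> x = ract \<phi> x \<ominus>\<^bsub>TCS\<^esub> lact \<phi> x"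
      using vs_minus_eq[OF vsT] vs_minus_eq[OF vsTCS] ract_CS[OF \<phi> x] lact_CS[OF \<phi> x] CS_closed by simp
    ultimately show ?thesis
      using lin_minus[OF f vsTCS P] ract_CS[OF \<phi> x] lact_CS[OF \<phi> x] vs_minus_self[OF P] lin_closed[OF f]
      by simp
  qed
  have "W \<subseteq> {x \<in> CS. f x = \<zero>\<^bsub>P\<^esub>}"
    unfolding W_def by (rule span_least[OF sub]) (use W_gens z in auto)
  thus ?thesis using w by auto
qed

lemma translation_W: "w \<in> W \<Longrightarrow> \<kappa>\<^sub>0 w = \<zero>\<^bsub>H\<^esub>"
  by (rule W_vanish[OF lin_translation H.vsC])
    (simp_all add: translation_cn slice_closed counit_slices)

lemma CH_swap:
  assumes c: "c \<in> carrier C" and h: "h \<in> carrier H" and P: "vs P"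
    and b: "\<And>x y. \<lbrakk>x \<in> carrier C; y \<in> carrier C\<rbrakk> \<Longrightarrow> bilin H H P (b x y)"
  shows "C.sw P (\<lambda>x y. H.sw P (b x y) h) c = H.sw P (\<lambda>p q. C.sw P (\<lambda>x y. b x y p q) c) h"
  using C.sw_tlift_swap[OF c H.comult_closed[OF h] H.vsC H.vsC P b] by (simp add: H.sw_def)


section \<open>The action of H\<close>

definition actT :: "'h \<Rightarrow> ('c \<times> 'c \<Rightarrow> 'k) set \<Rightarrow> ('c \<times> 'c \<Rightarrow> 'k) set"
  where "actT h = tmap K C C id (\<lambda>c'. act c' h)"

lemma actT_tlift: "actT h = tlift K T (\<lambda>x y. pt x (act y h))"
  by (simp add: actT_def tmap_def)

lemma lin_actT_left: "\<lbrakk>h \<in> carrier H; f \<in> L X T\<rbrakk> \<Longrightarrow> (\<lambda>x. actT h (f x)) \<in> L X T"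
  unfolding actT_tlift by (rule lin_comp[OF lin_tlift[OF C.vsC C.vsC vsT]]) (assumption | rule mlin)+

lemma lin_actT_right: "\<lbrakk>x \<in> carrier T; f \<in> L X H; vs X\<rbrakk> \<Longrightarrow> (\<lambda>y. actT (f y) x) \<in> L X T"
  unfolding actT_tlift
  by (rule lin_comp[of "\<lambda>h. tlift K T (\<lambda>u v. pt u (act v h)) x", OF tlift_lin_param[OF C.vsC C.vsC _ vsT H.vsC]])
    (assumption | rule mlin)+

lemma actT_closed: "\<lbrakk>h \<in> carrier H; x \<in> carrier T\<rbrakk> \<Longrightarrow> actT h x \<in> carrier T"
  by (rule lin_closed[OF lin_actT_left[OF _ lin_id]])

lemma actT_pure: "\<lbrakk>h \<in> carrier H; c \<in> carrier C; d \<in> carrier C\<rbrakk> \<Longrightarrow> actT h (pt c d) = pt c (act d h)"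
  unfolding actT_tlift by (rule tlift_pure[OF C.vsC C.vsC vsT]) (assumption | rule mlin)+

lemma actT_cn:
  assumes c: "c \<in> carrier C" and h: "h \<in> carrier H" and g: "g \<in> carrier H"
  shows "actT g (cn c h) = cn c (h \<otimes>\<^bsub>H\<^esub> g)"
proof -
  have "actT g (cn c h) = C.sw T (\<lambda>x y. actT g (pt x (act y h))) c"
    unfolding cn_def
    by (rule C.sw_commute[OF c lin_actT_left[OF g lin_id] vsT vsT]) (assumption | rule mlin h)+
  also have "\<dots> = C.sw T (\<lambda>x y. pt x (act y (h \<otimes>\<^bsub>H\<^esub> g))) c"
    by (rule C.sw_cong[OF c vsT]) (assumption | rule mlin h g | simp add: actT_pure act_closed h g act_mult)+
  finally show ?thesis by (simp add: cn_def)
qed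

lemma actT_CS:
  assumes g: "g \<in> carrier H" and x: "x \<in> CS"
  shows "actT g x \<in> CS"
proof -
  have "CS \<subseteq> {x \<in> carrier T. actT g x \<in> CS}"
    by (rule CS_span[OF subspace_vimage[OF lin_actT_left[OF g lin_id] vsT vsT subspace_CS]])
      (simp add: actT_cn cn_closed cn_CS g mult_closed)
  thus ?thesis using x by auto
qed

lemma actT_ract_lact:
  assumes g: "g \<in> carrier H" and \<phi>: "\<phi> \<in> L D S" and x: "x \<in> CS"
  shows "actT g (ract \<phi> x) = ract \<phi> (actT g x)" and "actT g (lact \<phi> x) = lact \<phi> (actT g x)"
proof -
  note l = lin_actT_left[OF g] lin_comp[OF lin_ract[OF \<phi>]] lin_comp[OF lin_lact[OF \<phi>]] lin_id
  show "actT g (ract \<phi> x) = ract \<phi> (actT g x)"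
    by (rule CS_ext[OF lin_TCS lin_TCS vsT _ x], (rule l)+)
      (simp add: ract_cn[OF \<phi>] actT_cn g mult_closed slice_closed[OF \<phi>])
  show "actT g (lact \<phi> x) = lact \<phi> (actT g x)"
    by (rule CS_ext[OF lin_TCS lin_TCS vsT _ x], (rule l)+)
      (simp add: lact_cn[OF \<phi>] actT_cn g mult_closed slice_closed[OF \<phi>])
qed

text \<open>The action of \<open>H\<close> affects only the second argument of \<open>cn\<close>, the slices only the first one, so
  they commute on the cotensor square.\<close>

lemma actT_W:
  assumes g: "g \<in> carrier H" and w: "w \<in> W"
  shows "actT g w \<in> W"
proof -
  note l = lin_actT_left[OF g lin_id]
  have *: "actT g (ract \<phi> x \<ominus>\<^bsub>T\<^esub> lact \<phi> x) \<in> W" if \<phi>: "\<phi> \<in> L D S" and x: "x \<in> CS" for \<phi> x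
    using W_memI[OF \<phi> actT_CS[OF g x]] lin_minus[OF l vsT vsT] ract_CS[OF \<phi> x] lact_CS[OF \<phi> x] CS_closed
    by (simp add: actT_ract_lact[OF g \<phi> x])
  have "{ract \<phi> x \<ominus>\<^bsub>T\<^esub> lact \<phi> x | \<phi> x. \<phi> \<in> L D S \<and> x \<in> CS} \<subseteq> {w \<in> carrier T. actT g w \<in> W}"
    using W_gens CS_closed by (auto simp: *)
  from span_least[OF subspace_vimage[OF l vsT vsT subspace_W] this]
  have "W \<subseteq> {w \<in> carrier T. actT g w \<in> W}" unfolding W_def .
  thus ?thesis using w by auto
qed


section \<open>The comultiplication\<close>

abbreviation "A \<equiv> ambient_quot K C I"
abbreviation "AA \<equiv> tensor K A A"
abbreviation "cls \<equiv> coinv_class K C I"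

lemma vsA: "vs A"
  unfolding ambient_quot_def by (rule vs_quot[OF vsT subspace_W])

lemma vsAA: "vs AA" by (rule vs_tensor[OF vsA vsA])

lemma lin_cls: "f \<in> L X T \<Longrightarrow> (\<lambda>x. cls (f x)) \<in> L X A"
  unfolding ambient_quot_def coinv_class_def by (rule lin_comp[OF lin_coset[OF vsT subspace_W]])

lemma cls_closed: "x \<in> carrier T \<Longrightarrow> cls x \<in> carrier A"
  by (rule lin_closed[OF lin_cls[OF lin_id]])

lemma A_cases:
  assumes "a \<in> carrier A" obtains x where "x \<in> carrier T" "a = cls x"
  using assms by (auto simp: ambient_quot_def coinv_class_def quot_carrier)

lemma cls_eq_iff: "\<lbrakk>x \<in> carrier T; y \<in> carrier T\<rbrakk> \<Longrightarrow> cls x = cls y \<longleftrightarrow> x \<ominus>\<^bsub>T\<^esub> y \<in> W"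
  unfolding coinv_class_def by (rule coset_eq_iff[OF vsT subspace_W])

lemma cls_ract_lact: "\<lbrakk>\<phi> \<in> L D S; x \<in> CS\<rbrakk> \<Longrightarrow> cls (ract \<phi> x) = cls (lact \<phi> x)"
  by (subst cls_eq_iff) (auto intro: W_memI ract_CS lact_CS CS_closed)

lemma cls_actT_eq:
  assumes "g \<in> carrier H" "x \<in> carrier T" "y \<in> carrier T" "cls x = cls y"
  shows "cls (actT g x) = cls (actT g y)"
proof -
  have "actT g (x \<ominus>\<^bsub>T\<^esub> y) \<in> W" using assms by (simp add: cls_eq_iff actT_W)
  thus ?thesis using assms
    by (simp add: cls_eq_iff actT_closed lin_minus[OF lin_actT_left[OF _ lin_id] vsT vsT])
qed

lemmas mlin' = mlin vsA vsAA lin_cls cls_closed lin_cn_left lin_cn_right cn_closed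
  lin_actT_left lin_actT_right actT_closed

text \<open>\<open>swA P b x\<close> is the Sweedler sum of the \<open>b e\<^sup>1 e\<^sup>2\<close> for the class \<open>e\<close> of \<open>x\<close>.\<close>

definition swA :: "('k, 'p, 'z) module_scheme
    \<Rightarrow> (('c \<times> 'c \<Rightarrow> 'k) set set \<Rightarrow> ('c \<times> 'c \<Rightarrow> 'k) set set \<Rightarrow> 'p) \<Rightarrow> ('c \<times> 'c \<Rightarrow> 'k) set \<Rightarrow> 'p"
  where "swA P b = tlift K P (\<lambda>c d. C.sw P (\<lambda>c1 c2. C.sw P (\<lambda>d1 d2.
    b (cls (pt c1 d2)) (cls (pt c2 d1))) d) c)"

abbreviation "\<Delta> \<equiv> coinv_comult_formula K C I"

lemma \<Delta>_swA: "\<Delta> = swA AA (pure_tensor K A A)"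
  by (simp add: coinv_comult_formula_def swA_def C.sw_def Let_def)

context
  fixes P :: "('k, 'p, 'z) module_scheme" and b
  assumes P: "vs P" and b: "bilin A A P b"
begin

lemmas b_rules = lin_comp[OF bilin_right[OF b]] lin_comp[OF bilin_left[OF b]] bilin_closed[OF b] P

lemma lin_swA: "swA P b \<in> L T P"
  unfolding swA_def by (rule lin_tlift[OF C.vsC C.vsC P]) (assumption | rule mlin' b_rules)+

lemma swA_pure:
  "\<lbrakk>c \<in> carrier C; d \<in> carrier C\<rbrakk> \<Longrightarrow> swA P b (pt c d)
    = C.sw P (\<lambda>c1 c2. C.sw P (\<lambda>d1 d2. b (cls (pt c1 d2)) (cls (pt c2 d1))) d) c"
  unfolding swA_def by (rule tlift_pure[OF C.vsC C.vsC P]) (assumption | rule mlin' b_rules)+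

text \<open>Cutting \<open>c\<^sup>1 \<otimes> c\<^sup>2h\<close> on both sides yields \<open>c\<^sup>1 \<otimes> c\<^sup>4h\<^sup>2\<close> and \<open>c\<^sup>2 \<otimes> c\<^sup>3h\<^sup>1\<close>, and
  the second leg is again a value of the canonical map.\<close>

lemma swA_cn:
  assumes c: "c \<in> carrier C" and h: "h \<in> carrier H"
  shows "swA P b (cn c h) = H.sw P (\<lambda>p q. C.sw P (\<lambda>x y. C.sw P (\<lambda>w z.
    b (cls (pt x (act z q))) (cls (cn w p))) y) c) h"
proof -
  have "swA P b (cn c h) = C.sw P (\<lambda>x y. swA P b (pt x (act y h))) c"
    unfolding cn_def by (rule C.sw_commute[OF c lin_swA vsT P]) (assumption | rule mlin' h)+
  also have "\<dots> = C.sw P (\<lambda>x y. C.sw P (\<lambda>x1 x2. C.sw P (\<lambda>y1 y2. H.sw P (\<lambda>p q.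
      b (cls (pt x1 (act y2 q))) (cls (pt x2 (act y1 p)))) h) y) x) c"
  proof (rule C.sw_cong[OF c P])
    fix x y assume x: "x \<in> carrier C" and y: "y \<in> carrier C"
    show "swA P b (pt x (act y h)) = C.sw P (\<lambda>x1 x2. C.sw P (\<lambda>y1 y2. H.sw P (\<lambda>p q.
      b (cls (pt x1 (act y2 q))) (cls (pt x2 (act y1 p)))) h) y) x"
      unfolding swA_pure[OF x act_closed[OF y h]]
    proof (rule C.sw_cong[OF x P])
      fix x1 x2 assume x12: "x1 \<in> carrier C" "x2 \<in> carrier C"
      show "C.sw P (\<lambda>d1 d2. b (cls (pt x1 d2)) (cls (pt x2 d1))) (act y h)
        = C.sw P (\<lambda>y1 y2. H.sw P (\<lambda>p q. b (cls (pt x1 (act y2 q))) (cls (pt x2 (act y1 p)))) h) y"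
        by (rule sw_act[OF y h P]) (assumption | rule mlin' b_rules x12)+
    qed (assumption | rule mlin' b_rules h y)+
  qed (assumption | rule mlin' b_rules h)+
  also have "\<dots> = C.sw P (\<lambda>x y. C.sw P (\<lambda>x1 x2. H.sw P (\<lambda>p q. C.sw P (\<lambda>y1 y2.
      b (cls (pt x1 (act y2 q))) (cls (pt x2 (act y1 p)))) y) h) x) c"
    by (rule C.sw_cong[OF c P], (assumption | rule mlin' b_rules h)+,
        rule C.sw_cong[where P = P], (assumption | rule mlin' b_rules h)+,
        rule CH_swap[where P = P], (assumption | rule mlin' b_rules h)+)
  also have "\<dots> = C.sw P (\<lambda>x y. H.sw P (\<lambda>p q. C.sw P (\<lambda>x1 x2. C.sw P (\<lambda>y1 y2.
      b (cls (pt x1 (act y2 q))) (cls (pt x2 (act y1 p)))) y) x) h) c"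
    by (rule C.sw_cong[OF c P], (assumption | rule mlin' b_rules h)+,
        rule CH_swap[where P = P], (assumption | rule mlin' b_rules h)+)
  also have "\<dots> = H.sw P (\<lambda>p q. C.sw P (\<lambda>x y. C.sw P (\<lambda>x1 x2. C.sw P (\<lambda>y1 y2.
      b (cls (pt x1 (act y2 q))) (cls (pt x2 (act y1 p)))) y) x) c) h"
    by (rule CH_swap[OF c h P]) (assumption | rule mlin' b_rules h)+
  also have "\<dots> = H.sw P (\<lambda>p q. C.sw P (\<lambda>x y. C.sw P (\<lambda>w z.
    b (cls (pt x (act z q))) (cls (cn w p))) y) c) h"
  proof (rule H.sw_cong[OF h P])
    fix p q assume pq: "p \<in> carrier H" "q \<in> carrier H"
    have "C.sw P (\<lambda>x y. C.sw P (\<lambda>x1 x2. C.sw P (\<lambda>y1 y2.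
        b (cls (pt x1 (act y2 q))) (cls (pt x2 (act y1 p)))) y) x) c
      = C.sw P (\<lambda>x y. C.sw P (\<lambda>w z. C.sw P (\<lambda>u v.
        b (cls (pt x (act z q))) (cls (pt u (act v p)))) w) y) c" (is "?lhs = _")
      by (rule C.sw_coassoc4[OF c P]) (assumption | rule mlin' b_rules pq)+
    also have "\<dots> = C.sw P (\<lambda>x y. C.sw P (\<lambda>w z. b (cls (pt x (act z q))) (cls (cn w p))) y) c" (is "_ = ?rhs")
    proof (rule C.sw_cong[OF c P])
      fix x y assume x: "x \<in> carrier C" and y: "y \<in> carrier C"
      show "C.sw P (\<lambda>w z. C.sw P (\<lambda>u v. b (cls (pt x (act z q))) (cls (pt u (act v p)))) w) y
        = C.sw P (\<lambda>w z. b (cls (pt x (act z q))) (cls (cn w p))) y"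
      proof (rule C.sw_cong[OF y P])
        fix w z assume w: "w \<in> carrier C" and z: "z \<in> carrier C"
        have m: "cls (pt x (act z q)) \<in> carrier A" by (assumption | rule mlin' x z pq)+
        show "C.sw P (\<lambda>u v. b (cls (pt x (act z q))) (cls (pt u (act v p)))) w
          = b (cls (pt x (act z q))) (cls (cn w p))"
          unfolding cn_def
          by (rule C.sw_commute[OF w lin_comp[OF bilin_right[OF b m] lin_cls[OF lin_id]] vsT P, symmetric])
            (assumption | rule mlin' pq)+
      qed (assumption | rule mlin' b_rules pq x)+
    qed (assumption | rule mlin' b_rules pq)+
    finally show "?lhs = ?rhs" .
  qed (assumption | rule mlin' b_rules c)+
  finally show ?thesis .
qed

lemma tlift_\<Delta>:
  assumes x: "x \<in> carrier T"
  shows "tlift K P b (\<Delta> x) = swA P b x"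
proof -
  have pA: "bilin A A AA (pure_tensor K A A)" by (rule bilin_pure[OF vsA vsA])
  note l = lin_tlift[OF vsA vsA P b]
  have \<Delta>': "swA AA (pure_tensor K A A) \<in> L T AA"
    unfolding swA_def
    by (rule lin_tlift[OF C.vsC C.vsC vsAA]) (assumption | rule mlin')+
  have \<Delta>p: "swA AA (pure_tensor K A A) (pt c d) = C.sw AA (\<lambda>c1 c2. C.sw AA (\<lambda>d1 d2.
      pure_tensor K A A (cls (pt c1 d2)) (cls (pt c2 d1))) d) c" if "c \<in> carrier C" "d \<in> carrier C" for c d
    unfolding swA_def
    by (rule tlift_pure[OF C.vsC C.vsC vsAA _ that]) (assumption | rule mlin')+
  show ?thesis
    unfolding \<Delta>_swA
  proof (rule tensor_ext[OF C.vsC C.vsC lin_comp[OF l \<Delta>'] lin_swA P _ x])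
    fix c d assume c: "c \<in> carrier C" and d: "d \<in> carrier C"
    have "tlift K P b (swA AA (pure_tensor K A A) (pt c d)) = C.sw P (\<lambda>c1 c2. tlift K P b (C.sw AA (\<lambda>d1 d2.
      pure_tensor K A A (cls (pt c1 d2)) (cls (pt c2 d1))) d)) c"
      unfolding \<Delta>p[OF c d] by (rule C.sw_commute[OF c l vsAA P]) (assumption | rule mlin' d)+
    also have "\<dots> = swA P b (pt c d)"
      unfolding swA_pure[OF c d]
    proof (rule C.sw_cong[OF c P])
      fix c1 c2 assume c12: "c1 \<in> carrier C" "c2 \<in> carrier C"
      have "tlift K P b (C.sw AA (\<lambda>d1 d2. pure_tensor K A A (cls (pt c1 d2)) (cls (pt c2 d1))) d)
        = C.sw P (\<lambda>d1 d2. tlift K P b (pure_tensor K A A (cls (pt c1 d2)) (cls (pt c2 d1)))) d" (is "?lhs = _")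
        by (rule C.sw_commute[OF d l vsAA P]) (assumption | rule mlin' c12)+
      also have "\<dots> = C.sw P (\<lambda>d1 d2. b (cls (pt c1 d2)) (cls (pt c2 d1))) d" (is "_ = ?rhs")
        by (rule C.sw_cong[OF d P], (assumption | rule mlin' c12 b_rules)+,
            rule tlift_pure[OF vsA vsA P b], (assumption | rule mlin' c12 b_rules)+)
      finally show "?lhs = ?rhs" .
    qed (assumption | rule mlin' d b_rules)+
    finally show "tlift K P b (swA AA (pure_tensor K A A) (pt c d)) = swA P b (pt c d)" .
  qed
qed

end

lemma lin_\<Delta>: "\<Delta> \<in> L T AA"
  unfolding \<Delta>_swA by (rule lin_swA[OF vsAA bilin_pure[OF vsA vsA]])


subsection \<open>Central functionals\<close>

text \<open>These are the functionals on the space of coinvariants of \<open>C\<close>, or the elements of the dual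
  algebra of \<open>C\<close> that commute with the functionals on \<open>D\<close>.\<close>

definition central :: "('c \<Rightarrow> 'k) \<Rightarrow> bool"
  where "central \<chi> \<longleftrightarrow> \<chi> \<in> L C S \<and>
    (\<forall>\<phi>\<in>L D S. \<forall>c\<in>carrier C. \<chi> (C.slice_right (pull \<phi>) c) = \<chi> (C.slice_left (pull \<phi>) c))"

lemma central_lin: "central \<chi> \<Longrightarrow> \<chi> \<in> L C S"
  and central_eq: "\<lbrakk>central \<chi>; \<phi> \<in> L D S; c \<in> carrier C\<rbrakk>
    \<Longrightarrow> \<chi> (C.slice_right (pull \<phi>) c) = \<chi> (C.slice_left (pull \<phi>) c)"
  by (simp_all add: central_def)

text \<open>A functional \<open>\<phi>\<close> on \<open>D\<close> takes the values \<open>\<chi>(\<phi>(c\<^sup>1)c\<^sup>2)\<close> and \<open>\<chi>(c\<^sup>1\<phi>(c\<^sup>2))\<close> at the two sides, which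
  agree because \<open>\<chi>\<close> is central; and such functionals separate the points of \<open>D\<close>.\<close>

lemma proj_slice_central:
  assumes \<chi>: "central \<chi>" and c: "c \<in> carrier C"
  shows "\<pi> (C.slice_right \<chi> c) = \<pi> (C.slice_left \<chi> c)"
proof -
  note l = central_lin[OF \<chi>]
  have sc: "C.slice_right \<chi> c \<in> carrier C" "C.slice_left \<chi> c \<in> carrier C"
    using C.slice_right_closed[OF l c] C.slice_left_closed[OF l c] by auto
  have cl: "\<pi> (C.slice_right \<chi> c) \<in> carrier D" "\<pi> (C.slice_left \<chi> c) \<in> carrier D"
    using sc by (auto intro: proj_closed)
  have k: "\<chi> y \<in> carrier K" if "y \<in> carrier C" for y using functional_closed[OF l that] .
  have "\<phi> (\<pi> (C.slice_right \<chi> c) \<ominus>\<^bsub>D\<^esub> \<pi> (C.slice_left \<chi> c)) = \<zero>" if \<phi>: "\<phi> \<in> L D S" for \<phi>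
  proof -
    have p: "pull \<phi> y \<in> carrier K" if "y \<in> carrier C" for y
      using functional_closed[OF \<phi> proj_closed[OF that]] .
    have m: "a \<odot>\<^bsub>S\<^esub> b = b \<odot>\<^bsub>S\<^esub> a" "a \<odot>\<^bsub>S\<^esub> b \<in> carrier K" if "a \<in> carrier K" "b \<in> carrier K" for a b
      using m_comm[OF that] that by (simp_all add: scalar_module_def)
    have "\<phi> (\<pi> (C.slice_right \<chi> c)) = C.sw S (\<lambda>x y. \<chi> y \<odot>\<^bsub>S\<^esub> pull \<phi> x) c"
      by (rule C.lin_slice_right_commute[OF l lin_pull[OF \<phi>] vs_scalar c])
    also have "\<dots> = C.sw S (\<lambda>x y. pull \<phi> x \<odot>\<^bsub>S\<^esub> \<chi> y) c"
      by (rule C.sw_cong[OF c vs_scalar]) (simp_all add: m k p)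
    also have "\<dots> = \<chi> (C.slice_left (pull \<phi>) c)"
      by (rule C.lin_slice_left_commute[OF lin_pull[OF \<phi>] l vs_scalar c, symmetric])
    also have "\<dots> = \<chi> (C.slice_right (pull \<phi>) c)" by (rule central_eq[OF \<chi> \<phi> c, symmetric])
    also have "\<dots> = C.sw S (\<lambda>x y. pull \<phi> y \<odot>\<^bsub>S\<^esub> \<chi> x) c"
      by (rule C.lin_slice_right_commute[OF lin_pull[OF \<phi>] l vs_scalar c])
    also have "\<dots> = C.sw S (\<lambda>x y. \<chi> x \<odot>\<^bsub>S\<^esub> pull \<phi> y) c"
      by (rule C.sw_cong[OF c vs_scalar]) (simp_all add: m k p)
    also have "\<dots> = \<phi> (\<pi> (C.slice_left \<chi> c))"
      by (rule C.lin_slice_left_commute[OF l lin_pull[OF \<phi>] vs_scalar c, symmetric])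
    finally have "\<phi> (\<pi> (C.slice_right \<chi> c)) = \<phi> (\<pi> (C.slice_left \<chi> c))" .
    moreover have "\<zero>\<^bsub>S\<^esub> = \<zero>" by (simp add: scalar_module_def)
    ultimately show ?thesis
      using lin_minus[OF \<phi> vsD vs_scalar cl] vs_minus_self[OF vs_scalar] p[OF sc(1)] p[OF sc(2)] by simp
  qed
  hence "\<pi> (C.slice_right \<chi> c) \<ominus>\<^bsub>D\<^esub> \<pi> (C.slice_left \<chi> c) = \<zero>\<^bsub>D\<^esub>"
    by (rule functionals_separate[OF vsD vs_minus[OF vsD cl]])
  thus ?thesis using vs_minus_self[OF vsD cl] by simp
qed

text \<open>The sum of the \<open>c\<^sup>1 \<otimes> \<chi>(c\<^sup>2)c\<^sup>3\<close>.\<close>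

definition cut :: "('c \<Rightarrow> 'k) \<Rightarrow> 'c \<Rightarrow> ('c \<times> 'c \<Rightarrow> 'k) set"
  where "cut \<chi> c = C.sw T (\<lambda>x y. pt x (C.slice_left \<chi> y)) c"

lemma cut_closed: "\<lbrakk>\<chi> \<in> L C S; c \<in> carrier C\<rbrakk> \<Longrightarrow> cut \<chi> c \<in> carrier T"
  unfolding cut_def by (assumption | rule mlin C.slice_left_closed)+

text \<open>Coacting on the first factor leaves \<open>\<chi>\<close> to the right of the part in \<open>D\<close>, coacting on the second
  one leaves it to the left, and for central \<open>\<chi>\<close> the two slices have the same image in \<open>D\<close>.\<close>

lemma cut_CS:
  assumes \<chi>: "central \<chi>" and c: "c \<in> carrier C"
  shows "cut \<chi> c \<in> CS"
proof -
  let ?X = CDC and ?p = "\<lambda>x d y. pure_tensor K C (tensor K D C) x (pure_tensor K D C d y)"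
  note l = central_lin[OF \<chi>]
  note r = mlin C.slice_left_closed[OF l] C.lin_slice_left[OF l] C.slice_right_closed[OF l] C.lin_slice_right[OF l]
  have "coact_right (cut \<chi> c) = C.sw ?X (\<lambda>x y. coact_right (pt x (C.slice_left \<chi> y))) c"
    unfolding cut_def by (rule C.sw_commute[OF c lin_coact_right]) (assumption | rule r)+
  also have "\<dots> = C.sw ?X (\<lambda>x y. C.sw ?X (\<lambda>x1 x2. ?p x1 (\<pi> x2) (C.slice_left \<chi> y)) x) c"
    by (rule C.sw_cong[OF c]) (assumption | rule r coact_right_pure)+
  also have "\<dots> = C.sw ?X (\<lambda>x y. C.sw ?X (\<lambda>y1 y2. ?p x (\<pi> y1) (C.slice_left \<chi> y2)) y) c"
    by (rule C.sw_coassoc[OF c]) (assumption | rule r)+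
  also have "\<dots> = C.sw ?X (\<lambda>x y. C.sw ?X (\<lambda>y1 y2. ?p x (\<pi> (C.slice_right \<chi> y1)) y2) y) c"
    by (rule C.sw_cong[OF c], (assumption | rule r)+,
        rule C.sw_slice_middle[OF l, symmetric], (assumption | rule r)+)
  also have "\<dots> = C.sw ?X (\<lambda>x y. C.sw ?X (\<lambda>y1 y2. ?p x (\<pi> (C.slice_left \<chi> y1)) y2) y) c"
    by (rule C.sw_cong[OF c], (assumption | rule r)+,
        rule C.sw_cong, (assumption | rule r | simp add: proj_slice_central[OF \<chi>])+)
  also have "\<dots> = C.sw ?X (\<lambda>x y. coact_left (pt x (C.slice_left \<chi> y))) c"
  proof (rule C.sw_cong[OF c])
    fix x y assume x: "x \<in> carrier C" and y: "y \<in> carrier C"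
    have "C.sw ?X (\<lambda>d1 d2. ?p x (\<pi> d1) d2) (C.slice_left \<chi> y)
      = C.sw ?X (\<lambda>y1 y2. ?p x (\<pi> (C.slice_left \<chi> y1)) y2) y"
      by (rule C.sw_slice_left[OF l _ _ y]) (assumption | rule r x)+
    thus "C.sw ?X (\<lambda>y1 y2. ?p x (\<pi> (C.slice_left \<chi> y1)) y2) y = coact_left (pt x (C.slice_left \<chi> y))"
      by (simp add: coact_left_pure[OF x C.slice_left_closed[OF l y]])
  qed (assumption | rule r lin_closed[OF lin_coact_left])+
  also have "\<dots> = coact_left (cut \<chi> c)"
    unfolding cut_def by (rule C.sw_commute[OF c lin_coact_left, symmetric]) (assumption | rule r)+
  finally show ?thesis using cut_closed[OF l c] by (simp add: CS_def)
qed

lemma cut_slice: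
  assumes \<chi>: "\<chi> \<in> L C S" and \<phi>: "\<phi> \<in> L D S" and c: "c \<in> carrier C"
  shows "cut \<chi> (C.slice_right (pull \<phi>) c) = ract \<phi> (cut \<chi> c)"
    and "cut \<chi> (C.slice_left (pull \<phi>) c) = lact \<phi> (cut \<chi> c)"
proof -
  note r = mlin C.slice_left_closed[OF \<chi>] C.lin_slice_left[OF \<chi>] slice_closed[OF \<phi>]
  have "cut \<chi> (C.slice_right (pull \<phi>) c) = C.sw T (\<lambda>x y. pt x (C.slice_left \<chi> (C.slice_right (pull \<phi>) y))) c"
    unfolding cut_def by (rule C.sw_slice_right[OF lin_pull[OF \<phi>] vsT _ c]) (assumption | rule r)+
  also have "\<dots> = C.sw T (\<lambda>x y. ract \<phi> (pt x (C.slice_left \<chi> y))) c"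
    by (rule C.sw_cong[OF c vsT])
      (simp_all add: ract_pure[OF \<phi>] C.slice_left_right[OF \<chi> lin_pull[OF \<phi>]] C.slice_left_closed[OF \<chi>]
        pure_closed C.vsC slice_closed[OF \<phi>])
  also have "\<dots> = ract \<phi> (cut \<chi> c)"
    unfolding cut_def
    by (rule C.sw_commute[OF c lin_ract[OF \<phi>], symmetric]) (assumption | rule r)+
  finally show "cut \<chi> (C.slice_right (pull \<phi>) c) = ract \<phi> (cut \<chi> c)" .
  have "cut \<chi> (C.slice_left (pull \<phi>) c) = C.sw T (\<lambda>x y. pt (C.slice_left (pull \<phi>) x) (C.slice_left \<chi> y)) c"
    unfolding cut_def by (rule C.sw_slice_left[OF lin_pull[OF \<phi>] vsT _ c]) (assumption | rule r)+
  also have "\<dots> = C.sw T (\<lambda>x y. lact \<phi> (pt x (C.slice_left \<chi> y))) c"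
    by (rule C.sw_cong[OF c vsT])
      (simp_all add: lact_pure[OF \<phi>] C.slice_left_closed[OF \<chi>] pure_closed C.vsC slice_closed[OF \<phi>])
  also have "\<dots> = lact \<phi> (cut \<chi> c)"
    unfolding cut_def
    by (rule C.sw_commute[OF c lin_lact[OF \<phi>], symmetric]) (assumption | rule r)+
  finally show "cut \<chi> (C.slice_left (pull \<phi>) c) = lact \<phi> (cut \<chi> c)" .
qed

lemma central_cn:
  assumes \<psi>: "\<psi> \<in> L A S" and h: "h \<in> carrier H"
  shows "central (\<lambda>c. \<psi> (cls (cn c h)))"
  unfolding central_def
proof (intro conjI ballI)
  show "(\<lambda>c. \<psi> (cls (cn c h))) \<in> L C S"
    by (rule lin_comp[OF \<psi>]) (assumption | rule mlin' h)+
  fix \<phi> c assume \<phi>: "\<phi> \<in> L D S" and c: "c \<in> carrier C"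
  show "\<psi> (cls (cn (C.slice_right (pull \<phi>) c) h)) = \<psi> (cls (cn (C.slice_left (pull \<phi>) c) h))"
    using cls_ract_lact[OF \<phi> cn_CS[OF c h]] by (simp add: ract_cn[OF \<phi> c h] lact_cn[OF \<phi> c h])
qed

text \<open>In \<open>[c\<^sup>1 \<otimes> c\<^sup>3h\<^sup>2] \<otimes> [cn c\<^sup>2 h\<^sup>1]\<close> the functional \<open>\<psi>\<close> consumes \<open>c\<^sup>2\<close> and \<open>h\<^sup>1\<close>.\<close>

lemma \<Delta>_second_leg:
  assumes \<psi>: "\<psi> \<in> L A S" and c: "c \<in> carrier C" and h: "h \<in> carrier H"
  shows "tlift K A (\<lambda>a a'. \<psi> a' \<odot>\<^bsub>A\<^esub> a) (\<Delta> (cn c h))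
    = H.sw A (\<lambda>p q. cls (actT q (cut (\<lambda>w. \<psi> (cls (cn w p))) c))) h"
proof -
  note \<psi>r = lin_comp[OF \<psi>] functional_closed[OF \<psi>]
  have b: "bilin A A A (\<lambda>a a'. \<psi> a' \<odot>\<^bsub>A\<^esub> a)" by (assumption | rule mlin' \<psi>r)+
  have "tlift K A (\<lambda>a a'. \<psi> a' \<odot>\<^bsub>A\<^esub> a) (\<Delta> (cn c h)) = H.sw A (\<lambda>p q. C.sw A (\<lambda>x y. C.sw A (\<lambda>w z.
    \<psi> (cls (cn w p)) \<odot>\<^bsub>A\<^esub> cls (pt x (act z q))) y) c) h"
    by (simp add: tlift_\<Delta>[OF vsA b cn_closed[OF c h]] swA_cn[OF vsA b c h])
  also have "\<dots> = H.sw A (\<lambda>p q. cls (actT q (cut (\<lambda>w. \<psi> (cls (cn w p))) c))) h"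
  proof (rule H.sw_cong[OF h vsA])
    fix p q assume pq: "p \<in> carrier H" "q \<in> carrier H"
    define \<chi> where "\<chi> = (\<lambda>w. \<psi> (cls (cn w p)))"
    have l: "\<chi> \<in> L C S" unfolding \<chi>_def by (rule central_lin[OF central_cn[OF \<psi> pq(1)]])
    note sr = C.slice_left_closed[OF l] C.\<chi>_closed[OF l]
    show "cls (actT q (cut (\<lambda>w. \<psi> (cls (cn w p))) c)) \<in> carrier A"
      unfolding \<chi>_def[symmetric] by (assumption | rule mlin' pq cut_closed l c)+
    have "C.sw A (\<lambda>x y. C.sw A (\<lambda>w z. \<chi> w \<odot>\<^bsub>A\<^esub> cls (pt x (act z q))) y) c
      = C.sw A (\<lambda>x y. cls (actT q (pt x (C.slice_left \<chi> y)))) c"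
    proof (rule C.sw_cong[OF c vsA])
      fix x y assume x: "x \<in> carrier C" and y: "y \<in> carrier C"
      show "cls (actT q (pt x (C.slice_left \<chi> y))) \<in> carrier A" by (assumption | rule mlin' pq sr x y)+
      have "cls (pt x (act (C.slice_left \<chi> y) q)) = C.sw A (\<lambda>w z. \<chi> w \<odot>\<^bsub>A\<^esub> cls (pt x (act z q))) y"
        by (rule C.lin_slice_left_commute[OF l _ vsA y, where f = "\<lambda>z. cls (pt x (act z q))"])
          (assumption | rule mlin' pq x)+
      thus "C.sw A (\<lambda>w z. \<chi> w \<odot>\<^bsub>A\<^esub> cls (pt x (act z q))) y = cls (actT q (pt x (C.slice_left \<chi> y)))"
        by (simp add: actT_pure pq x y sr)
    qed
    also have "\<dots> = cls (actT q (cut \<chi> c))"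
      unfolding cut_def
      by (rule C.sw_commute[OF c, where f = "\<lambda>t. cls (actT q t)", symmetric]) (assumption | rule mlin' pq sr)+
    finally show "C.sw A (\<lambda>x y. C.sw A (\<lambda>w z. \<psi> (cls (cn w p)) \<odot>\<^bsub>A\<^esub> cls (pt x (act z q))) y) c
      = cls (actT q (cut (\<lambda>w. \<psi> (cls (cn w p))) c))" unfolding \<chi>_def .
  qed
  finally show ?thesis .
qed

text \<open>After evaluation of the second leg, the two slices of \<open>c\<close> give the two actions of \<open>\<phi>\<close> on an
  element of the cotensor square, and these have the same class.\<close>

lemma \<Delta>_W:
  assumes w: "w \<in> W"
  shows "\<Delta> w = \<zero>\<^bsub>AA\<^esub>"
proof (rule W_vanish[OF lin_TCS[OF lin_\<Delta>] vsAA _ w])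
  fix \<phi> c h assume \<phi>: "\<phi> \<in> L D S" and c: "c \<in> carrier C" and h: "h \<in> carrier H"
  let ?r = "\<Delta> (cn (C.slice_right (pull \<phi>) c) h)" and ?l = "\<Delta> (cn (C.slice_left (pull \<phi>) c) h)"
  note sc = slice_closed[OF \<phi> c]
  have cl: "?r \<in> carrier AA" "?l \<in> carrier AA"
    by (rule lin_closed[OF lin_\<Delta>], rule cn_closed[OF _ h], rule sc)+
  have "?r \<ominus>\<^bsub>AA\<^esub> ?l = \<zero>\<^bsub>AA\<^esub>"
  proof (rule tensor_separate_right[OF vsA vsA vs_minus[OF vsAA cl]])
    fix \<psi> assume \<psi>: "\<psi> \<in> L A S"
    have b: "bilin A A A (\<lambda>a a'. \<psi> a' \<odot>\<^bsub>A\<^esub> a)"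
      by (assumption | rule mlin' lin_comp[OF \<psi>] functional_closed[OF \<psi>])+
    note l = lin_tlift[OF vsA vsA vsA b]
    have "tlift K A (\<lambda>a a'. \<psi> a' \<odot>\<^bsub>A\<^esub> a) ?r = tlift K A (\<lambda>a a'. \<psi> a' \<odot>\<^bsub>A\<^esub> a) ?l"
      unfolding \<Delta>_second_leg[OF \<psi> sc(1) h] \<Delta>_second_leg[OF \<psi> sc(2) h]
    proof (rule H.sw_cong[OF h vsA])
      fix p q assume pq: "p \<in> carrier H" "q \<in> carrier H"
      let ?\<chi> = "\<lambda>w. \<psi> (cls (cn w p))"
      have \<chi>: "central ?\<chi>" by (rule central_cn[OF \<psi> pq(1)])
      have cut: "cut ?\<chi> c \<in> CS" by (rule cut_CS[OF \<chi> c])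
      have "cls (actT q (ract \<phi> (cut ?\<chi> c))) = cls (actT q (lact \<phi> (cut ?\<chi> c)))"
        by (rule cls_actT_eq[OF pq(2) CS_closed CS_closed]) (rule ract_CS lact_CS \<phi> cut cls_ract_lact)+
      thus "cls (actT q (cut ?\<chi> (C.slice_right (pull \<phi>) c))) = cls (actT q (cut ?\<chi> (C.slice_left (pull \<phi>) c)))"
        by (simp add: cut_slice[OF central_lin[OF \<chi>] \<phi> c])
      show "cls (actT q (cut ?\<chi> (C.slice_left (pull \<phi>) c))) \<in> carrier A"
        by (rule mlin' pq cut_closed central_lin[OF \<chi>] sc)+
    qed
    thus "tlift K A (\<lambda>a a'. \<psi> a' \<odot>\<^bsub>A\<^esub> a) (?r \<ominus>\<^bsub>AA\<^esub> ?l) = \<zero>\<^bsub>A\<^esub>"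
      using lin_minus[OF l vsAA vsA cl] vs_minus_self[OF vsA] lin_closed[OF l] cl by simp
  qed
  thus "?r = ?l" using vs_minus_self[OF vsAA cl] by simp
qed

subsection \<open>The ambient quotient\<close>

abbreviation "\<Delta>A \<equiv> induced \<Delta>"
abbreviation "\<epsilon>T \<equiv> coinv_counit_formula K C"
abbreviation "\<epsilon>A \<equiv> induced \<epsilon>T"
abbreviation "aact \<equiv> coinv_act K C act I"

lemma induced_cls:
  assumes f: "f \<in> L T P" and P: "vs P" and W: "\<And>w. w \<in> W \<Longrightarrow> f w = \<zero>\<^bsub>P\<^esub>"
  shows "x \<in> carrier T \<Longrightarrow> induced f (cls x) = f x" and "induced f \<in> L A P"
  unfolding coinv_class_def ambient_quot_def
  by (rule induced_coset[OF vsT subspace_W P f W], assumption+)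
    (rule lin_induced[OF vsT subspace_W P f W])

lemma \<Delta>A_cls: "x \<in> carrier T \<Longrightarrow> \<Delta>A (cls x) = \<Delta> x" and lin_\<Delta>A: "\<Delta>A \<in> L A AA"
  using induced_cls[OF lin_\<Delta> vsAA \<Delta>_W] by auto

lemma \<Delta>A_closed: "a \<in> carrier A \<Longrightarrow> \<Delta>A a \<in> carrier AA"
  by (rule lin_closed[OF lin_\<Delta>A])

lemma A_ext:
  assumes f: "f \<in> L A P" and g: "g \<in> L A P" and P: "vs P"
    and eq: "\<And>c d. \<lbrakk>c \<in> carrier C; d \<in> carrier C\<rbrakk> \<Longrightarrow> f (cls (pt c d)) = g (cls (pt c d))"
    and a: "a \<in> carrier A"
  shows "f a = g a"
proof -
  obtain x where x: "x \<in> carrier T" "a = cls x" using A_cases[OF a] .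
  show ?thesis unfolding x(2)
    by (rule tensor_ext[OF C.vsC C.vsC lin_comp[OF f lin_cls[OF lin_id]] lin_comp[OF g lin_cls[OF lin_id]] P eq x(1)])
qed

lemma tlift_\<Delta>A_pure:
  assumes P: "vs P" and b: "bilin A A P b" and c: "c \<in> carrier C" and d: "d \<in> carrier C"
  shows "tlift K P b (\<Delta>A (cls (pt c d)))
    = C.sw P (\<lambda>c1 c2. C.sw P (\<lambda>d1 d2. b (cls (pt c1 d2)) (cls (pt c2 d1))) d) c"
  using pure_closed[OF c d C.vsC C.vsC] by (simp add: \<Delta>A_cls tlift_\<Delta>[OF P b] swA_pure[OF P b c d])

lemma lin_\<Delta>A_arg: "\<lbrakk>f \<in> L X A; bilin A A P b; vs P\<rbrakk> \<Longrightarrow> (\<lambda>x. tlift K P b (\<Delta>A (f x))) \<in> L X P"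
  by (rule lin_tlift_arg[OF lin_comp[OF lin_\<Delta>A] _ vsA vsA])

lemma lin_\<Delta>A_par:
  "\<lbrakk>a \<in> carrier A; vs P; vs X; \<And>y z. \<lbrakk>y \<in> carrier A; z \<in> carrier A\<rbrakk> \<Longrightarrow> (\<lambda>x. b x y z) \<in> L X P\<rbrakk>
    \<Longrightarrow> (\<lambda>x. tlift K P (b x) (\<Delta>A a)) \<in> L X P"
  by (rule tlift_lin_param[OF vsA vsA \<Delta>A_closed])

lemma \<Delta>A_tlift_closed:
  "\<lbrakk>a \<in> carrier A; vs P; \<And>y z. \<lbrakk>y \<in> carrier A; z \<in> carrier A\<rbrakk> \<Longrightarrow> b y z \<in> carrier P\<rbrakk>
    \<Longrightarrow> tlift K P b (\<Delta>A a) \<in> carrier P"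
  by (rule tlift_closed[OF vsA vsA \<Delta>A_closed])

lemma \<epsilon>T_lin: "\<epsilon>T \<in> L T S"
  unfolding coinv_counit_formula_def
  by (rule lin_tlift[OF C.vsC C.vsC vs_scalar]) (assumption | rule mlin)+

lemma \<epsilon>T_pure: "\<lbrakk>c \<in> carrier C; d \<in> carrier C\<rbrakk> \<Longrightarrow> \<epsilon>T (pt c d) = counit C c \<otimes> counit C d"
  unfolding coinv_counit_formula_def
  by (rule tlift_pure[OF C.vsC C.vsC vs_scalar]) (assumption | rule mlin)+

lemma \<epsilon>T_cn:
  assumes c: "c \<in> carrier C" and h: "h \<in> carrier H"
  shows "\<epsilon>T (cn c h) = counit C c \<otimes> counit H h"
proof -
  have "\<epsilon>T (cn c h) = C.sw S (\<lambda>x y. \<epsilon>T (pt x (act y h))) c"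
    unfolding cn_def by (rule C.sw_commute[OF c \<epsilon>T_lin vsT vs_scalar]) (assumption | rule mlin h)+
  also have "\<dots> = C.sw S (\<lambda>x y. counit C x \<odot>\<^bsub>S\<^esub> (counit C y \<otimes> counit H h)) c"
  proof (rule C.sw_cong[OF c vs_scalar])
    fix x y assume xy: "x \<in> carrier C" "y \<in> carrier C"
    show "counit C x \<odot>\<^bsub>S\<^esub> (counit C y \<otimes> counit H h) \<in> carrier S"
      by (rule vs_smult[OF vs_scalar]) (simp_all add: xy h C.counit_closed H.counit_closed)
    show "\<epsilon>T (pt x (act y h)) = counit C x \<odot>\<^bsub>S\<^esub> (counit C y \<otimes> counit H h)"
      by (simp add: \<epsilon>T_pure xy h act_closed counit_act scalar_module_def)
  qed
  also have "\<dots> = counit C c \<otimes> counit H h"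
    by (rule C.sw_counit_left[OF c vs_scalar]) (assumption | rule mlin h)+
  finally show ?thesis .
qed

lemma \<epsilon>T_W: "w \<in> W \<Longrightarrow> \<epsilon>T w = \<zero>\<^bsub>S\<^esub>"
  by (rule W_vanish[OF lin_TCS[OF \<epsilon>T_lin] vs_scalar]) (simp_all add: \<epsilon>T_cn slice_closed counit_slices)

lemma \<epsilon>A_cls: "x \<in> carrier T \<Longrightarrow> \<epsilon>A (cls x) = \<epsilon>T x" and \<epsilon>A_lin: "\<epsilon>A \<in> L A S"
  using induced_cls[OF \<epsilon>T_lin vs_scalar \<epsilon>T_W] by auto

lemma \<epsilon>A_closed: "a \<in> carrier A \<Longrightarrow> \<epsilon>A a \<in> carrier K"
  by (rule functional_closed[OF \<epsilon>A_lin])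

lemma cls_actT_W: "\<lbrakk>h \<in> carrier H; w \<in> W\<rbrakk> \<Longrightarrow> cls (actT h w) = \<zero>\<^bsub>A\<^esub>"
  using coset_eq_zero_iff[OF vsT subspace_W, of "actT h w"] actT_W[of h w] W_CS CS_closed
  by (auto simp: coinv_class_def ambient_quot_def)

lemma aact_cls: "\<lbrakk>h \<in> carrier H; x \<in> carrier T\<rbrakk> \<Longrightarrow> aact (cls x) h = cls (actT h x)"
  and lin_aact0: "h \<in> carrier H \<Longrightarrow> (\<lambda>a. aact a h) \<in> L A A"
  using induced_cls[of "\<lambda>x. cls (actT h x)" A] lin_cls[OF lin_actT_left[OF _ lin_id]] vsA cls_actT_W
  by (simp_all add: coinv_act_def actT_def)

lemma lin_aact_left: "\<lbrakk>h \<in> carrier H; f \<in> L X A\<rbrakk> \<Longrightarrow> (\<lambda>x. aact (f x) h) \<in> L X A"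
  by (rule lin_comp[OF lin_aact0])

lemma lin_aact_right:
  assumes a: "a \<in> carrier A" and f: "f \<in> L X H"
  shows "(\<lambda>x. aact a (f x)) \<in> L X A"
proof (rule lin_comp[OF _ f])
  obtain x where x: "x \<in> carrier T" "a = cls x" using A_cases[OF a] .
  have "(\<lambda>h. cls (actT h x)) \<in> L H A" by (assumption | rule mlin' x)+
  thus "(\<lambda>h. aact a h) \<in> L H A"
    by (rule lin_restrict_dom) (simp_all add: x aact_cls H.vsC)
qed

lemma aact_closed: "\<lbrakk>a \<in> carrier A; h \<in> carrier H\<rbrakk> \<Longrightarrow> aact a h \<in> carrier A"
  by (rule lin_closed[OF lin_aact0])

lemmas mlinA = mlin' lin_\<Delta>A_arg lin_\<Delta>A_par \<Delta>A_tlift_closed \<Delta>A_closed lin_comp[OF lin_\<Delta>A]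
  lin_comp[OF \<epsilon>A_lin] \<epsilon>A_closed lin_aact_left lin_aact_right aact_closed

abbreviation "AAA \<equiv> tensor K A AA"
abbreviation "p3 x y z \<equiv> pure_tensor K A AA x (pure_tensor K A A y z)"

text \<open>The formula is that of \<open>C \<otimes> C\<^sup>c\<^sup>o\<^sup>p\<close>, so its coassociativity is that of \<open>C\<close> in both factors.  Both
  sides are the sum of the \<open>g c\<^sup>1 c\<^sup>2 c\<^sup>3 d\<^sup>1 d\<^sup>2 d\<^sup>3\<close>.\<close>

lemma \<Delta>A_coassoc:
  assumes a: "a \<in> carrier A"
  shows "tlift K AAA (\<lambda>a1 a2. tlift K AAA (\<lambda>m n. p3 m n a2) (\<Delta>A a1)) (\<Delta>A a)
    = tlift K AAA (\<lambda>a1 a2. pure_tensor K A AA a1 (\<Delta>A a2)) (\<Delta>A a)"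
proof (rule A_ext[OF _ _ _ _ a])
  show "(\<lambda>a. tlift K AAA (\<lambda>a1 a2. tlift K AAA (\<lambda>m n. p3 m n a2) (\<Delta>A a1)) (\<Delta>A a)) \<in> L A AAA"
    by (assumption | rule mlinA)+
  show "(\<lambda>a. tlift K AAA (\<lambda>a1 a2. pure_tensor K A AA a1 (\<Delta>A a2)) (\<Delta>A a)) \<in> L A AAA"
    by (assumption | rule mlinA)+
  show "vs AAA" by (rule vs_tensor[OF vsA vsAA])
  fix c d assume c: "c \<in> carrier C" and d: "d \<in> carrier C"
  define g where "g = (\<lambda>c1 c2 c3 d1 d2 d3. p3 (cls (pt c1 d3)) (cls (pt c2 d2)) (cls (pt c3 d1)))"
  have P: "vs AAA" by (rule vs_tensor[OF vsA vsAA])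
  have "tlift K AAA (\<lambda>a1 a2. tlift K AAA (\<lambda>m n. p3 m n a2) (\<Delta>A a1)) (\<Delta>A (cls (pt c d)))
    = C.sw AAA (\<lambda>c1 c2. C.sw AAA (\<lambda>d1 d2.
        tlift K AAA (\<lambda>m n. p3 m n (cls (pt c2 d1))) (\<Delta>A (cls (pt c1 d2)))) d) c"
    by (rule tlift_\<Delta>A_pure[OF P _ c d]) (assumption | rule mlinA)+
  also have "\<dots> = C.sw AAA (\<lambda>c1 c2. C.sw AAA (\<lambda>d1 d2. C.sw AAA (\<lambda>e1 e2. C.sw AAA (\<lambda>f1 f2.
        g e1 e2 c2 d1 f1 f2) d2) c1) d) c"
    unfolding g_def
    by (rule C.sw_cong[OF c P], (assumption | rule mlinA d)+, rule C.sw_cong[OF d P], (assumption | rule mlinA)+,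
        rule tlift_\<Delta>A_pure[OF P], (assumption | rule mlinA)+)
  also have "\<dots> = C.sw AAA (\<lambda>c1 c2. C.sw AAA (\<lambda>e1 e2. C.sw AAA (\<lambda>d1 d2. C.sw AAA (\<lambda>f1 f2.
        g e1 e2 c2 d1 f1 f2) d2) d) c1) c"
    unfolding g_def
    by (rule C.sw_cong[OF c P], (assumption | rule mlinA d)+, rule C.sw_swap[OF d _ P], (assumption | rule mlinA)+)
  also have "\<dots> = C.sw AAA (\<lambda>c1 c2. C.sw AAA (\<lambda>e1 e2. C.sw AAA (\<lambda>d1 d2. C.sw AAA (\<lambda>f1 f2.
        g c1 e1 e2 d1 f1 f2) d2) d) c2) c"
    unfolding g_def by (rule C.sw_coassoc[OF c P]) (assumption | rule mlinA d)+
  also have "\<dots> = C.sw AAA (\<lambda>c1 c2. C.sw AAA (\<lambda>e1 e2. C.sw AAA (\<lambda>d1 d2. C.sw AAA (\<lambda>f1 f2.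
        g c1 e1 e2 f1 f2 d2) d1) d) c2) c"
    unfolding g_def
    by (rule C.sw_cong[OF c P], (assumption | rule mlinA d)+, rule C.sw_cong[OF _ P], (assumption | rule mlinA d)+,
        rule C.sw_coassoc[OF d P, symmetric], (assumption | rule mlinA)+)
  also have "\<dots> = C.sw AAA (\<lambda>c1 c2. C.sw AAA (\<lambda>d1 d2. C.sw AAA (\<lambda>e1 e2. C.sw AAA (\<lambda>f1 f2.
        g c1 e1 e2 f1 f2 d2) d1) c2) d) c"
    unfolding g_def
    by (rule C.sw_cong[OF c P], (assumption | rule mlinA d)+, rule C.sw_swap[OF _ d P], (assumption | rule mlinA)+)
  also have "\<dots> = C.sw AAA (\<lambda>c1 c2. C.sw AAA (\<lambda>d1 d2. pure_tensor K A AA (cls (pt c1 d2)) (\<Delta>A (cls (pt c2 d1)))) d) c"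
  proof (rule C.sw_cong[OF c P])
    fix c1 c2 assume c12: "c1 \<in> carrier C" "c2 \<in> carrier C"
    show "C.sw AAA (\<lambda>d1 d2. C.sw AAA (\<lambda>e1 e2. C.sw AAA (\<lambda>f1 f2. g c1 e1 e2 f1 f2 d2) d1) c2) d
      = C.sw AAA (\<lambda>d1 d2. pure_tensor K A AA (cls (pt c1 d2)) (\<Delta>A (cls (pt c2 d1)))) d"
    proof (rule C.sw_cong[OF d P])
      fix d1 d2 assume d12: "d1 \<in> carrier C" "d2 \<in> carrier C"
      let ?a = "cls (pt c1 d2)"
      have a: "?a \<in> carrier A" "cls (pt c2 d1) \<in> carrier A" by (rule mlinA c12 d12)+
      have l: "(\<lambda>t. pure_tensor K A AA ?a t) \<in> L AA AAA" by (assumption | rule mlinA a)+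
      have "pure_tensor K A AA ?a (\<Delta>A (cls (pt c2 d1)))
        = pure_tensor K A AA ?a (tlift K AA (pure_tensor K A A) (\<Delta>A (cls (pt c2 d1))))"
        using \<Delta>A_cls[OF pure_closed[OF c12(2) d12(1) C.vsC C.vsC]]
          tlift_\<Delta>[OF vsAA bilin_pure[OF vsA vsA] pure_closed[OF c12(2) d12(1) C.vsC C.vsC]]
        by (simp add: \<Delta>_swA)
      also have "\<dots> = tlift K AAA (\<lambda>m n. p3 ?a m n) (\<Delta>A (cls (pt c2 d1)))"
        by (rule tlift_commute[OF vsA vsA \<Delta>A_closed[OF a(2)] vsAA P l]) (assumption | rule mlinA)+
      also have "\<dots> = C.sw AAA (\<lambda>e1 e2. C.sw AAA (\<lambda>f1 f2. g c1 e1 e2 f1 f2 d2) d1) c2"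
        unfolding g_def by (rule tlift_\<Delta>A_pure[OF P _ c12(2) d12(1)]) (assumption | rule mlinA a)+
      finally show "C.sw AAA (\<lambda>e1 e2. C.sw AAA (\<lambda>f1 f2. g c1 e1 e2 f1 f2 d2) d1) c2
        = pure_tensor K A AA ?a (\<Delta>A (cls (pt c2 d1)))" by simp
    qed (assumption | rule mlinA c12)+
  qed (assumption | rule mlinA d)+
  also have "\<dots> = tlift K AAA (\<lambda>a1 a2. pure_tensor K A AA a1 (\<Delta>A a2)) (\<Delta>A (cls (pt c d)))"
    by (rule tlift_\<Delta>A_pure[OF P _ c d, symmetric]) (assumption | rule mlinA)+
  finally show "tlift K AAA (\<lambda>a1 a2. tlift K AAA (\<lambda>m n. p3 m n a2) (\<Delta>A a1)) (\<Delta>A (cls (pt c d)))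
    = tlift K AAA (\<lambda>a1 a2. pure_tensor K A AA a1 (\<Delta>A a2)) (\<Delta>A (cls (pt c d)))" .
qed

lemma \<Delta>A_counit:
  assumes a: "a \<in> carrier A"
  shows "tlift K A (\<lambda>x y. \<epsilon>A x \<odot>\<^bsub>A\<^esub> y) (\<Delta>A a) = a" "tlift K A (\<lambda>x y. \<epsilon>A y \<odot>\<^bsub>A\<^esub> x) (\<Delta>A a) = a"
proof -
  have l: "(\<lambda>a. tlift K A (\<lambda>x y. \<epsilon>A x \<odot>\<^bsub>A\<^esub> y) (\<Delta>A a)) \<in> L A A"
    "(\<lambda>a. tlift K A (\<lambda>x y. \<epsilon>A y \<odot>\<^bsub>A\<^esub> x) (\<Delta>A a)) \<in> L A A" by (assumption | rule mlinA)+
  have s: "(k \<otimes> m) \<odot>\<^bsub>A\<^esub> x = m \<odot>\<^bsub>A\<^esub> (k \<odot>\<^bsub>A\<^esub> x)" if "k \<in> carrier K" "m \<in> carrier K" "x \<in> carrier A" for k m x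
    using module.smult_assoc1[OF vsA, of m k x] m_comm[of k m] that by simp
  have e: "\<epsilon>A (cls (pt x y)) = counit C x \<otimes> counit C y" if "x \<in> carrier C" "y \<in> carrier C" for x y
    using that by (simp add: \<epsilon>A_cls \<epsilon>T_pure pure_closed C.vsC)
  show "tlift K A (\<lambda>x y. \<epsilon>A x \<odot>\<^bsub>A\<^esub> y) (\<Delta>A a) = a"
  proof (rule A_ext[OF l(1) lin_id vsA _ a])
    fix c d assume c: "c \<in> carrier C" and d: "d \<in> carrier C"
    have "tlift K A (\<lambda>x y. \<epsilon>A x \<odot>\<^bsub>A\<^esub> y) (\<Delta>A (cls (pt c d)))
      = C.sw A (\<lambda>c1 c2. C.sw A (\<lambda>d1 d2. \<epsilon>A (cls (pt c1 d2)) \<odot>\<^bsub>A\<^esub> cls (pt c2 d1)) d) c"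
      by (rule tlift_\<Delta>A_pure[OF vsA _ c d]) (assumption | rule mlinA)+
    also have "\<dots> = C.sw A (\<lambda>c1 c2. counit C c1 \<odot>\<^bsub>A\<^esub> cls (pt c2 d)) c"
    proof (rule C.sw_cong[OF c vsA])
      fix c1 c2 assume c12: "c1 \<in> carrier C" "c2 \<in> carrier C"
      have "C.sw A (\<lambda>d1 d2. \<epsilon>A (cls (pt c1 d2)) \<odot>\<^bsub>A\<^esub> cls (pt c2 d1)) d
        = C.sw A (\<lambda>d1 d2. counit C d2 \<odot>\<^bsub>A\<^esub> (counit C c1 \<odot>\<^bsub>A\<^esub> cls (pt c2 d1))) d" (is "?lhs = _")
        by (rule C.sw_cong[OF d vsA])
          (simp_all add: e c12 s C.counit_closed cls_closed pure_closed C.vsC vs_smult vsA)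
      also have "\<dots> = counit C c1 \<odot>\<^bsub>A\<^esub> cls (pt c2 d)" (is "_ = ?rhs")
        by (rule C.sw_counit_right[OF d vsA]) (assumption | rule mlinA c12)+
      finally show "?lhs = ?rhs" .
    qed (assumption | rule mlinA d)+
    also have "\<dots> = cls (pt c d)"
      by (rule C.sw_counit_left[OF c vsA]) (assumption | rule mlinA d)+
    finally show "tlift K A (\<lambda>x y. \<epsilon>A x \<odot>\<^bsub>A\<^esub> y) (\<Delta>A (cls (pt c d))) = cls (pt c d)" .
  qed
  show "tlift K A (\<lambda>x y. \<epsilon>A y \<odot>\<^bsub>A\<^esub> x) (\<Delta>A a) = a"
  proof (rule A_ext[OF l(2) lin_id vsA _ a])
    fix c d assume c: "c \<in> carrier C" and d: "d \<in> carrier C"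
    have "tlift K A (\<lambda>x y. \<epsilon>A y \<odot>\<^bsub>A\<^esub> x) (\<Delta>A (cls (pt c d)))
      = C.sw A (\<lambda>c1 c2. C.sw A (\<lambda>d1 d2. \<epsilon>A (cls (pt c2 d1)) \<odot>\<^bsub>A\<^esub> cls (pt c1 d2)) d) c"
      by (rule tlift_\<Delta>A_pure[OF vsA _ c d]) (assumption | rule mlinA)+
    also have "\<dots> = C.sw A (\<lambda>c1 c2. counit C c2 \<odot>\<^bsub>A\<^esub> cls (pt c1 d)) c"
    proof (rule C.sw_cong[OF c vsA])
      fix c1 c2 assume c12: "c1 \<in> carrier C" "c2 \<in> carrier C"
      have "C.sw A (\<lambda>d1 d2. \<epsilon>A (cls (pt c2 d1)) \<odot>\<^bsub>A\<^esub> cls (pt c1 d2)) d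
        = C.sw A (\<lambda>d1 d2. counit C d1 \<odot>\<^bsub>A\<^esub> (counit C c2 \<odot>\<^bsub>A\<^esub> cls (pt c1 d2))) d" (is "?lhs = _")
        by (rule C.sw_cong[OF d vsA])
          (simp_all add: e c12 s C.counit_closed cls_closed pure_closed C.vsC vs_smult vsA)
      also have "\<dots> = counit C c2 \<odot>\<^bsub>A\<^esub> cls (pt c1 d)" (is "_ = ?rhs")
        by (rule C.sw_counit_left[OF d vsA]) (assumption | rule mlinA c12)+
      finally show "?lhs = ?rhs" .
    qed (assumption | rule mlinA d)+
    also have "\<dots> = cls (pt c d)"
      by (rule C.sw_counit_right[OF c vsA]) (assumption | rule mlinA d)+
    finally show "tlift K A (\<lambda>x y. \<epsilon>A y \<odot>\<^bsub>A\<^esub> x) (\<Delta>A (cls (pt c d))) = cls (pt c d)" .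
  qed
qed

text \<open>Here cocommutativity of \<open>H\<close> enters: \<open>\<Delta>\<close> reverses the order of the parts of the second factor,
  and hence of the parts of \<open>h\<close>.\<close>

lemma \<Delta>A_act:
  assumes a: "a \<in> carrier A" and h: "h \<in> carrier H"
  shows "\<Delta>A (aact a h) = tlift K AA (\<lambda>m n. H.sw AA (\<lambda>p q. pure_tensor K A A (aact m p) (aact n q)) h) (\<Delta>A a)"
proof (rule A_ext[OF _ _ vsAA _ a])
  show "(\<lambda>a. \<Delta>A (aact a h)) \<in> L A AA" by (assumption | rule mlinA h)+
  show "(\<lambda>a. tlift K AA (\<lambda>m n. H.sw AA (\<lambda>p q. pure_tensor K A A (aact m p) (aact n q)) h) (\<Delta>A a)) \<in> L A AA"
    by (assumption | rule mlinA h)+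
  fix c d assume c: "c \<in> carrier C" and d: "d \<in> carrier C"
  let ?P = "pure_tensor K A A"
  have pA: "bilin A A AA ?P" by (rule bilin_pure[OF vsA vsA])
  have "\<Delta>A (aact (cls (pt c d)) h) = swA AA ?P (pt c (act d h))" (is "?lhs = _")
    using c d h by (simp add: aact_cls pure_closed C.vsC actT_pure \<Delta>A_cls[unfolded \<Delta>_swA] act_closed \<Delta>_swA)
  also have "\<dots> = C.sw AA (\<lambda>c1 c2. C.sw AA (\<lambda>d1 d2. ?P (cls (pt c1 d2)) (cls (pt c2 d1))) (act d h)) c"
    by (rule swA_pure[OF vsAA pA c act_closed[OF d h]])
  also have "\<dots> = C.sw AA (\<lambda>c1 c2. C.sw AA (\<lambda>d1 d2. H.sw AA (\<lambda>p q.
      ?P (aact (cls (pt c1 d2)) p) (aact (cls (pt c2 d1)) q)) h) d) c"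
  proof (rule C.sw_cong[OF c vsAA])
    fix c1 c2 assume c12: "c1 \<in> carrier C" "c2 \<in> carrier C"
    have "C.sw AA (\<lambda>d1 d2. ?P (cls (pt c1 d2)) (cls (pt c2 d1))) (act d h)
      = C.sw AA (\<lambda>d1 d2. H.sw AA (\<lambda>p q. ?P (cls (pt c1 (act d2 q))) (cls (pt c2 (act d1 p)))) h) d" (is "?lhs = _")
      by (rule sw_act[OF d h vsAA]) (assumption | rule mlinA c12)+
    also have "\<dots> = C.sw AA (\<lambda>d1 d2. H.sw AA (\<lambda>p q. ?P (cls (pt c1 (act d2 p))) (cls (pt c2 (act d1 q)))) h) d"
      by (rule C.sw_cong[OF d vsAA], (assumption | rule mlinA c12 h)+,
          rule H.sw_cocomm[OF cocomm h vsAA], (assumption | rule mlinA c12)+)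
    also have "\<dots> = C.sw AA (\<lambda>d1 d2. H.sw AA (\<lambda>p q. ?P (aact (cls (pt c1 d2)) p) (aact (cls (pt c2 d1)) q)) h) d" (is "_ = ?rhs")
      by (rule C.sw_cong[OF d vsAA], (assumption | rule mlinA c12 h)+,
          rule H.sw_cong[OF h vsAA], (assumption | rule mlinA c12)+)
        (simp add: aact_cls actT_pure c12 pure_closed C.vsC)
    finally show "?lhs = ?rhs" .
  qed (assumption | rule mlinA d h)+
  also have "\<dots> = tlift K AA (\<lambda>m n. H.sw AA (\<lambda>p q. ?P (aact m p) (aact n q)) h) (\<Delta>A (cls (pt c d)))" (is "_ = ?rhs")
    by (rule tlift_\<Delta>A_pure[OF vsAA _ c d, symmetric]) (assumption | rule mlinA h)+
  finally show "?lhs = ?rhs" .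
qed

lemma aact_mult:
  assumes a: "a \<in> carrier A" and g: "g \<in> carrier H" and h: "h \<in> carrier H"
  shows "aact a (g \<otimes>\<^bsub>H\<^esub> h) = aact (aact a g) h"
proof (rule A_ext[OF _ _ vsA _ a])
  show "(\<lambda>a. aact a (g \<otimes>\<^bsub>H\<^esub> h)) \<in> L A A" "(\<lambda>a. aact (aact a g) h) \<in> L A A"
    by (assumption | rule mlinA g h)+
qed (simp add: aact_cls g h mult_closed actT_pure actT_closed pure_closed C.vsC act_mult act_closed)

lemma aact_one:
  assumes a: "a \<in> carrier A"
  shows "aact a \<one>\<^bsub>H\<^esub> = a"
proof (rule A_ext[OF _ lin_id vsA _ a])
  show "(\<lambda>a. aact a \<one>\<^bsub>H\<^esub>) \<in> L A A" by (rule lin_aact0[OF H.one_closed])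
qed (simp add: aact_cls actT_pure pure_closed C.vsC act_one)

lemma \<epsilon>A_act:
  assumes a: "a \<in> carrier A" and h: "h \<in> carrier H"
  shows "\<epsilon>A (aact a h) = \<epsilon>A a \<otimes> counit H h"
proof (rule A_ext[OF _ _ vs_scalar _ a])
  show "(\<lambda>a. \<epsilon>A (aact a h)) \<in> L A S" "(\<lambda>a. \<epsilon>A a \<otimes> counit H h) \<in> L A S"
    by (assumption | rule mlinA h)+
qed (simp add: aact_cls \<epsilon>A_cls actT_pure pure_closed C.vsC \<epsilon>T_pure act_closed h counit_act m_assoc
    C.counit_closed H.counit_closed)

section \<open>The coalgebra of coinvariants\<close>

abbreviation "Q \<equiv> coinv_coalgebra K C I"
abbreviation "QQ \<equiv> tensor K Q Q"
abbreviation "QQQ \<equiv> tensor K Q QQ"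
abbreviation "\<kappa> \<equiv> kappa K H C act"

lemma quot_TCS:
  "carrier (quot_module TCS W) = cls ` CS" "add (quot_module TCS W) = add A"
  "zero (quot_module TCS W) = zero A" "smult (quot_module TCS W) = smult A"
  "W +>\<^bsub>TCS\<^esub> x = cls x"
proof -
  have c: "W +>\<^bsub>TCS\<^esub> x = W +>\<^bsub>T\<^esub> x" for x by (simp add: coset_def')
  show "W +>\<^bsub>TCS\<^esub> x = cls x" by (simp add: c coinv_class_def)
  show "carrier (quot_module TCS W) = cls ` CS"
    by (simp add: quot_carrier c coinv_class_def)
  show "add (quot_module TCS W) = add A"
    by (simp add: quot_module_def ambient_quot_def set_add_def set_mult_def fun_eq_iff)
  show "zero (quot_module TCS W) = zero A" by (simp add: quot_module_def ambient_quot_def)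
  show "smult (quot_module TCS W) = smult A"
    by (simp add: quot_module_def ambient_quot_def c)
qed

lemma Q_simps:
  "carrier Q = cls ` CS" "add Q = add A" "zero Q = zero A" "smult Q = smult A"
  "counit Q = \<epsilon>A"
  "comult Q = (\<lambda>U. THE t. t \<in> carrier QQ \<and> (\<forall>x\<in>U. ambient_incl K C I t = \<Delta> x))"
proof -
  have Q': "carrier Q = cls ` CS" "add Q = add A" "zero Q = zero A" "smult Q = smult A"
    by (simp_all add: coinv_coalgebra_def coinv_module_def Let_def module.defs coalgebra.defs quot_TCS)
  show "carrier Q = cls ` CS" "add Q = add A" "zero Q = zero A" "smult Q = smult A"
    by (fact Q')+
  have "tensor K (coinv_module K C I) (coinv_module K C I) = QQ"
    by (rule tensor_cong) (simp_all add: Q' coinv_module_def quot_TCS)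
  thus "counit Q = \<epsilon>A"
    "comult Q = (\<lambda>U. THE t. t \<in> carrier QQ \<and> (\<forall>x\<in>U. ambient_incl K C I t = \<Delta> x))"
    by (simp_all add: coinv_coalgebra_def Let_def module.defs coalgebra.defs)
qed

lemma subspace_Q: "submodule (cls ` CS) K A"
proof -
  have "submodule (cls ` carrier TCS) K A"
    by (rule subspace_image[OF lin_TCS[OF lin_cls[OF lin_id]] vsTCS vsA])
  thus ?thesis by simp
qed

lemma vsQ: "vs Q"
  by (rule vs_cong[OF vs_subspace[OF vsA subspace_Q]]) (simp_all add: Q_simps)

lemma vsQQ: "vs QQ" by (rule vs_tensor[OF vsQ vsQ])
lemma vsQQQ: "vs QQQ" by (rule vs_tensor[OF vsQ vsQQ])
lemma vsAAA: "vs AAA" by (rule vs_tensor[OF vsA vsAA])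

lemma Q_A: "q \<in> carrier Q \<Longrightarrow> q \<in> carrier A"
  using subspace_subset[OF subspace_Q] by (auto simp: Q_simps)

lemma cls_Q: "x \<in> CS \<Longrightarrow> cls x \<in> carrier Q" by (simp add: Q_simps)

lemma Q_cases:
  assumes "q \<in> carrier Q" obtains x where "x \<in> CS" "q = cls x"
  using assms by (auto simp: Q_simps)

lemma lin_incl: "(\<lambda>q. q) \<in> L Q A"
  by (rule linI) (simp_all add: Q_A Q_simps(2,4))

lemma lin_into_Q: "\<lbrakk>f \<in> L X A; \<And>x. x \<in> carrier X \<Longrightarrow> f x \<in> carrier Q\<rbrakk> \<Longrightarrow> f \<in> L X Q"
  by (auto simp: lin_hom_def Q_simps(2,4))

lemma lin_on_Q: "f \<in> L A P \<Longrightarrow> f \<in> L Q P"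
  using lin_comp[OF _ lin_incl] by auto

lemma lin_Q_cls:
  assumes f: "f \<in> L TCS P" and g: "\<And>x. x \<in> CS \<Longrightarrow> g (cls x) = f x"
  shows "g \<in> L Q P"
proof -
  have "g \<in> L (quot_module TCS W) P"
    by (rule lin_from_quot[OF vsTCS subspace_W_TCS f]) (simp add: quot_TCS g)
  thus ?thesis by (simp add: lin_hom_def Q_simps quot_TCS)
qed

text \<open>A linear retraction of the ambient quotient onto the quotient of the cotensor square.  It splits
  the map of tensor squares induced by the inclusion, which is therefore injective, and it extends
  maps from the latter quotient, such as \<open>\<kappa>\<close>, to the former.\<close>

definition rho where "rho = (SOME p. p \<in> L A A \<and> (\<forall>a\<in>carrier A. p a \<in> cls ` CS) \<and> (\<forall>u\<in>cls ` CS. p u = u))"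

lemma rho: "rho \<in> L A A" "a \<in> carrier A \<Longrightarrow> rho a \<in> carrier Q" "q \<in> carrier Q \<Longrightarrow> rho q = q"
proof -
  have "\<exists>p. p \<in> L A A \<and> (\<forall>a\<in>carrier A. p a \<in> cls ` CS) \<and> (\<forall>u\<in>cls ` CS. p u = u)"
    by (rule retraction_exists[OF vsA subspace_Q]) auto
  from someI_ex[OF this] show "rho \<in> L A A" "a \<in> carrier A \<Longrightarrow> rho a \<in> carrier Q"
    "q \<in> carrier Q \<Longrightarrow> rho q = q"
    unfolding rho_def[symmetric] by (auto simp: Q_simps)
qed

lemma rho_Q: "rho \<in> L A Q" by (rule lin_into_Q[OF rho(1,2)])

abbreviation "incl \<equiv> ambient_incl K C I"
abbreviation "pQ \<equiv> pure_tensor K Q Q"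
abbreviation "pA \<equiv> pure_tensor K A A"

definition retr where "retr = tmap K Q Q rho rho"

lemma lin_incl2: "incl \<in> L QQ AA"
  unfolding ambient_incl_def id_def by (rule lin_tmap[OF vsQ vsQ vsA vsA lin_incl lin_incl])

lemma incl_pure: "\<lbrakk>x \<in> carrier Q; y \<in> carrier Q\<rbrakk> \<Longrightarrow> incl (pQ x y) = pA x y"
  unfolding ambient_incl_def id_def by (rule tmap_pure[OF vsQ vsQ vsA vsA lin_incl lin_incl])

lemma lin_retr: "retr \<in> L AA QQ"
  unfolding retr_def by (rule lin_tmap[OF vsA vsA vsQ vsQ rho_Q rho_Q])

lemma retr_pure: "\<lbrakk>x \<in> carrier A; y \<in> carrier A\<rbrakk> \<Longrightarrow> retr (pA x y) = pQ (rho x) (rho y)"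
  unfolding retr_def by (rule tmap_pure[OF vsA vsA vsQ vsQ rho_Q rho_Q])

lemma retr_incl: "t \<in> carrier QQ \<Longrightarrow> retr (incl t) = t"
  by (rule tensor_ext[OF vsQ vsQ lin_comp[OF lin_retr lin_incl2] lin_id vsQQ])
    (simp_all add: incl_pure retr_pure Q_A rho(3))

lemma tlift_incl:
  assumes P: "vs P" and b: "bilin A A P b" and t: "t \<in> carrier QQ"
  shows "tlift K P b (incl t) = tlift K P b t"
proof (rule tensor_ext[OF vsQ vsQ lin_comp[OF lin_tlift[OF vsA vsA P b] lin_incl2] _ P _ t])
  have bQ: "bilin Q Q P b"
    by (rule bilinI) (auto intro: lin_on_Q bilin_right[OF b] bilin_left[OF b] Q_A)
  show "tlift K P b \<in> L QQ P" by (rule lin_tlift[OF vsQ vsQ P bQ])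
  show "tlift K P b (incl (pQ x y)) = tlift K P b (pQ x y)" if "x \<in> carrier Q" "y \<in> carrier Q" for x y
    using that by (simp add: incl_pure tlift_pure[OF vsA vsA P b] tlift_pure[OF vsQ vsQ P bQ] Q_A)
qed

text \<open>Both legs of \<open>\<Delta>\<close> lie in the quotient of the cotensor square: the second one by the formula on
  the image of the canonical map, the first one because middle cuts do.\<close>

lemma incl_retr_\<Delta>:
  assumes x: "x \<in> CS"
  shows "incl (retr (\<Delta> x)) = \<Delta> x"
proof -
  define r1 where "r1 = tlift K AA (\<lambda>a a'. pA (rho a) a')"
  define r2 where "r2 = tlift K AA (\<lambda>a a'. pA a (rho a'))"
  note rr = mlinA lin_comp[OF rho(1)] Q_A[OF rho(2)]
  have b1: "bilin A A AA (\<lambda>a a'. pA (rho a) a')" and b2: "bilin A A AA (\<lambda>a a'. pA a (rho a'))"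
    by (assumption | rule rr)+
  have l1: "r1 \<in> L AA AA" and l2: "r2 \<in> L AA AA"
    unfolding r1_def r2_def by (rule lin_tlift[OF vsA vsA vsAA b1] lin_tlift[OF vsA vsA vsAA b2])+
  have p1: "r1 (pA a a') = pA (rho a) a'" and p2: "r2 (pA a a') = pA a (rho a')"
    if "a \<in> carrier A" "a' \<in> carrier A" for a a'
    unfolding r1_def r2_def
    by (rule tlift_pure[OF vsA vsA vsAA b1 that] tlift_pure[OF vsA vsA vsAA b2 that])+
  have "incl (retr t) = r1 (r2 t)" if "t \<in> carrier AA" for t
    by (rule tensor_ext[OF vsA vsA lin_comp[OF lin_incl2 lin_retr] lin_comp[OF l1 l2] vsAA _ that])
      (simp add: retr_pure incl_pure rho(2) p1 p2 Q_A)
  moreover have "r2 (\<Delta> x) = \<Delta> x"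
  proof (rule CS_ext[OF lin_TCS[OF lin_comp[OF l2 lin_\<Delta>]] lin_TCS[OF lin_\<Delta>] vsAA _ x])
    fix c h assume c: "c \<in> carrier C" and h: "h \<in> carrier H"
    have "r2 (\<Delta> (cn c h)) = swA AA (\<lambda>a a'. pA a (rho a')) (cn c h)"
      unfolding r2_def by (rule tlift_\<Delta>[OF vsAA b2 cn_closed[OF c h]])
    also have "\<dots> = swA AA pA (cn c h)"
      unfolding swA_cn[OF vsAA b2 c h] swA_cn[OF vsAA bilin_pure[OF vsA vsA] c h]
      by (rule H.sw_cong[OF h vsAA], (assumption | rule rr c)+,
          rule C.sw_cong[OF c vsAA], (assumption | rule rr)+,
          rule C.sw_cong[OF _ vsAA], (assumption | rule rr)+)
        (simp add: rho(3) cls_Q cn_CS)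
    finally show "r2 (\<Delta> (cn c h)) = \<Delta> (cn c h)" by (simp add: \<Delta>_swA)
  qed
  moreover have "r1 (\<Delta> x) = \<Delta> x"
  proof (rule CS_ext[OF lin_TCS[OF lin_comp[OF l1 lin_\<Delta>]] lin_TCS[OF lin_\<Delta>] vsAA _ x])
    fix c h assume c: "c \<in> carrier C" and h: "h \<in> carrier H"
    let ?t = "\<Delta> (cn c h)"
    have t: "?t \<in> carrier AA" by (rule lin_closed[OF lin_\<Delta> cn_closed[OF c h]])
    have rt: "r1 ?t \<in> carrier AA" by (rule lin_closed[OF l1 t])
    have "r1 ?t \<ominus>\<^bsub>AA\<^esub> ?t = \<zero>\<^bsub>AA\<^esub>"
    proof (rule tensor_separate_right[OF vsA vsA vs_minus[OF vsAA rt t]])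
      fix \<psi> assume \<psi>: "\<psi> \<in> L A S"
      let ?e = "tlift K A (\<lambda>a a'. \<psi> a' \<odot>\<^bsub>A\<^esub> a)"
      have b: "bilin A A A (\<lambda>a a'. \<psi> a' \<odot>\<^bsub>A\<^esub> a)"
        by (assumption | rule mlin' lin_comp[OF \<psi>] functional_closed[OF \<psi>])+
      note l = lin_tlift[OF vsA vsA vsA b]
      have "?e (r1 ?t) = rho (?e ?t)"
        by (rule tensor_ext[OF vsA vsA lin_comp[OF l l1] lin_comp[OF rho(1) l] vsA _ t])
          (simp add: p1 tlift_pure[OF vsA vsA vsA b] Q_A rho(2) lin_smult[OF rho(1)] functional_closed[OF \<psi>])
      also have "\<dots> = H.sw A (\<lambda>p q. rho (cls (actT q (cut (\<lambda>w. \<psi> (cls (cn w p))) c)))) h"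
        unfolding \<Delta>_second_leg[OF \<psi> c h]
        by (rule H.sw_commute[OF h rho(1) vsA vsA])
          (assumption | rule rr cut_closed central_lin[OF central_cn[OF \<psi>]] c)+
      also have "\<dots> = H.sw A (\<lambda>p q. cls (actT q (cut (\<lambda>w. \<psi> (cls (cn w p))) c))) h"
        by (rule H.sw_cong[OF h vsA])
          (assumption | rule rr cut_closed central_lin[OF central_cn[OF \<psi>]] c |
            simp add: rho(3) cls_Q actT_CS cut_CS central_cn[OF \<psi>] c)+
      also have "\<dots> = ?e ?t" by (rule \<Delta>_second_leg[OF \<psi> c h, symmetric])
      finally have "?e (r1 ?t) = ?e ?t" .
      thus "?e (r1 ?t \<ominus>\<^bsub>AA\<^esub> ?t) = \<zero>\<^bsub>A\<^esub>"
        using lin_minus[OF l vsAA vsA rt t] vs_minus_self[OF vsA] lin_closed[OF l] rt t by simp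
    qed
    thus "r1 ?t = ?t" using vs_minus_self[OF vsAA rt t] by simp
  qed
  ultimately show ?thesis using lin_closed[OF lin_\<Delta> CS_closed[OF x]] by simp
qed

lemma comult_Q_cls:
  assumes x: "x \<in> CS"
  shows "comult Q (cls x) = retr (\<Delta> x)"
proof -
  have xT: "x \<in> carrier T" by (rule CS_closed[OF x])
  have y: "\<Delta> y = \<Delta> x" if "y \<in> cls x" for y
  proof -
    have y': "y \<in> carrier T" "cls y = cls x"
      using coset_memD[OF vsT subspace_W xT] that by (auto simp: coinv_class_def)
    show ?thesis using \<Delta>A_cls[OF y'(1)] \<Delta>A_cls[OF xT] y'(2) by simp
  qed
  have xx: "x \<in> cls x" using coset_self[OF vsT subspace_W xT] by (simp add: coinv_class_def)
  have r: "retr (\<Delta> x) \<in> carrier QQ" by (rule lin_closed[OF lin_retr lin_closed[OF lin_\<Delta> xT]])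
  show ?thesis
    unfolding Q_simps(6)
  proof (rule the_equality)
    show "retr (\<Delta> x) \<in> carrier QQ \<and> (\<forall>y\<in>cls x. incl (retr (\<Delta> x)) = \<Delta> y)"
      using r y incl_retr_\<Delta>[OF x] by simp
    fix t assume "t \<in> carrier QQ \<and> (\<forall>y\<in>cls x. incl t = \<Delta> y)"
    hence "t \<in> carrier QQ" "incl t = \<Delta> x" using xx by auto
    thus "t = retr (\<Delta> x)" using retr_incl[of t] by simp
  qed
qed

lemma comult_Q_lin: "comult Q \<in> L Q QQ"
  by (rule lin_Q_cls[OF lin_TCS[OF lin_comp[OF lin_retr lin_\<Delta>]] comult_Q_cls])

lemma comult_Q_closed: "q \<in> carrier Q \<Longrightarrow> comult Q q \<in> carrier QQ"
  by (rule lin_closed[OF comult_Q_lin])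

lemma incl_comult_Q:
  assumes q: "q \<in> carrier Q"
  shows "incl (comult Q q) = \<Delta>A q"
proof -
  obtain x where x: "x \<in> CS" "q = cls x" using Q_cases[OF q] .
  show ?thesis by (simp add: x comult_Q_cls incl_retr_\<Delta> \<Delta>A_cls CS_closed)
qed

lemma tlift_comult_Q:
  assumes P: "vs P" and b: "bilin A A P b" and q: "q \<in> carrier Q"
  shows "tlift K P b (comult Q q) = tlift K P b (\<Delta>A q)"
  using tlift_incl[OF P b comult_Q_closed[OF q]] by (simp add: incl_comult_Q[OF q])

lemma tlift_comult_Q_cong:
  assumes P: "vs P" and b: "bilin A A P b'" and q: "q \<in> carrier Q"
    and eq: "\<And>x y. \<lbrakk>x \<in> carrier Q; y \<in> carrier Q\<rbrakk> \<Longrightarrow> b x y = b' x y"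
  shows "tlift K P b (comult Q q) = tlift K P b' (\<Delta>A q)"
proof -
  have "tlift K P b (comult Q q) = tlift K P b' (comult Q q)"
    by (rule tlift_cong[OF vsQ vsQ comult_Q_closed[OF q] P]) (auto simp: eq bilin_closed[OF b] Q_A)
  thus ?thesis by (simp add: tlift_comult_Q[OF P b q])
qed

text \<open>\<open>J\<close> embeds the threefold tensor product into that of the ambient quotient, where the identity
  is known; \<open>J'\<close> is a left inverse.\<close>

lemma coassoc_Q:
  assumes q: "q \<in> carrier Q"
  shows "tassoc K Q Q Q (tmap K QQ Q (comult Q) id (comult Q q)) = tmap K Q QQ id (comult Q) (comult Q q)"
    (is "?l = ?r")
proof -
  define J where "J = tmap K A AA (\<lambda>q. q) incl"
  define J' where "J' = tmap K Q QQ rho retr"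
  have J: "J \<in> L QQQ AAA" unfolding J_def by (rule lin_tmap[OF vsQ vsQQ vsA vsAA lin_incl lin_incl2])
  have J': "J' \<in> L AAA QQQ" unfolding J'_def by (rule lin_tmap[OF vsA vsAA vsQ vsQQ rho_Q lin_retr])
  have Jp: "J (pure_tensor K Q QQ x t) = pure_tensor K A AA x (incl t)"
    if "x \<in> carrier Q" "t \<in> carrier QQ" for x t
    unfolding J_def by (rule tmap_pure[OF vsQ vsQQ vsA vsAA lin_incl lin_incl2 that])
  have J'p: "J' (pure_tensor K A AA x t) = pure_tensor K Q QQ (rho x) (retr t)"
    if "x \<in> carrier A" "t \<in> carrier AA" for x t
    unfolding J'_def by (rule tmap_pure[OF vsA vsAA vsQ vsQQ rho_Q lin_retr that])
  have J'J: "J' (J t) = t" if "t \<in> carrier QQQ" for t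
    by (rule tensor_ext[OF vsQ vsQQ lin_comp[OF J' J] lin_id vsQQQ _ that])
      (simp add: Jp J'p Q_A rho(3) retr_incl lin_closed[OF lin_incl2])
  note pc = pure_closed[OF _ _ vsQ vsQ] pure_closed[OF _ _ vsQ vsQQ] pure_closed[OF _ _ vsQQ vsQ]
  have vQQQ': "vs (tensor K QQ Q)" by (rule vs_tensor[OF vsQQ vsQ])
  note c = comult_Q_closed[OF q]
  have id: "id \<in> L Q Q" by (rule lin_id_const)
  have l: "?l \<in> carrier QQQ" and r: "?r \<in> carrier QQQ"
    by (rule lin_closed[OF lin_tassoc[OF vsQ vsQ vsQ]], rule lin_closed[OF lin_tmap[OF vsQ vsQ vsQQ vsQ comult_Q_lin id] c])
      (rule lin_closed[OF lin_tmap[OF vsQ vsQ vsQ vsQQ id comult_Q_lin] c])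
  have "J ?r = tlift K AAA (\<lambda>x y. J (pure_tensor K Q QQ x (comult Q y))) (comult Q q)"
    unfolding tmap_def[of K Q QQ] id_def
    by (rule tlift_commute[OF vsQ vsQ c vsQQQ vsAAA J]) (auto intro: pc comult_Q_closed)
  also have "\<dots> = tlift K AAA (\<lambda>x y. pure_tensor K A AA x (\<Delta>A y)) (\<Delta>A q)"
    by (rule tlift_comult_Q_cong[OF vsAAA _ q])
      ((assumption | rule mlinA)+, simp add: Jp comult_Q_closed incl_comult_Q)
  also have "\<dots> = tlift K AAA (\<lambda>a1 a2. tlift K AAA (\<lambda>m n. p3 m n a2) (\<Delta>A a1)) (\<Delta>A q)"
    by (rule \<Delta>A_coassoc[OF Q_A[OF q], symmetric])
  also have "\<dots> = tlift K AAA (\<lambda>x y. J (tassoc K Q Q Q (pure_tensor K QQ Q (comult Q x) y))) (comult Q q)"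
  proof (rule tlift_comult_Q_cong[OF vsAAA _ q, symmetric])
    show "bilin A A AAA (\<lambda>a1 a2. tlift K AAA (\<lambda>m n. p3 m n a2) (\<Delta>A a1))"
      by (assumption | rule mlinA)+
    fix x y assume x: "x \<in> carrier Q" and y: "y \<in> carrier Q"
    have "J (tassoc K Q Q Q (pure_tensor K QQ Q (comult Q x) y))
      = tlift K AAA (\<lambda>m n. J (pure_tensor K Q QQ m (pQ n y))) (comult Q x)"
      unfolding tassoc_pure[OF vsQ vsQ vsQ comult_Q_closed[OF x] y]
      by (rule tlift_commute[OF vsQ vsQ comult_Q_closed[OF x] vsQQQ vsAAA J]) (auto intro: pc y)
    also have "\<dots> = tlift K AAA (\<lambda>m n. p3 m n y) (\<Delta>A x)"
      by (rule tlift_comult_Q_cong[OF vsAAA _ x])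
        ((assumption | rule mlinA Q_A[OF y])+, simp add: Jp pc y incl_pure)
    finally show "J (tassoc K Q Q Q (pure_tensor K QQ Q (comult Q x) y)) = tlift K AAA (\<lambda>m n. p3 m n y) (\<Delta>A x)" .
  qed
  also have "\<dots> = J ?l"
    unfolding tmap_def[of K QQ Q] id_def
    by (rule tlift_commute[OF vsQ vsQ c vQQQ' vsAAA, symmetric, where f = "\<lambda>t. J (tassoc K Q Q Q t)"])
      (auto intro: pc comult_Q_closed lin_comp[OF J lin_tassoc[OF vsQ vsQ vsQ]])
  finally have "J ?r = J ?l" .
  hence "J' (J ?r) = J' (J ?l)" by simp
  thus ?thesis by (simp only: J'J[OF l] J'J[OF r])
qed

lemma coalgebra_Q: "coalgebra K Q"
proof (intro coalgebra.intro coalgebra_axioms.intro)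
  show "field K" by (rule field_axioms)
  show "module K Q" by (rule vsQ)
  show "comult Q \<in> lin_hom K Q (tensor K Q Q)" by (rule comult_Q_lin)
  show "counit Q \<in> lin_hom K Q (scalar_module K)" unfolding Q_simps(5) by (rule lin_on_Q[OF \<epsilon>A_lin])
  fix q assume q: "q \<in> carrier Q"
  show "tassoc K Q Q Q (tmap K QQ Q (comult Q) id (comult Q q)) = tmap K Q QQ id (comult Q) (comult Q q)"
    by (rule coassoc_Q[OF q])
  have s: "\<epsilon>A x \<odot>\<^bsub>Q\<^esub> y \<in> carrier Q" if "x \<in> carrier Q" "y \<in> carrier Q" for x y
    by (rule vs_smult[OF vsQ \<epsilon>A_closed[OF Q_A[OF that(1)]] that(2)])
  have "tlift K Q (\<lambda>x y. counit Q x \<odot>\<^bsub>Q\<^esub> y) (comult Q q) = tlift K A (\<lambda>x y. \<epsilon>A x \<odot>\<^bsub>Q\<^esub> y) (comult Q q)"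
    unfolding Q_simps(5)
    by (rule tlift_commute[OF vsQ vsQ comult_Q_closed[OF q] vsQ vsA lin_incl]) (rule s)
  also have "\<dots> = tlift K A (\<lambda>x y. \<epsilon>A x \<odot>\<^bsub>A\<^esub> y) (\<Delta>A q)"
    by (rule tlift_comult_Q_cong[OF vsA _ q]) ((assumption | rule mlinA)+, simp add: Q_simps(4))
  also have "\<dots> = q" by (rule \<Delta>A_counit(1)[OF Q_A[OF q]])
  finally show "tlift K Q (\<lambda>x y. counit Q x \<odot>\<^bsub>Q\<^esub> y) (comult Q q) = q" .
  have "tlift K Q (\<lambda>x y. counit Q y \<odot>\<^bsub>Q\<^esub> x) (comult Q q) = tlift K A (\<lambda>x y. \<epsilon>A y \<odot>\<^bsub>Q\<^esub> x) (comult Q q)"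
    unfolding Q_simps(5)
    by (rule tlift_commute[OF vsQ vsQ comult_Q_closed[OF q] vsQ vsA lin_incl]) (rule s)
  also have "\<dots> = tlift K A (\<lambda>x y. \<epsilon>A y \<odot>\<^bsub>A\<^esub> x) (\<Delta>A q)"
    by (rule tlift_comult_Q_cong[OF vsA _ q]) ((assumption | rule mlinA)+, simp add: Q_simps(4))
  also have "\<dots> = q" by (rule \<Delta>A_counit(2)[OF Q_A[OF q]])
  finally show "tlift K Q (\<lambda>x y. counit Q y \<odot>\<^bsub>Q\<^esub> x) (comult Q q) = q" .
qed

lemma aact_Q: "\<lbrakk>q \<in> carrier Q; h \<in> carrier H\<rbrakk> \<Longrightarrow> aact q h \<in> carrier Q"
  using CS_closed by (auto simp: Q_simps aact_cls intro!: imageI actT_CS)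

lemma comult_Q_act:
  assumes q: "q \<in> carrier Q" and h: "h \<in> carrier H"
  shows "comult Q (aact q h) = tensor_act K Q Q aact aact (comult Q q) (comult H h)"
proof -
  let ?i = "\<lambda>m n. H.sw QQ (\<lambda>p r. pQ (aact m p) (aact n r)) h"
  have ic: "?i m n \<in> carrier QQ" if "m \<in> carrier Q" "n \<in> carrier Q" for m n
    by (rule H.sw_closed[OF h vsQQ pure_closed[OF aact_Q aact_Q vsQ vsQ]]) (use that in auto)
  have ta: "tensor_act K Q Q aact aact (comult Q q) (comult H h) = tlift K QQ ?i (comult Q q)"
    by (simp add: tensor_act_def H.sw_def)
  have "incl (tlift K QQ ?i (comult Q q)) = tlift K AA (\<lambda>m n. incl (?i m n)) (comult Q q)"
    by (rule tlift_commute[OF vsQ vsQ comult_Q_closed[OF q] vsQQ vsAA lin_incl2]) (rule ic)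
  also have "\<dots> = tlift K AA (\<lambda>m n. H.sw AA (\<lambda>p r. pA (aact m p) (aact n r)) h) (\<Delta>A q)"
  proof (rule tlift_comult_Q_cong[OF vsAA _ q])
    show "bilin A A AA (\<lambda>m n. H.sw AA (\<lambda>p r. pA (aact m p) (aact n r)) h)"
      by (assumption | rule mlinA h)+
    fix m n assume mn: "m \<in> carrier Q" "n \<in> carrier Q"
    have "incl (?i m n) = H.sw AA (\<lambda>p r. incl (pQ (aact m p) (aact n r))) h"
      by (rule H.sw_commute[OF h lin_incl2 vsQQ vsAA pure_closed[OF aact_Q aact_Q vsQ vsQ]]) (use mn in auto)
    also have "\<dots> = H.sw AA (\<lambda>p r. pA (aact m p) (aact n r)) h"
      by (rule H.sw_cong[OF h vsAA])
        (assumption | rule mlinA Q_A mn | simp add: incl_pure aact_Q mn)+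
    finally show "incl (?i m n) = H.sw AA (\<lambda>p r. pA (aact m p) (aact n r)) h" .
  qed
  also have "\<dots> = \<Delta>A (aact q h)" by (rule \<Delta>A_act[OF Q_A[OF q] h, symmetric])
  also have "\<dots> = incl (comult Q (aact q h))" by (rule incl_comult_Q[OF aact_Q[OF q h], symmetric])
  finally have "incl (tlift K QQ ?i (comult Q q)) = incl (comult Q (aact q h))" .
  hence "retr (incl (tlift K QQ ?i (comult Q q))) = retr (incl (comult Q (aact q h)))" by simp
  moreover have "tlift K QQ ?i (comult Q q) \<in> carrier QQ"
    by (rule tlift_closed[OF vsQ vsQ comult_Q_closed[OF q] vsQQ ic])
  ultimately show ?thesis
    by (simp only: ta retr_incl comult_Q_closed[OF aact_Q[OF q h]])
qed

lemma module_coalgebra_Q: "right_module_coalgebra K H Q aact"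
proof (intro right_module_coalgebra.intro right_module_coalgebra_axioms.intro)
  show "hopf_algebra K H" by (rule H.hopf_algebra_axioms)
  show "coalgebra K Q" by (rule coalgebra_Q)
  show "(\<lambda>q. aact q h) \<in> lin_hom K Q Q" if "h \<in> carrier H" for h
    by (rule lin_into_Q[OF lin_on_Q[OF lin_aact0[OF that]]]) (rule aact_Q[OF _ that])
  show "aact q \<in> lin_hom K H Q" if "q \<in> carrier Q" for q
    by (rule lin_into_Q) (use lin_aact_right[OF Q_A[OF that] lin_id] aact_Q[OF that] in auto)
  show "aact q (g \<otimes>\<^bsub>H\<^esub> h) = aact (aact q g) h" if "q \<in> carrier Q" "g \<in> carrier H" "h \<in> carrier H" for q g h
    by (rule aact_mult[OF Q_A[OF that(1)] that(2,3)])
  show "aact q \<one>\<^bsub>H\<^esub> = q" if "q \<in> carrier Q" for q by (rule aact_one[OF Q_A[OF that]])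
  show "comult Q (aact q h) = tensor_act K Q Q aact aact (comult Q q) (comult H h)"
    if "q \<in> carrier Q" "h \<in> carrier H" for q h by (rule comult_Q_act[OF that])
  show "counit Q (aact q h) = counit Q q \<otimes> counit H h" if "q \<in> carrier Q" "h \<in> carrier H" for q h
    unfolding Q_simps(5) by (rule \<epsilon>A_act[OF Q_A[OF that(1)] that(2)])
qed


section \<open>The cointegral\<close>

lemma kappa_cls: "x \<in> CS \<Longrightarrow> \<kappa> (cls x) = \<kappa>\<^sub>0 x"
  using induced_coset[OF vsTCS subspace_W_TCS H.vsC lin_translation translation_W, of x]
  by (simp add: kappa_def quot_TCS)

lemma kappa_lin: "\<kappa> \<in> L Q H"
  by (rule lin_Q_cls[OF lin_translation kappa_cls])

lemma kappa_cn: "\<lbrakk>c \<in> carrier C; h \<in> carrier H\<rbrakk> \<Longrightarrow> \<kappa> (cls (cn c h)) = counit C c \<odot>\<^bsub>H\<^esub> h"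
  by (simp add: kappa_cls cn_CS translation_cn)

lemma Q_ext:
  assumes f: "f \<in> L Q P" and g: "g \<in> L Q P" and P: "vs P"
    and eq: "\<And>c h. \<lbrakk>c \<in> carrier C; h \<in> carrier H\<rbrakk> \<Longrightarrow> f (cls (cn c h)) = g (cls (cn c h))"
    and q: "q \<in> carrier Q"
  shows "f q = g q"
proof -
  obtain x where x: "x \<in> CS" "q = cls x" using Q_cases[OF q] .
  have "(\<lambda>x. cls x) \<in> L TCS Q"
    by (rule lin_into_Q[OF lin_TCS[OF lin_cls[OF lin_id]]]) (simp add: cls_Q)
  from CS_ext[OF lin_comp[OF f this] lin_comp[OF g this] P eq x(1)] show ?thesis by (simp add: x(2))
qed

lemma kappa_cointegral: "total_cointegral K H Q aact \<kappa>"
  unfolding total_cointegral_def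
proof (intro conjI ballI)
  show "\<kappa> \<in> lin_hom K Q H" by (rule kappa_lin)
  fix q assume q: "q \<in> carrier Q"
  have "counit H (\<kappa> q) = \<epsilon>A q"
  proof (rule Q_ext[OF lin_comp[OF H.counit_linear kappa_lin] lin_on_Q[OF \<epsilon>A_lin] vs_scalar _ q])
    fix c h assume c: "c \<in> carrier C" and h: "h \<in> carrier H"
    show "counit H (\<kappa> (cls (cn c h))) = \<epsilon>A (cls (cn c h))"
      using lin_smult[OF H.counit_linear C.counit_closed[OF c] h]
      by (simp add: kappa_cn c h \<epsilon>A_cls cn_closed \<epsilon>T_cn scalar_module_def)
  qed
  thus "counit H (\<kappa> q) = counit Q q" by (simp add: Q_simps(5))
  fix h assume h: "h \<in> carrier H"
  have l: "(\<lambda>q. aact q h) \<in> L Q Q"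
    by (rule lin_into_Q[OF lin_on_Q[OF lin_aact0[OF h]]]) (rule aact_Q[OF _ h])
  show "\<kappa> (aact q h) = \<kappa> q \<otimes>\<^bsub>H\<^esub> h"
    by (rule Q_ext[OF lin_comp[OF kappa_lin l] lin_Hmult_left[OF h kappa_lin] H.vsC _ q])
      (simp add: aact_cls cn_closed h actT_cn kappa_cn mult_closed H.smult_mult_left C.counit_closed)
qed

text \<open>This expresses that \<open>\<kappa>\<close> is a morphism of coalgebras: it maps the two legs of the comultiplication
  at \<open>cn c h\<close> to \<open>\<epsilon>(c)h\<^sup>2\<close> and \<open>h\<^sup>1\<close>, which may be exchanged by cocommutativity.\<close>

lemma convolution_cn:
  assumes f: "f \<in> L H H" and g: "g \<in> L H H" and c: "c \<in> carrier C" and h: "h \<in> carrier H"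
  shows "convolution K Q H (\<lambda>q. f (\<kappa> q)) (\<lambda>q. g (\<kappa> q)) (cls (cn c h))
    = counit C c \<odot>\<^bsub>H\<^esub> H.sw H (\<lambda>p q. f p \<otimes>\<^bsub>H\<^esub> g q) h"
proof -
  \<comment> \<open>the legs \<open>c\<^sup>1 \<otimes> c\<^sup>3h\<^sup>2\<close> need not lie in the cotensor square one by one, hence \<open>rho\<close>\<close>
  define k where "k = (\<lambda>a. \<kappa> (rho a))"
  have k: "k \<in> L A H" unfolding k_def by (rule lin_comp[OF kappa_lin rho_Q])
  have k_cn: "k (cls (cn c h)) = counit C c \<odot>\<^bsub>H\<^esub> h" if "c \<in> carrier C" "h \<in> carrier H" for c h
    using that by (simp add: k_def rho(3) cls_Q cn_CS kappa_cn)
  note kr = mlinA lin_comp[OF k] lin_comp[OF f] lin_comp[OF g] lin_closed[OF k] lin_closed[OF f] lin_closed[OF g]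
  have b: "bilin A A H (\<lambda>a a'. f (k a) \<otimes>\<^bsub>H\<^esub> g (k a'))" by (assumption | rule kr H.vsC)+
  have "convolution K Q H (\<lambda>q. f (\<kappa> q)) (\<lambda>q. g (\<kappa> q)) (cls (cn c h))
    = tlift K H (\<lambda>a a'. f (k a) \<otimes>\<^bsub>H\<^esub> g (k a')) (\<Delta>A (cls (cn c h)))"
    unfolding convolution_def
    by (rule tlift_comult_Q_cong[OF H.vsC b cls_Q[OF cn_CS[OF c h]]]) (simp add: k_def rho(3))
  also have "\<dots> = H.sw H (\<lambda>p q. C.sw H (\<lambda>x y. C.sw H (\<lambda>w z.
      f (k (cls (pt x (act z q)))) \<otimes>\<^bsub>H\<^esub> g (k (cls (cn w p)))) y) c) h"
    by (simp add: \<Delta>A_cls cn_closed c h tlift_\<Delta>[OF H.vsC b] swA_cn[OF H.vsC b c h])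
  also have "\<dots> = H.sw H (\<lambda>p q. counit C c \<odot>\<^bsub>H\<^esub> (f q \<otimes>\<^bsub>H\<^esub> g p)) h"
  proof (rule H.sw_cong[OF h H.vsC])
    fix p q assume pq: "p \<in> carrier H" "q \<in> carrier H"
    have gp: "g p \<in> carrier H" by (rule lin_closed[OF g pq(1)])
    have "C.sw H (\<lambda>x y. C.sw H (\<lambda>w z. f (k (cls (pt x (act z q)))) \<otimes>\<^bsub>H\<^esub> g (k (cls (cn w p)))) y) c
      = C.sw H (\<lambda>x y. f (k (cls (pt x (act y q)))) \<otimes>\<^bsub>H\<^esub> g p) c" (is "?lhs = _")
    proof (rule C.sw_cong[OF c H.vsC])
      fix x y assume x: "x \<in> carrier C" and y: "y \<in> carrier C"
      have "C.sw H (\<lambda>w z. f (k (cls (pt x (act z q)))) \<otimes>\<^bsub>H\<^esub> g (k (cls (cn w p)))) y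
        = C.sw H (\<lambda>w z. counit C w \<odot>\<^bsub>H\<^esub> (f (k (cls (pt x (act z q)))) \<otimes>\<^bsub>H\<^esub> g p)) y" (is "?lhs = _")
      proof (rule C.sw_cong[OF y H.vsC])
        fix w z assume w: "w \<in> carrier C" and z: "z \<in> carrier C"
        have fk: "f (k (cls (pt x (act z q)))) \<in> carrier H" by (assumption | rule kr x z pq)+
        show "f (k (cls (pt x (act z q)))) \<otimes>\<^bsub>H\<^esub> g (k (cls (cn w p)))
          = counit C w \<odot>\<^bsub>H\<^esub> (f (k (cls (pt x (act z q)))) \<otimes>\<^bsub>H\<^esub> g p)"
          by (simp add: k_cn w pq lin_smult[OF g] C.counit_closed H.smult_mult_right fk gp)
      qed (assumption | rule kr H.vsC x pq gp)+
      also have "\<dots> = f (k (cls (pt x (act y q)))) \<otimes>\<^bsub>H\<^esub> g p" (is "_ = ?rhs")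
        by (rule C.sw_counit_left[OF y H.vsC]) (assumption | rule kr H.vsC x pq gp)+
      finally show "?lhs = ?rhs" .
    qed (assumption | rule kr H.vsC pq gp)+
    also have "\<dots> = f (k (cls (cn c q))) \<otimes>\<^bsub>H\<^esub> g p"
      unfolding cn_def
      by (rule C.sw_commute[OF c, where f = "\<lambda>t. f (k (cls t)) \<otimes>\<^bsub>H\<^esub> g p", symmetric])
        (assumption | rule kr H.vsC pq gp)+
    also have "\<dots> = counit C c \<odot>\<^bsub>H\<^esub> (f q \<otimes>\<^bsub>H\<^esub> g p)" (is "_ = ?rhs")
      by (simp add: k_cn c pq lin_smult[OF f] C.counit_closed H.smult_mult_left lin_closed[OF f] gp)
    finally show "?lhs = ?rhs" .
  qed (assumption | rule kr H.vsC c)+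
  also have "\<dots> = H.sw H (\<lambda>p q. counit C c \<odot>\<^bsub>H\<^esub> (f p \<otimes>\<^bsub>H\<^esub> g q)) h"
    by (rule H.sw_cocomm[OF cocomm h H.vsC]) (assumption | rule kr H.vsC c)+
  also have "\<dots> = counit C c \<odot>\<^bsub>H\<^esub> H.sw H (\<lambda>p q. f p \<otimes>\<^bsub>H\<^esub> g q) h"
    by (rule H.sw_commute[OF h, where f = "\<lambda>x. counit C c \<odot>\<^bsub>H\<^esub> x", symmetric]) (assumption | rule kr H.vsC c)+
  finally show ?thesis .
qed

lemma kappa_invertible: "convolution_invertible K Q H \<kappa>"
proof -
  obtain A' where A': "antipode K H A'" using H.invertible_antipode by blast
  hence a: "A' \<in> L H H"
    and a1: "h \<in> carrier H \<Longrightarrow> H.sw H (\<lambda>x y. A' x \<otimes>\<^bsub>H\<^esub> y) h = counit H h \<odot>\<^bsub>H\<^esub> \<one>\<^bsub>H\<^esub>"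
    and a2: "h \<in> carrier H \<Longrightarrow> H.sw H (\<lambda>x y. x \<otimes>\<^bsub>H\<^esub> A' y) h = counit H h \<odot>\<^bsub>H\<^esub> \<one>\<^bsub>H\<^esub>" for h
    by (auto simp: antipode_def H.sw_def)
  have g: "(\<lambda>q. A' (\<kappa> q)) \<in> L Q H" by (rule lin_comp[OF a kappa_lin])
  have clin: "(\<lambda>q. convolution K Q H f g q) \<in> L Q H" if "f \<in> L Q H" "g \<in> L Q H" for f g
    unfolding convolution_def
    by (rule lin_tlift_arg[OF comult_Q_lin _ vsQ vsQ H.vsC])
      (assumption | rule bilinI lin_Hmult_left lin_Hmult_right that lin_closed[OF that(1)] lin_closed[OF that(2)])+
  have ulin: "(\<lambda>q. counit Q q \<odot>\<^bsub>H\<^esub> \<one>\<^bsub>H\<^esub>) \<in> L Q H"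
    unfolding Q_simps(5) by (rule lin_smult_left[OF lin_on_Q[OF \<epsilon>A_lin] H.one_closed H.vsC])
  have u: "counit C c \<odot>\<^bsub>H\<^esub> (counit H h \<odot>\<^bsub>H\<^esub> \<one>\<^bsub>H\<^esub>) = counit Q (cls (cn c h)) \<odot>\<^bsub>H\<^esub> \<one>\<^bsub>H\<^esub>"
    if "c \<in> carrier C" "h \<in> carrier H" for c h
    using that module.smult_assoc1[OF H.vsC C.counit_closed H.counit_closed H.one_closed, of c h]
    by (simp add: Q_simps(5) \<epsilon>A_cls cn_closed \<epsilon>T_cn)
  have "convolution K Q H \<kappa> (\<lambda>q. A' (\<kappa> q)) q = counit Q q \<odot>\<^bsub>H\<^esub> \<one>\<^bsub>H\<^esub>"
    "convolution K Q H (\<lambda>q. A' (\<kappa> q)) \<kappa> q = counit Q q \<odot>\<^bsub>H\<^esub> \<one>\<^bsub>H\<^esub>" if q: "q \<in> carrier Q" for q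
    by (rule Q_ext[OF clin[OF kappa_lin g] ulin H.vsC _ q],
        use convolution_cn[OF lin_id a] in \<open>simp add: a2 u\<close>)
      (rule Q_ext[OF clin[OF g kappa_lin] ulin H.vsC _ q],
        use convolution_cn[OF a lin_id] in \<open>simp add: a1 u\<close>)
  thus ?thesis unfolding convolution_invertible_def using kappa_lin g by blast
qed

end

theorem lemma3p31:
  fixes K :: "('k, 'r) ring_scheme"
    and H :: "('k, 'h, 'x) coalgebra_scheme"
    and C :: "('k, 'c, 'y) coalgebra_scheme"
    and act :: "'c \<Rightarrow> 'h \<Rightarrow> 'c"
    and I :: "'c set"
    and Q :: "('k, ('c \<times> 'c \<Rightarrow> 'k) set set) coalgebra"
  assumes galois: "hopf_galois_coextension K H C act"
    and cocomm: "cocommutative K H"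
    and I: "I = coideal K H C act"
    and Q: "Q = coinv_coalgebra K C I"
  shows
    "submodule (coinv_rel K C I) K ((tensor K C C)\<lparr>carrier := cotensor_square K C I\<rparr>)
     \<and> (\<forall>x\<in>cotensor_square K C I.
          comult Q (coinv_class K C I x) \<in> carrier (tensor K Q Q)
          \<and> ambient_incl K C I (comult Q (coinv_class K C I x)) = coinv_comult_formula K C I x
          \<and> counit Q (coinv_class K C I x) = coinv_counit_formula K C x
          \<and> (\<forall>h\<in>carrier H. coinv_act K C act I (coinv_class K C I x) h
                = coinv_class K C I (tmap K C C id (\<lambda>c'. act c' h) x))
          \<and> kappa K H C act (coinv_class K C I x) = translation_map K H C act x)
     \<and> right_module_coalgebra K H Q (coinv_act K C act I)
     \<and> total_cointegral K H Q (coinv_act K C act I) (kappa K H C act)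
     \<and> convolution_invertible K Q H (kappa K H C act)"
proof -
  interpret hopf_galois_coextension K H C act by (rule galois)
  interpret galois K H C act I
    by unfold_locales (rule I, rule cocomm)
  show ?thesis
    unfolding Q
    by (intro conjI ballI subspace_W_TCS module_coalgebra_Q kappa_cointegral kappa_invertible
        comult_Q_closed cls_Q kappa_cls)
      (simp_all add: incl_comult_Q cls_Q \<Delta>A_cls CS_closed Q_simps(5) \<epsilon>A_cls aact_cls actT_def)
qed

end
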